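(* Suppose that the functions $H_i$ have continuous second order derivatives with at most polynomial growth at infinity, and that for any $s$ there exists a polynomial $p_s(x)$ such that $\Vert J(s,x)\Vert_{l^\infty}\le|p_s(x)|$ for all $x$. If $F(S)$ has generalised derivatives with at most polynomial growth a.e., then the random variables $$\xi=\frac{1}{\sqrt{\Delta t_1}}\Big(F(S)\Theta^{(1)}(s,Z_1,\sqrt{\Delta t_1}Z_1)-F(\hat S)\Theta^{(1)}(s,Z_1,\sqrt{\Delta t_1}\hat Z_1)\Big),$$ $$\eta_1=\frac{1}{\sqrt{\Delta t_1}}\Big(F(S)\Lambda^{(1)}(s,Z_1,\sqrt{\Delta t_1}Z_1)-F(\hat S)\Lambda^{(1)}(s,Z_1,\sqrt{\Delta t_1}\hat Z_1)\Big)$$ have variance of order $$\mathrm{Var}(\xi)=\mathrm{O}(1),\qquad \mathrm{Var}(\eta_1)=\mathrm{O}(1)\qquad(\Delta t_1\to0).$$ If, in addition, $F(S)$ has second order generalised derivatives with at most polynomial growth a.e., then the random variable $$\eta_2=\frac{1}{\Delta t_1}\Big(F(S)\Lambda^{(2)}(s,Z_1,\sqrt{\Delta t_1}Z_1)-2F(\bar S)\Lambda^{(2)}(s,Z_1,\sqrt{\Delta t_1}\bar Z_1)+F(\hat S)\Lambda^{(2)}(s,Z_1,\sqrt{\Delta t_1}\hat Z_1)\Big)$$ has variance of order $$\mathrm{Var}(\eta_2)=\mathrm{O}(1)\qquad(\Delta t_1\to0).$$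
   Context: Setting. $0=t_0<t_1<\cdots<t_N=T$ are discretisation times, $\Delta t_{i+1}=t_{i+1}-t_i$; in the asymptotics $\Delta t_1=t_1\to0$ the times $t_2,\dots,t_N$ are kept fixed. $Z=(Z_1,\dots,Z_N)$ with $Z_1,\dots,Z_N$ i.i.d. standard normal random (column) vectors in $\mathbb{R}^n$. The $\mathbb{R}^n$-valued process $S$ is defined by $S_{t_{i+1}}=H_i(S_{t_i},\sqrt{\Delta t_{i+1}}Z_{i+1})$, $0\le i<N$, $S_{t_0}=s$, where $s$ is the spot vector (positive spot prices) and $H_i=(H_i^{(1)},\dots,H_i^{(n)})$ are given functions $H_i(s,x)$ (which may depend on $t_{i+1}$ and $\Delta t_{i+1}$). Standing assumption: $H_0(s,x)$ is smooth in $s$ and $x$, and the $n\times n$ matrix $\partial_xH_0$ is invertible. $F:(\mathbb{R}^n)^N\to\mathbb{R}$ is the (measurable) payoff function, with at most polynomial growth at infinity, and $F(S)=F(S_{t_1},\dots,S_{t_N})$. Generalised derivatives are weak derivatives: $\partial_if$ is the generalised derivative of $f$ on $\mathbb{R}^d$ if $\int f\,\partial_ig\,dx=-\int\partial_if\,g\,dx$ for all $g\in C^\infty(\mathbb{R}^d)$ with compact support; the derivatives of $F$ are with respect to its arguments. $\hat Z=(-Z_1,Z_2,\dots,Z_N)$, $\bar Z=(0,Z_2,\dots,Z_N)$ (so $\hat Z_1=-Z_1$, $\bar Z_1=0$), and $\hat S,\bar S$ are defined by $\hat S_{t_{i+1}}=H_i(\hat S_{t_i},\sqrt{\Delta t_{i+1}}\hat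 Z_{i+1})$, $\hat S_{t_0}=s$, and $\bar S_{t_{i+1}}=H_i(\bar S_{t_i},\sqrt{\Delta t_{i+1}}\bar Z_{i+1})$, $\bar S_{t_0}=s$. With $(\partial_sH_0)_{kp}=\partial_{s^{(p)}}H_0^{(k)}$, $(\partial_xH_0)_{kp}=\partial_{x^{(p)}}H_0^{(k)}$, let $J(s,x)=(\partial_xH_0)^{-1}(\partial_sH_0)$; $\Vert A\Vert_{l^\infty}=\max_{i,j}|A_{ij}|$. For $s,z,x\in\mathbb{R}^n$ ($z$, $x$ independent variables), with sums over $\{1,\dots,n\}$ and $J$ evaluated at $(s,x)$: $$\Theta_l^{(1)}(s,z,x)=\sum_pz^{(p)}J_{pl},$$ $$\Lambda_{lm}^{(1)}(s,z,x)=\sum_pz^{(p)}\partial_{s^{(m)}}J_{pl}-\sum_{p,r}z^{(p)}J_{rm}\,\partial_{x^{(r)}}J_{pl}-\sum_{p,r}z^{(p)}\,\partial_{x^{(r)}}J_{rm}\,J_{pl}-\sum_{p,r}z^{(r)}J_{rm}\,\partial_{x^{(p)}}J_{pl},$$ $$\Lambda_{lm}^{(2)}(s,z,x)=\sum_{p,r}(z^{(r)}z^{(p)}-\delta_{rp})J_{rm}J_{pl}.$$ Thus $\Theta^{(1)}$ is vector-valued and $\Lambda^{(1)},\Lambda^{(2)}$ are matrix-valued; variances and their orders are understood entrywise.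
   Formalization: F is assumed continuous; for η1 the first partial derivatives of J are also assumed polynomially bounded in x; where H_i depends on Δt_1, the smoothness, growth, inverse and p_s bounds are assumed uniform for small Δt_1. The claim fails without these. *)

theory Defs
  imports "HOL-Probability.Probability" "HOL-Library.Landau_Symbols"
begin

definition dird :: "'a::real_normed_vector \<Rightarrow> ('a \<Rightarrow> 'b::real_normed_vector) \<Rightarrow> 'a \<Rightarrow> 'b" where
  "dird b f x = frechet_derivative f (at x) b"

definition iter_pd :: "'a::real_normed_vector list \<Rightarrow> ('a \<Rightarrow> 'b::real_normed_vector) \<Rightarrow> 'a \<Rightarrow> 'b" where
  "iter_pd bs f = foldr dird bs f"

text \<open>
  The differentiability clause makes sure that the total function
  \<^const>\<open>frechet_derivative\<close> is only used where it is meaningful.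
\<close>

definition C_k :: "nat \<Rightarrow> ('a::euclidean_space \<Rightarrow> 'b::real_normed_vector) \<Rightarrow> bool" where
  "C_k k f \<longleftrightarrow> (\<forall>bs. set bs \<subseteq> Basis \<longrightarrow>
     (length bs < k \<longrightarrow> (\<forall>x. iter_pd bs f differentiable (at x))) \<and>
     (length bs \<le> k \<longrightarrow> continuous_on UNIV (iter_pd bs f)))"

definition C_inf :: "('a::euclidean_space \<Rightarrow> 'b::real_normed_vector) \<Rightarrow> bool" where
  "C_inf f \<longleftrightarrow> (\<forall>k. C_k k f)"

definition test_function :: "('a::euclidean_space \<Rightarrow> real) \<Rightarrow> bool" where
  "test_function g \<longleftrightarrow> C_inf g \<and> compact (closure {x. g x \<noteq> 0})"

text \<open>
  \<open>weak_pd b f f'\<close>: the function \<open>f'\<close> is the generalised partial derivative of \<open>f\<close> in the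
  coordinate direction \<open>b\<close>.  The integrability clauses exclude the convention that
  non-integrable functions have integral \<open>0\<close>.
\<close>

definition weak_pd :: "'a::euclidean_space \<Rightarrow> ('a \<Rightarrow> real) \<Rightarrow> ('a \<Rightarrow> real) \<Rightarrow> bool" where
  "weak_pd b f f' \<longleftrightarrow> (\<forall>g. test_function g \<longrightarrow>
     integrable lborel (\<lambda>x. f x * dird b g x) \<and>
     integrable lborel (\<lambda>x. f' x * g x) \<and>
     (LINT x|lborel. f x * dird b g x) = - (LINT x|lborel. f' x * g x))"

text \<open>
  The growth bounds are global: unlike a bound near infinity only, \<open>poly_growth_ae\<close> excludes
  local singularities of a generalised derivative.
\<close>

definition poly_growth :: "('a::real_normed_vector \<Rightarrow> 'b::real_normed_vector) \<Rightarrow> bool" where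
  "poly_growth f \<longleftrightarrow> (\<exists>C k. \<forall>x. norm (f x) \<le> C * (1 + norm x) ^ k)"

definition poly_growth_ae :: "('a::euclidean_space \<Rightarrow> real) \<Rightarrow> bool" where
  "poly_growth_ae f \<longleftrightarrow> (\<exists>C k. AE x in lborel. \<bar>f x\<bar> \<le> C * (1 + norm x) ^ k)"

definition weak_diff1 :: "('a::euclidean_space \<Rightarrow> real) \<Rightarrow> bool" where
  "weak_diff1 f \<longleftrightarrow> (\<forall>b\<in>Basis. \<exists>f'. weak_pd b f f' \<and> poly_growth_ae f')"

definition weak_diff2 :: "('a::euclidean_space \<Rightarrow> real) \<Rightarrow> bool" where
  "weak_diff2 f \<longleftrightarrow> (\<forall>b\<in>Basis. \<exists>f'. weak_pd b f f' \<and> poly_growth_ae f' \<and>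
     (\<forall>c\<in>Basis. \<exists>f''. weak_pd c f' f'' \<and> poly_growth_ae f''))"

text \<open>
  Families indexed by the first time step \<open>h\<close>, which tends to \<open>0\<close> from the right: the bounds
  do not depend on \<open>h\<close>.  For a family that is constant in \<open>h\<close> the first notion is
  \<^const>\<open>poly_growth\<close>, and the second holds for every continuous function.
\<close>

definition unif_poly_growth ::
  "(real \<Rightarrow> 'a::real_normed_vector \<Rightarrow> 'b::real_normed_vector) \<Rightarrow> bool" where
  "unif_poly_growth f \<longleftrightarrow>
     (\<exists>C k. \<forall>\<^sub>F h in at_right 0. \<forall>x. norm (f h x) \<le> C * (1 + norm x) ^ k)"

definition unif_loc_bounded ::
  "(real \<Rightarrow> 'a::real_normed_vector \<Rightarrow> 'b::real_normed_vector) \<Rightarrow> bool" where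
  "unif_loc_bounded f \<longleftrightarrow>
     (\<forall>K. compact K \<longrightarrow> (\<exists>C. \<forall>\<^sub>F h in at_right 0. \<forall>x\<in>K. norm (f h x) \<le> C))"

text \<open>
  A scheme \<open>H\<close> takes the index \<open>i\<close>, the time \<open>t (i + 1)\<close>, the step \<open>t (i + 1) - t i\<close>, and
  then the arguments \<open>s\<close> and \<open>x\<close> of the function \<open>H\<close> with index \<open>i\<close>.
\<close>

type_synonym 'n scheme = "nat \<Rightarrow> real \<Rightarrow> real \<Rightarrow> real^'n \<Rightarrow> real^'n \<Rightarrow> real^'n"

definition dt :: "(nat \<Rightarrow> real) \<Rightarrow> nat \<Rightarrow> real" where
  "dt t i = t i - t (i - 1)"

definition step :: "(nat \<Rightarrow> real) \<Rightarrow> 'n::finite scheme \<Rightarrow> nat \<Rightarrow> real^'n \<Rightarrow> real^'n \<Rightarrow> real^'n" where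
  "step t H i = H i (t (Suc i)) (dt t (Suc i))"

primrec path :: "(nat \<Rightarrow> real) \<Rightarrow> 'n::finite scheme \<Rightarrow> real^'n \<Rightarrow> (nat \<Rightarrow> real^'n) \<Rightarrow> nat \<Rightarrow> real^'n"
where
  "path t H s z 0 = s"
| "path t H s z (Suc i) = step t H i (path t H s z i) (sqrt (dt t (Suc i)) *\<^sub>R z (Suc i))"

text \<open>
  The argument of the payoff is a tuple indexed by a finite linearly ordered type \<open>'m\<close> with
  \<open>N = CARD('m)\<close>: the \<open>k\<close>-th smallest element \<open>j\<close> of \<open>'m\<close>, for which \<open>card {..j} = k\<close>,
  carries the state at time \<open>t k\<close>.
\<close>

definition states ::
  "(nat \<Rightarrow> real) \<Rightarrow> 'n::finite scheme \<Rightarrow> real^'n \<Rightarrow> (nat \<Rightarrow> real^'n) \<Rightarrow> real^'n^'m::{finite,linorder}"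
where
  "states t H s z = (\<chi> j. path t H s z (card {..j}))"

definition hat :: "(nat \<Rightarrow> real^'n) \<Rightarrow> nat \<Rightarrow> real^'n" where
  "hat z = z(1 := - z 1)"

definition bar :: "(nat \<Rightarrow> real^'n) \<Rightarrow> nat \<Rightarrow> real^'n" where
  "bar z = z(1 := 0)"

definition dsH :: "(real^'n \<Rightarrow> real^'n \<Rightarrow> real^'n) \<Rightarrow> real^'n \<Rightarrow> real^'n \<Rightarrow> real^'n::finite^'n" where
  "dsH H0 s x = jacobian (\<lambda>u. H0 u x) (at s)"

definition dxH :: "(real^'n \<Rightarrow> real^'n \<Rightarrow> real^'n) \<Rightarrow> real^'n \<Rightarrow> real^'n \<Rightarrow> real^'n::finite^'n" where
  "dxH H0 s x = jacobian (\<lambda>y. H0 s y) (at x)"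

definition Jmat :: "(real^'n \<Rightarrow> real^'n \<Rightarrow> real^'n) \<Rightarrow> real^'n \<Rightarrow> real^'n \<Rightarrow> real^'n::finite^'n" where
  "Jmat H0 s x = matrix_inv (dxH H0 s x) ** dsH H0 s x"

text \<open>
  \<open>dsJ H0 m p l s x\<close> and \<open>dxJ H0 m p l s x\<close> are the partial derivatives of the entry
  \<open>(p, l)\<close> of \<open>J\<close> with respect to the \<open>m\<close>-th component of \<open>s\<close> and of \<open>x\<close>.
\<close>

definition dsJ ::
  "(real^'n \<Rightarrow> real^'n \<Rightarrow> real^'n) \<Rightarrow> 'n::finite \<Rightarrow> 'n \<Rightarrow> 'n \<Rightarrow> real^'n \<Rightarrow> real^'n \<Rightarrow> real" where
  "dsJ H0 m p l s x = dird (axis m 1) (\<lambda>u. Jmat H0 u x $ p $ l) s"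

definition dxJ ::
  "(real^'n \<Rightarrow> real^'n \<Rightarrow> real^'n) \<Rightarrow> 'n::finite \<Rightarrow> 'n \<Rightarrow> 'n \<Rightarrow> real^'n \<Rightarrow> real^'n \<Rightarrow> real" where
  "dxJ H0 m p l s x = dird (axis m 1) (\<lambda>y. Jmat H0 s y $ p $ l) x"

definition Theta1 ::
  "(real^'n \<Rightarrow> real^'n \<Rightarrow> real^'n) \<Rightarrow> real^'n \<Rightarrow> real^'n \<Rightarrow> real^'n \<Rightarrow> real^'n::finite" where
  "Theta1 H0 s z x = (\<chi> l. \<Sum>p\<in>UNIV. z $ p * Jmat H0 s x $ p $ l)"

definition Lambda1 ::
  "(real^'n \<Rightarrow> real^'n \<Rightarrow> real^'n) \<Rightarrow> real^'n \<Rightarrow> real^'n \<Rightarrow> real^'n \<Rightarrow> real^'n::finite^'n" where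
  "Lambda1 H0 s z x = (\<chi> l m.
      (\<Sum>p\<in>UNIV. z $ p * dsJ H0 m p l s x)
    - (\<Sum>p\<in>UNIV. \<Sum>r\<in>UNIV. z $ p * Jmat H0 s x $ r $ m * dxJ H0 r p l s x)
    - (\<Sum>p\<in>UNIV. \<Sum>r\<in>UNIV. z $ p * dxJ H0 r r m s x * Jmat H0 s x $ p $ l)
    - (\<Sum>p\<in>UNIV. \<Sum>r\<in>UNIV. z $ r * Jmat H0 s x $ r $ m * dxJ H0 p p l s x))"

definition Lambda2 ::
  "(real^'n \<Rightarrow> real^'n \<Rightarrow> real^'n) \<Rightarrow> real^'n \<Rightarrow> real^'n \<Rightarrow> real^'n \<Rightarrow> real^'n::finite^'n" where
  "Lambda2 H0 s z x = (\<chi> l m.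
      \<Sum>p\<in>UNIV. \<Sum>r\<in>UNIV. (z $ r * z $ p - (if r = p then 1 else 0)) *
        Jmat H0 s x $ r $ m * Jmat H0 s x $ p $ l)"

definition xi ::
  "(real^'n^'m::{finite,linorder} \<Rightarrow> real) \<Rightarrow> (nat \<Rightarrow> real) \<Rightarrow> 'n::finite scheme \<Rightarrow> real^'n
    \<Rightarrow> (nat \<Rightarrow> real^'n) \<Rightarrow> real^'n" where
  "xi F t H s z = (1 / sqrt (dt t 1)) *\<^sub>R
     (F (states t H s z) *\<^sub>R Theta1 (step t H 0) s (z 1) (sqrt (dt t 1) *\<^sub>R z 1)
    - F (states t H s (hat z)) *\<^sub>R Theta1 (step t H 0) s (z 1) (sqrt (dt t 1) *\<^sub>R hat z 1))"

definition eta1 ::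
  "(real^'n^'m::{finite,linorder} \<Rightarrow> real) \<Rightarrow> (nat \<Rightarrow> real) \<Rightarrow> 'n::finite scheme \<Rightarrow> real^'n
    \<Rightarrow> (nat \<Rightarrow> real^'n) \<Rightarrow> real^'n^'n" where
  "eta1 F t H s z = (1 / sqrt (dt t 1)) *\<^sub>R
     (F (states t H s z) *\<^sub>R Lambda1 (step t H 0) s (z 1) (sqrt (dt t 1) *\<^sub>R z 1)
    - F (states t H s (hat z)) *\<^sub>R Lambda1 (step t H 0) s (z 1) (sqrt (dt t 1) *\<^sub>R hat z 1))"

definition eta2 ::
  "(real^'n^'m::{finite,linorder} \<Rightarrow> real) \<Rightarrow> (nat \<Rightarrow> real) \<Rightarrow> 'n::finite scheme \<Rightarrow> real^'n
    \<Rightarrow> (nat \<Rightarrow> real^'n) \<Rightarrow> real^'n^'n" where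
  "eta2 F t H s z = (1 / dt t 1) *\<^sub>R
     (F (states t H s z) *\<^sub>R Lambda2 (step t H 0) s (z 1) (sqrt (dt t 1) *\<^sub>R z 1)
    - (2 * F (states t H s (bar z))) *\<^sub>R Lambda2 (step t H 0) s (z 1) (sqrt (dt t 1) *\<^sub>R bar z 1)
    + F (states t H s (hat z)) *\<^sub>R Lambda2 (step t H 0) s (z 1) (sqrt (dt t 1) *\<^sub>R hat z 1))"

definition std_normal_vector :: "'w measure \<Rightarrow> ('w \<Rightarrow> real^'n::finite) \<Rightarrow> bool" where
  "std_normal_vector M X \<longleftrightarrow>
     distributed M lborel X (\<lambda>x. ennreal (\<Prod>j\<in>UNIV. std_normal_density (x $ j)))"

text \<open>
  \<open>Var (X h) = O(1)\<close> as \<open>h\<close> tends to \<open>0\<close> from the right.  Square integrability is required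
  explicitly, because the Bochner integral of a non-integrable function is \<open>0\<close>.
\<close>

definition var_O1 :: "'w measure \<Rightarrow> (real \<Rightarrow> 'w \<Rightarrow> real) \<Rightarrow> bool" where
  "var_O1 M X \<longleftrightarrow>
     (\<forall>\<^sub>F h in at_right 0. X h \<in> borel_measurable M \<and> integrable M (\<lambda>\<omega>. (X h \<omega>)\<^sup>2)) \<and>
     (\<lambda>h. prob_space.variance M (X h)) \<in> O[at_right 0](\<lambda>_. 1)"

end

theory Submission
  imports Defs
begin

text \<open>
  With \<open>y = sqrt h Z\<^sub>1\<close>, where \<open>h\<close> is the first time step, every estimator is a sum of products of a
  polynomial in \<open>Z\<^sub>1\<close>, the same at all evaluation points, with a symmetric difference of a function of
  \<open>y\<close>: the payoff along the path times a polynomial in entries of \<open>J\<close> and, for \<open>\<eta>\<^sub>1\<close>, of its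
  derivatives.  For \<open>\<xi>\<close> and \<open>\<eta>\<^sub>1\<close> the difference is taken between \<open>y\<close> and \<open>- y\<close> and
  divided by \<open>sqrt h\<close>; for \<open>\<eta>\<^sub>2\<close> it is the second difference at \<open>y\<close>, \<open>0\<close>, \<open>- y\<close>, divided by
  \<open>h\<close>.  Since the first difference of a Lipschitz function is \<open>O(\<bar>y\<bar>)\<close> and the second difference of a
  function with Lipschitz gradient is \<open>O(\<bar>y\<bar>\<^sup>2)\<close>, the power of \<open>sqrt h\<close> cancels.  What remains is
  bounded, uniformly in \<open>h\<close>, by a power of the weight \<open>1 + \<bar>Z\<^sub>1\<bar> + \<dots> + \<bar>Z\<^sub>N\<bar>\<close>, which has all moments;
  the second moment bounds the variance.  Three points need an argument.

  The payoff is only weakly differentiable, and the law of the path may be singular, so that values of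
  a generalised derivative along the path are meaningless.  But mollifying a continuous function turns
  bounds on its generalised derivatives into bounds on classical derivatives, uniformly in the width of
  the mollifier, and these integrate to inequalities between values of the function, which survive the
  limit: \<open>weak_diff1_imp_lip_poly\<close> and \<open>weak_diff2_imp_lip2_poly\<close>.

  Only \<open>J\<close> itself, and for \<open>\<eta>\<^sub>1\<close> its first derivatives, have polynomial growth; nothing is assumed about
  the growth of the further derivatives of \<open>J\<close> that the difference estimates would consume.  For \<open>\<bar>y\<bar> \<le> 1\<close> local
  bounds suffice, and they follow from the smoothness of the first step and from the derivative formula
  of the inverse matrix (\<open>unif_C_matrix_inv\<close>).  For \<open>\<bar>y\<bar> > 1\<close> the growth bound alone does, because
  then \<open>1 < \<bar>y\<bar>\<^sup>p\<close> (\<open>small_diff_local\<close>).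

  The estimates have to pass through the recursion of the scheme, the payoff and the products.  The
  predicate \<open>small_diff\<close> records growth together with the orders of the differences, and is closed
  under multiplication and under composition with functions whose first and second differences are
  controlled with polynomially growing constants
  (\<open>small_diff_compose\<close>, \<open>small_diff_mult\<close>); \<open>var_O1_weighted_symm_diff\<close> combines everything for the
  common form of the three estimators.
\<close>

section \<open>Directional derivatives and difference bounds\<close>

lemma dird_eqI:
  assumes "(f has_derivative D) (at x)"
  shows "dird b f x = D b"
  using frechet_derivative_at[OF assms] by (simp add: dird_def)

lemma dird_const: "dird b (\<lambda>x. c) x = 0"
  using dird_eqI[OF has_derivative_const] .

lemma dird_add:
  assumes "f differentiable at x" "g differentiable at x"
  shows "dird b (\<lambda>x. f x + g x) x = dird b f x + dird b g x"
  unfolding dird_def[of b f] dird_def[of b g]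
  by (rule dird_eqI) (intro has_derivative_add assms[unfolded frechet_derivative_works])

lemma dird_mult:
  fixes f g :: "'a::real_normed_vector \<Rightarrow> real"
  assumes "f differentiable at x" "g differentiable at x"
  shows "dird b (\<lambda>x. f x * g x) x = f x * dird b g x + dird b f x * g x"
  unfolding dird_def[of b f] dird_def[of b g]
  by (rule dird_eqI) (intro has_derivative_mult assms[unfolded frechet_derivative_works])

lemma dird_bounded_linear:
  assumes "f differentiable at x" "bounded_linear L"
  shows "dird b (\<lambda>x. L (f x)) x = L (dird b f x)"
  unfolding dird_def[of b f]
  by (rule dird_eqI)
    (intro bounded_linear.has_derivative[OF assms(2)] assms(1)[unfolded frechet_derivative_works])

lemma dird_cmult:
  fixes f :: "'a::real_normed_vector \<Rightarrow> real"
  assumes "f differentiable at x"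
  shows "(\<lambda>x. c * f x) differentiable at x" "dird b (\<lambda>x. c * f x) x = c * dird b f x"
proof -
  have D: "((\<lambda>x. c * f x) has_derivative (\<lambda>v. c * frechet_derivative f (at x) v)) (at x)"
    by (rule has_derivative_mult_right) (use assms in \<open>simp add: frechet_derivative_works\<close>)
  then show "(\<lambda>x. c * f x) differentiable at x" by (rule differentiableI)
  show "dird b (\<lambda>x. c * f x) x = c * dird b f x"
    using dird_eqI[OF D, of b] by (simp add: dird_def[of b f])
qed

lemma dird_translate:
  assumes "f differentiable at (y - x)"
  shows "dird b (\<lambda>y. f (y - x)) y = dird b f (y - x)"
proof -
  have "((\<lambda>y. f (y - x)) has_derivative frechet_derivative f (at (y - x))) (at y)"
    by (rule has_derivative_compose[of "\<lambda>y. y - x" "\<lambda>v. v"])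
      (use assms in \<open>auto simp: frechet_derivative_works intro!: derivative_eq_intros\<close>)
  from dird_eqI[OF this] show ?thesis by (simp add: dird_def)
qed

lemma dird_partial:
  fixes f :: "'a::real_normed_vector \<times> 'b::real_normed_vector \<Rightarrow> 'c::real_normed_vector"
  assumes "f differentiable at (u, x)"
  shows "dird a (\<lambda>v. f (v, x)) u = dird (a, 0) f (u, x)"
    and "dird b (\<lambda>y. f (u, y)) x = dird (0, b) f (u, x)"
proof -
  have D: "(f has_derivative frechet_derivative f (at (u, x))) (at (u, x))"
    using assms by (simp add: frechet_derivative_works)
  have "((\<lambda>v. f (v, x)) has_derivative (\<lambda>w. frechet_derivative f (at (u, x)) (w, 0))) (at u)"
    by (rule has_derivative_compose[of "\<lambda>v. (v, x)" "\<lambda>w. (w, 0)", OF _ D])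
      (auto intro!: derivative_eq_intros)
  from dird_eqI[OF this] show "dird a (\<lambda>v. f (v, x)) u = dird (a, 0) f (u, x)"
    by (simp add: dird_def)
  have "((\<lambda>y. f (u, y)) has_derivative (\<lambda>w. frechet_derivative f (at (u, x)) (0, w))) (at x)"
    by (rule has_derivative_compose[of "\<lambda>y. (u, y)" "\<lambda>w. (0, w)", OF _ D])
      (auto intro!: derivative_eq_intros)
  from dird_eqI[OF this] show "dird b (\<lambda>y. f (u, y)) x = dird (0, b) f (u, x)"
    by (simp add: dird_def)
qed

lemma frechet_derivative_eq_sum_dird:
  fixes f :: "'a::euclidean_space \<Rightarrow> 'b::real_normed_vector"
  assumes "f differentiable at x"
  shows "frechet_derivative f (at x) v = (\<Sum>b\<in>Basis. (v \<bullet> b) *\<^sub>R dird b f x)"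
proof -
  have lin: "linear (frechet_derivative f (at x))"
    using assms by (rule linear_frechet_derivative)
  have "frechet_derivative f (at x) v = frechet_derivative f (at x) (\<Sum>b\<in>Basis. (v \<bullet> b) *\<^sub>R b)"
    by (simp add: euclidean_representation)
  also have "\<dots> = (\<Sum>b\<in>Basis. (v \<bullet> b) *\<^sub>R dird b f x)"
    by (simp add: linear_sum[OF lin] linear_scale[OF lin] dird_def)
  finally show ?thesis .
qed

lemma has_derivative_sum_dird:
  fixes f :: "'a::euclidean_space \<Rightarrow> 'b::real_normed_vector"
  assumes "f differentiable at x"
  shows "(f has_derivative (\<lambda>v. \<Sum>b\<in>Basis. (v \<bullet> b) *\<^sub>R dird b f x)) (at x)"
proof -
  have "frechet_derivative f (at x) = (\<lambda>v. \<Sum>b\<in>Basis. (v \<bullet> b) *\<^sub>R dird b f x)"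
    using frechet_derivative_eq_sum_dird[OF assms] by blast
  then show ?thesis
    using assms[unfolded frechet_derivative_works] by (simp only:)
qed

lemma norm_sum_dird_le:
  fixes D :: "'a::euclidean_space \<Rightarrow> 'b::real_normed_vector"
  assumes "\<And>b. b \<in> Basis \<Longrightarrow> norm (D b) \<le> B"
  shows "norm (\<Sum>b\<in>Basis. (v \<bullet> b) *\<^sub>R D b) \<le> real DIM('a) * B * norm v"
proof -
  have "norm (\<Sum>b\<in>Basis. (v \<bullet> b) *\<^sub>R D b) \<le> (\<Sum>b\<in>(Basis::'a set). norm v * B)"
    using assms by (intro sum_norm_le) (auto intro!: mult_mono Basis_le_norm)
  then show ?thesis by (simp add: mult_ac)
qed

lemma increment_bound:
  fixes f :: "'a::euclidean_space \<Rightarrow> 'b::real_normed_vector"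
  assumes U: "convex U" "a \<in> U" "b \<in> U"
    and f: "\<And>x. x \<in> U \<Longrightarrow> f differentiable at x"
    and B: "\<And>e x. e \<in> Basis \<Longrightarrow> x \<in> U \<Longrightarrow> norm (dird e f x) \<le> B"
  shows "norm (f a - f b) \<le> real DIM('a) * B * norm (a - b)"
proof (rule differentiable_bound[OF U(1) _ _ U(2,3)])
  fix x assume "x \<in> U"
  then show "(f has_derivative (\<lambda>v. \<Sum>b\<in>Basis. (v \<bullet> b) *\<^sub>R dird b f x)) (at x within U)"
    by (rule has_derivative_at_withinI[OF has_derivative_sum_dird[OF f]])
  show "onorm (\<lambda>v. \<Sum>b\<in>Basis. (v \<bullet> b) *\<^sub>R dird b f x) \<le> real DIM('a) * B"
    by (rule onorm_le) (intro norm_sum_dird_le B \<open>x \<in> U\<close>)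
qed

lemma C_k_continuous:
  assumes "C_k k f"
  shows "continuous_on UNIV f"
  using assms[unfolded C_k_def, rule_format, of "[]"] by (simp add: iter_pd_def)

text \<open>
  Along the two segments from \<open>b\<close> to \<open>a\<close> and from \<open>b\<close> to \<open>c\<close>, traversed simultaneously, the
  derivative of the sum of the two values splits into the derivative of \<open>f\<close> in the direction
  \<open>a - 2 b + c\<close> and the variation of the derivative between the two segments.
\<close>

lemma second_difference_bound:
  fixes f :: "'a::euclidean_space \<Rightarrow> 'b::real_normed_vector"
  assumes U: "convex U" "a \<in> U" "b \<in> U" "c \<in> U"
    and f: "\<And>x. x \<in> U \<Longrightarrow> f differentiable at x"
    and f2: "\<And>e x. e \<in> Basis \<Longrightarrow> x \<in> U \<Longrightarrow> dird e f differentiable at x"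
    and B: "\<And>e x. e \<in> Basis \<Longrightarrow> x \<in> U \<Longrightarrow> norm (dird e f x) \<le> B"
    and B2: "\<And>e e' x. e \<in> Basis \<Longrightarrow> e' \<in> Basis \<Longrightarrow> x \<in> U \<Longrightarrow> norm (dird e' (dird e f) x) \<le> B"
  shows "norm (f a - 2 *\<^sub>R f b + f c) \<le>
    2 * (real DIM('a))\<^sup>2 * B * (norm (a - 2 *\<^sub>R b + c) + (norm (a - b))\<^sup>2 + (norm (c - b))\<^sup>2)"
proof -
  define n where "n = real DIM('a)"
  have n1: "1 \<le> n" using DIM_positive[where 'a='a] unfolding n_def by linarith
  obtain e0 :: 'a where "e0 \<in> Basis" using SOME_Basis by blast
  from B[OF this U(2)] have B0: "0 \<le> B" by (meson norm_ge_zero order_trans)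
  define d where "d = a - b"
  define e where "e = c - b"
  define D where "D x v = (\<Sum>i\<in>Basis. (v \<bullet> i) *\<^sub>R dird i f x)" for x v
  define E where "E = norm (d + e) + (norm d)\<^sup>2 + (norm e)\<^sup>2"
  define p where "p = (\<lambda>t. f (b + t *\<^sub>R d) + f (b + t *\<^sub>R e))"
  have in1: "b + t *\<^sub>R d \<in> U" and in2: "b + t *\<^sub>R e \<in> U" if "t \<in> {0..1}" for t
    using convexD_alt[OF U(1,3,2), of t] convexD_alt[OF U(1,3,4), of t] that
    by (auto simp: d_def e_def algebra_simps)
  have "norm (p 1 - p 0) \<le> 2 * n\<^sup>2 * B * E * norm (1 - 0 :: real)"
  proof (rule differentiable_bound[of "{0..1}"])
    fix t :: real assume t: "t \<in> {0..1}"
    note i1 = in1[OF t] and i2 = in2[OF t]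
    have h: "((\<lambda>t. f (b + t *\<^sub>R w)) has_derivative (\<lambda>s. D (b + t *\<^sub>R w) (s *\<^sub>R w))) (at t)"
      if "b + t *\<^sub>R w \<in> U" for w
    proof -
      have 1: "(f has_derivative D (b + t *\<^sub>R w)) (at (b + t *\<^sub>R w))"
        unfolding D_def by (intro has_derivative_sum_dird f that)
      have 2: "((\<lambda>t. b + t *\<^sub>R w) has_derivative (\<lambda>s. s *\<^sub>R w)) (at t)"
        by (auto intro!: derivative_eq_intros)
      show ?thesis
        by (rule has_derivative_compose[OF 2 1])
    qed
    show "(p has_derivative (\<lambda>s. D (b + t *\<^sub>R d) (s *\<^sub>R d) + D (b + t *\<^sub>R e) (s *\<^sub>R e)))
        (at t within {0..1})"
      unfolding p_def by (rule has_derivative_at_withinI[OF has_derivative_add[OF h[OF i1] h[OF i2]]])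
    show "onorm (\<lambda>s. D (b + t *\<^sub>R d) (s *\<^sub>R d) + D (b + t *\<^sub>R e) (s *\<^sub>R e)) \<le> 2 * n\<^sup>2 * B * E"
    proof (rule onorm_le)
      fix s :: real
      let ?x = "b + t *\<^sub>R d" and ?y = "b + t *\<^sub>R e"
      have eq: "D ?x (s *\<^sub>R d) + D ?y (s *\<^sub>R e)
          = s *\<^sub>R (D ?y (d + e) + (\<Sum>i\<in>Basis. (d \<bullet> i) *\<^sub>R (dird i f ?x - dird i f ?y)))"
        unfolding D_def
        by (simp add: inner_add_left scaleR_add_left scaleR_diff_right sum.distrib sum_subtractf
            scaleR_sum_right scaleR_add_right)
      have le1: "norm (D ?y (d + e)) \<le> n * B * norm (d + e)"
        unfolding D_def n_def by (intro norm_sum_dird_le B i2)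
      have le2: "norm (\<Sum>i\<in>Basis. (d \<bullet> i) *\<^sub>R (dird i f ?x - dird i f ?y))
          \<le> n * (n * B * (norm d + norm e)) * norm d"
        unfolding n_def
      proof (rule norm_sum_dird_le)
        fix i :: 'a assume i: "i \<in> Basis"
        have "norm (dird i f ?x - dird i f ?y) \<le> real DIM('a) * B * norm (?x - ?y)"
          by (rule increment_bound[OF U(1) i1 i2]) (auto intro: f2 B2 i)
        also have "norm (?x - ?y) \<le> t * (norm d + norm e)"
          using t norm_triangle_ineq4[of "t *\<^sub>R d" "t *\<^sub>R e"] by (simp add: algebra_simps)
        also have "\<dots> \<le> 1 * (norm d + norm e)"
          using t by (intro mult_right_mono) auto
        finally show "norm (dird i f ?x - dird i f ?y) \<le> real DIM('a) * B * (norm d + norm e)"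
          using B0 by (simp add: mult_left_mono)
      qed
      have le3: "n * B * norm (d + e) + n * (n * B * (norm d + norm e)) * norm d
          \<le> 2 * n\<^sup>2 * B * E"
      proof -
        have "n * B * norm (d + e) \<le> n\<^sup>2 * B * norm (d + e)"
          using n1 B0 by (intro mult_right_mono) (auto simp: power2_eq_square)
        moreover have "0 \<le> n\<^sup>2 * B * norm (d + e)"
          using B0 by simp
        \<comment> \<open>The difference is (|d| - |e|)^2 / 2 + |d|^2 / 2 + 3 |e|^2 / 2.\<close>
        moreover have "(norm d + norm e) * norm d \<le> 2 * ((norm d)\<^sup>2 + (norm e)\<^sup>2)"
        proof -
          have "0 \<le> (norm d - norm e)\<^sup>2 / 2 + (norm d)\<^sup>2 / 2 + 3 / 2 * (norm e)\<^sup>2"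
            by simp
          also have "\<dots> = 2 * ((norm d)\<^sup>2 + (norm e)\<^sup>2) - (norm d + norm e) * norm d"
            by (simp add: power2_eq_square field_simps)
          finally show ?thesis by simp
        qed
        then have "n\<^sup>2 * B * ((norm d + norm e) * norm d) \<le> n\<^sup>2 * B * (2 * ((norm d)\<^sup>2 + (norm e)\<^sup>2))"
          using B0 by (intro mult_left_mono) auto
        ultimately show ?thesis
          unfolding E_def by (simp add: algebra_simps power2_eq_square)
      qed
      have le: "norm (D ?y (d + e) + (\<Sum>i\<in>Basis. (d \<bullet> i) *\<^sub>R (dird i f ?x - dird i f ?y)))
          \<le> 2 * n\<^sup>2 * B * E"
        by (rule order_trans[OF norm_triangle_ineq]) (use le1 le2 le3 in linarith)
      show "norm (D ?x (s *\<^sub>R d) + D ?y (s *\<^sub>R e)) \<le> 2 * n\<^sup>2 * B * E * norm s"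
        unfolding eq norm_scaleR using mult_left_mono[OF le abs_ge_zero[of s]]
        by (simp add: mult_ac)
    qed
  qed auto
  moreover have "p 1 - p 0 = f a - 2 *\<^sub>R f b + f c"
    by (simp add: p_def d_def e_def scaleR_2)
  moreover have "E = norm (a - 2 *\<^sub>R b + c) + (norm (a - b))\<^sup>2 + (norm (c - b))\<^sup>2"
  proof -
    have "d + e = a - 2 *\<^sub>R b + c"
      by (simp add: d_def e_def scaleR_2)
    then show ?thesis by (simp only: E_def) (simp only: d_def e_def)
  qed
  ultimately show ?thesis by (simp add: n_def)
qed

definition lip_poly :: "real \<Rightarrow> nat \<Rightarrow> ('a::real_normed_vector \<Rightarrow> 'b::real_normed_vector) \<Rightarrow> bool" where
  "lip_poly C k f \<longleftrightarrow> (\<forall>a b. norm (f a - f b) \<le> C * (1 + norm a + norm b) ^ k * norm (a - b))"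

text \<open>
  In a second difference of a twice differentiable function, the first derivative sees the second
  difference of the arguments and the second derivative the squares of their increments.  Both terms are necessary, as a linear function and the
  square show.
\<close>

definition lip2_poly :: "real \<Rightarrow> nat \<Rightarrow> ('a::real_normed_vector \<Rightarrow> 'b::real_normed_vector) \<Rightarrow> bool" where
  "lip2_poly C k f \<longleftrightarrow> (\<forall>a b c. norm (f a - 2 *\<^sub>R f b + f c) \<le> C * (1 + norm a + norm b + norm c) ^ k *
      (norm (a - 2 *\<^sub>R b + c) + (norm (a - b))\<^sup>2 + (norm (c - b))\<^sup>2))"

text \<open>
  On the ball of radius \<open>norm a + norm b\<close> about the origin, which contains both points, the polynomial
  bound on the partial derivatives is at most its value at the boundary.
\<close>

lemma lip_poly_if_dird_bound:
  fixes f :: "'a::euclidean_space \<Rightarrow> 'b::real_normed_vector"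
  assumes C: "0 \<le> C"
    and f: "\<And>x. f differentiable at x"
    and B: "\<And>e x. e \<in> Basis \<Longrightarrow> norm (dird e f x) \<le> C * (1 + norm x) ^ k"
  shows "lip_poly (real DIM('a) * C) k f"
  unfolding lip_poly_def
proof (intro allI)
  fix a b :: 'a
  have "norm (f a - f b) \<le> real DIM('a) * (C * (1 + norm a + norm b) ^ k) * norm (a - b)"
  proof (rule increment_bound)
    fix e x :: 'a assume e: "e \<in> Basis" and x: "x \<in> cball 0 (norm a + norm b)"
    have "C * (1 + norm x) ^ k \<le> C * (1 + norm a + norm b) ^ k"
      using x C by (intro mult_left_mono power_mono) auto
    with B[OF e] show "norm (dird e f x) \<le> C * (1 + norm a + norm b) ^ k"
      by (rule order_trans)
  qed (auto intro: f)
  then show "norm (f a - f b) \<le> real DIM('a) * C * (1 + norm a + norm b) ^ k * norm (a - b)"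
    by (simp add: mult.assoc)
qed

lemma lip2_poly_if_dird_bound:
  fixes f :: "'a::euclidean_space \<Rightarrow> 'b::real_normed_vector"
  assumes C: "0 \<le> C"
    and f: "\<And>x. f differentiable at x"
    and f2: "\<And>e x. e \<in> Basis \<Longrightarrow> dird e f differentiable at x"
    and B: "\<And>e x. e \<in> Basis \<Longrightarrow> norm (dird e f x) \<le> C * (1 + norm x) ^ k"
    and B2: "\<And>e e' x. e \<in> Basis \<Longrightarrow> e' \<in> Basis \<Longrightarrow> norm (dird e' (dird e f) x) \<le> C * (1 + norm x) ^ k"
  shows "lip2_poly (2 * (real DIM('a))\<^sup>2 * C) k f"
  unfolding lip2_poly_def
proof (intro allI)
  fix a b c :: 'a
  let ?R = "norm a + norm b + norm c"
  have mono: "C * (1 + norm x) ^ k \<le> C * (1 + norm a + norm b + norm c) ^ k"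
    if "x \<in> cball 0 ?R" for x :: 'a
    using that C by (intro mult_left_mono power_mono) auto
  have "norm (f a - 2 *\<^sub>R f b + f c) \<le>
      2 * (real DIM('a))\<^sup>2 * (C * (1 + norm a + norm b + norm c) ^ k) *
      (norm (a - 2 *\<^sub>R b + c) + (norm (a - b))\<^sup>2 + (norm (c - b))\<^sup>2)"
    by (rule second_difference_bound[of "cball 0 ?R"])
      (auto intro: f f2 order_trans[OF B mono] order_trans[OF B2 mono])
  then show "norm (f a - 2 *\<^sub>R f b + f c) \<le>
      2 * (real DIM('a))\<^sup>2 * C * (1 + norm a + norm b + norm c) ^ k *
      (norm (a - 2 *\<^sub>R b + c) + (norm (a - b))\<^sup>2 + (norm (c - b))\<^sup>2)"
    by (simp add: mult.assoc)
qed

text \<open>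
  Bounds on the finitely many partial derivatives, each with its own constant and exponent, are merged by
  adding up the constants and the exponents.
\<close>

lemma uniform_poly_constants:
  fixes P :: "'i \<Rightarrow> real \<Rightarrow> nat \<Rightarrow> bool"
  assumes S: "finite S" and ex: "\<And>i. i \<in> S \<Longrightarrow> \<exists>C k. P i C k"
    and mono: "\<And>i C k C' k'. P i C k \<Longrightarrow> C \<le> C' \<Longrightarrow> 0 \<le> C' \<Longrightarrow> k \<le> k' \<Longrightarrow> P i C' k'"
  shows "\<exists>C k. 0 \<le> C \<and> (\<forall>i\<in>S. P i C k)"
proof -
  from ex obtain C k where Ck: "\<And>i. i \<in> S \<Longrightarrow> P i (C i) (k i)" by metis
  have "P i (\<Sum>i\<in>S. \<bar>C i\<bar>) (\<Sum>i\<in>S. k i)" if "i \<in> S" for i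
  proof (rule mono[OF Ck[OF that]])
    show "C i \<le> (\<Sum>i\<in>S. \<bar>C i\<bar>)"
      using member_le_sum[of i S "\<lambda>i. \<bar>C i\<bar>"] S that by simp
    show "k i \<le> (\<Sum>i\<in>S. k i)"
      using member_le_sum[of i S k] S that by simp
  qed (simp add: sum_nonneg)
  then show ?thesis
    by (intro exI[of _ "\<Sum>i\<in>S. \<bar>C i\<bar>"] exI[of _ "\<Sum>i\<in>S. k i"]) (auto intro: sum_nonneg)
qed

lemma poly_bound_mono:
  assumes "a \<le> C * (1 + norm x) ^ k" "C \<le> C'" "0 \<le> C'" "k \<le> k'"
  shows "a \<le> C' * (1 + norm x) ^ k'"
proof -
  note assms(1)
  also have "C * (1 + norm x) ^ k \<le> C' * (1 + norm x) ^ k'"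
    using assms(2-4) by (intro mult_mono power_increasing) auto
  finally show ?thesis .
qed

section \<open>Mollification of weakly differentiable functions\<close>

text \<open>
  The derivatives of \<open>exp (- 1 / t)\<close>, continued by \<open>0\<close> to \<open>t \<le> 0\<close>, are linear combinations of these
  functions.
\<close>

definition flat_exp :: "nat \<Rightarrow> real \<Rightarrow> real" where
  "flat_exp n t = (if 0 < t then (1 / t) ^ n * exp (- (1 / t)) else 0)"

lemma flat_exp_tendsto_0: "(flat_exp n \<longlongrightarrow> 0) (at_right 0)"
proof -
  have "((\<lambda>x::real. x ^ n / exp x) \<longlongrightarrow> 0) at_top"
    by (rule tendsto_power_div_exp_0)
  then have "((\<lambda>t::real. (inverse t) ^ n / exp (inverse t)) \<longlongrightarrow> 0) (at_right 0)"
    by (rule filterlim_compose[OF _ filterlim_inverse_at_top_right])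
  moreover have "\<forall>\<^sub>F t in at_right 0. (inverse t) ^ n / exp (inverse t) = flat_exp n t"
    unfolding eventually_at_filter
    by (intro always_eventually) (auto simp: flat_exp_def exp_minus field_simps)
  ultimately show ?thesis
    by (rule Lim_transform_eventually)
qed

text \<open>
  At the origin the right difference quotient of the function with index \<open>n\<close> is the function with
  index \<open>n + 1\<close>, which tends to \<open>0\<close>.
\<close>

lemma flat_exp_deriv:
  "(flat_exp n has_real_derivative (flat_exp (n + 2) t - n * flat_exp (n + 1) t)) (at t)"
proof -
  consider "0 < t" | "t < 0" | "t = 0" by linarith
  then show ?thesis
  proof cases
    case 1
    have "((\<lambda>t. (1 / t) ^ n * exp (- (1 / t))) has_real_derivative
        (flat_exp (n + 2) t - n * flat_exp (n + 1) t)) (at t)"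
    proof -
      have d: "((\<lambda>t. 1 / t) has_real_derivative - ((1 / t) ^ 2)) (at t)"
        using 1 by (auto intro!: derivative_eq_intros simp: power2_eq_square)
      have "((\<lambda>t. (1 / t) ^ n * exp (- (1 / t))) has_real_derivative
          real n * (- ((1 / t) ^ 2) * (1 / t) ^ (n - Suc 0)) * exp (- (1 / t)) +
          exp (- (1 / t)) * - (- ((1 / t) ^ 2)) * (1 / t) ^ n) (at t)"
        by (intro DERIV_mult DERIV_power DERIV_fun_exp DERIV_minus d)
      also have "real n * (- ((1 / t) ^ 2) * (1 / t) ^ (n - Suc 0)) * exp (- (1 / t)) +
          exp (- (1 / t)) * - (- ((1 / t) ^ 2)) * (1 / t) ^ n
          = flat_exp (n + 2) t - n * flat_exp (n + 1) t"
      proof -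
        have "u * (u ^ 2 * u ^ (n - Suc 0)) = u ^ 2 * u ^ n" if "n \<noteq> 0" for u :: real
          using that by (cases n) auto
        then show ?thesis
          using 1 by (cases n) (simp_all add: flat_exp_def power2_eq_square algebra_simps)
      qed
      finally show ?thesis .
    qed
    then show ?thesis
      by (rule has_field_derivative_transform_within_open[of _ _ _ "{0<..}"])
        (use 1 in \<open>auto simp: flat_exp_def\<close>)
  next
    case 2
    have "((\<lambda>t. 0) has_real_derivative (flat_exp (n + 2) t - n * flat_exp (n + 1) t)) (at t)"
      using 2 by (simp add: flat_exp_def)
    then show ?thesis
      by (rule has_field_derivative_transform_within_open[of _ _ _ "{..<0}"])
        (use 2 in \<open>auto simp: flat_exp_def\<close>)
  next
    case 3
    have "((\<lambda>h. (flat_exp n (0 + h) - flat_exp n 0) / h) \<longlongrightarrow> 0) (at 0)"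
    proof (rule filterlim_split_at_real)
      have "\<forall>\<^sub>F h in at_left 0. 0 = (flat_exp n (0 + h) - flat_exp n 0) / h"
        unfolding eventually_at_filter by (intro always_eventually) (auto simp: flat_exp_def)
      then show "((\<lambda>h. (flat_exp n (0 + h) - flat_exp n 0) / h) \<longlongrightarrow> 0) (at_left 0)"
        by (rule Lim_transform_eventually[OF tendsto_const])
      have "\<forall>\<^sub>F h in at_right 0. flat_exp (n + 1) h = (flat_exp n (0 + h) - flat_exp n 0) / h"
        unfolding eventually_at_filter by (intro always_eventually) (auto simp: flat_exp_def)
      then show "((\<lambda>h. (flat_exp n (0 + h) - flat_exp n 0) / h) \<longlongrightarrow> 0) (at_right 0)"
        by (rule Lim_transform_eventually[OF flat_exp_tendsto_0])
    qed
    then show ?thesis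
      using 3 by (simp add: DERIV_def flat_exp_def)
  qed
qed

text \<open>
  A family of functions supported in the ball of squared radius \<open>r\<close> about the origin which contains the
  standard bump and is closed under partial derivatives; its members are therefore smooth.
\<close>

inductive bump_fun :: "real \<Rightarrow> ('a::euclidean_space \<Rightarrow> real) \<Rightarrow> bool" for r where
  base: "bump_fun r (\<lambda>y. flat_exp n (r - y \<bullet> y))"
| add: "bump_fun r f \<Longrightarrow> bump_fun r g \<Longrightarrow> bump_fun r (\<lambda>y. f y + g y)"
| scale: "bump_fun r f \<Longrightarrow> bump_fun r (\<lambda>y. c * f y)"
| coord: "bump_fun r f \<Longrightarrow> bump_fun r (\<lambda>y. (y \<bullet> e) * f y)"

lemma bump_fun_differentiable:
  assumes "bump_fun r f"
  shows "f differentiable at y"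
  using assms
proof (induction arbitrary: y)
  case (base n)
  have "((\<lambda>y. flat_exp n (r - y \<bullet> y)) has_derivative
      (\<lambda>v. (flat_exp (n + 2) (r - y \<bullet> y) - n * flat_exp (n + 1) (r - y \<bullet> y)) * (- 2 * (y \<bullet> v)))) (at y)"
    by (rule has_derivative_compose[OF _ flat_exp_deriv[unfolded has_field_derivative_def]])
      (auto intro!: derivative_eq_intros simp: inner_commute)
  then show ?case by (rule differentiableI)
qed (auto intro!: differentiable_add differentiable_mult differentiable_const bounded_linear_imp_differentiable bounded_linear_inner_left)

lemma bump_fun_dird:
  assumes "bump_fun r f"
  shows "bump_fun r (dird b f)"
  using assms
proof induction
  case (base n)
  have "((\<lambda>y. flat_exp n (r - y \<bullet> y)) has_derivative
      (\<lambda>v. (flat_exp (n + 2) (r - y \<bullet> y) - n * flat_exp (n + 1) (r - y \<bullet> y)) * (- 2 * (y \<bullet> v)))) (at y)"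
    for y :: 'a
    by (rule has_derivative_compose[OF _ flat_exp_deriv[unfolded has_field_derivative_def]])
      (auto intro!: derivative_eq_intros simp: inner_commute)
  from dird_eqI[OF this]
  have "dird b (\<lambda>y. flat_exp n (r - y \<bullet> y)) = (\<lambda>y. (y \<bullet> b) * ((- 2) * flat_exp (n + 2) (r - y \<bullet> y)
      + 2 * n * flat_exp (n + 1) (r - y \<bullet> y)))"
    by (auto simp: algebra_simps)
  then show ?case
    by (simp only:) (intro bump_fun.intros)
next
  case (add f g)
  have "dird b (\<lambda>y. f y + g y) y = dird b f y + dird b g y" for y
    unfolding dird_def[of b f] dird_def[of b g]
    by (rule dird_eqI)
      (intro has_derivative_add frechet_derivative_works[THEN iffD1] bump_fun_differentiable[OF add.hyps(1)]
        bump_fun_differentiable[OF add.hyps(2)])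
  then have "dird b (\<lambda>y. f y + g y) = (\<lambda>y. dird b f y + dird b g y)" by blast
  then show ?case using add.IH by (auto intro: bump_fun.intros)
next
  case (scale f c)
  have "dird b (\<lambda>y. c * f y) y = c * dird b f y" for y
    unfolding dird_def[of b f]
    by (rule dird_eqI)
      (intro has_derivative_mult_right frechet_derivative_works[THEN iffD1] bump_fun_differentiable[OF scale.hyps])
  then have "dird b (\<lambda>y. c * f y) = (\<lambda>y. c * dird b f y)" by blast
  then show ?case using scale.IH by (auto intro: bump_fun.intros)
next
  case (coord f e)
  have "dird b (\<lambda>y. (y \<bullet> e) * f y) y = (y \<bullet> e) * dird b f y + (b \<bullet> e) * f y" for y
    unfolding dird_def[of b f]
    by (rule dird_eqI)
      (intro has_derivative_mult has_derivative_inner_left has_derivative_ident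
        frechet_derivative_works[THEN iffD1] bump_fun_differentiable[OF coord.hyps])
  then have "dird b (\<lambda>y. (y \<bullet> e) * f y) = (\<lambda>y. (y \<bullet> e) * dird b f y + (b \<bullet> e) * f y)" by blast
  then show ?case using coord by (auto intro: bump_fun.intros)
qed

lemma bump_fun_continuous:
  assumes "bump_fun r f"
  shows "continuous_on S f"
  using bump_fun_differentiable[OF assms]
  by (auto intro!: continuous_at_imp_continuous_on differentiable_imp_continuous_within)

lemma bump_fun_vanishes:
  assumes "bump_fun r f" "r \<le> y \<bullet> y"
  shows "f y = 0"
  using assms by induction (auto simp: flat_exp_def)

text \<open>
  All iterated partial derivatives are again translates of functions of the family, hence differentiable.
\<close>

lemma bump_fun_test_function:
  assumes f: "bump_fun (e\<^sup>2) f" and e: "0 \<le> e"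
  shows "test_function (\<lambda>y. f (y - x))"
proof -
  have iter: "\<exists>g. bump_fun (e\<^sup>2) g \<and> iter_pd bs (\<lambda>y. f (y - x)) = (\<lambda>y. g (y - x))" for bs
  proof (induction bs)
    case Nil
    then show ?case using f by (auto simp: iter_pd_def)
  next
    case (Cons b bs)
    then obtain g where g: "bump_fun (e\<^sup>2) g" "iter_pd bs (\<lambda>y. f (y - x)) = (\<lambda>y. g (y - x))"
      by blast
    have "iter_pd (b # bs) (\<lambda>y. f (y - x)) = (\<lambda>y. dird b g (y - x))"
      using g dird_translate[OF bump_fun_differentiable[OF g(1)]] by (auto simp: iter_pd_def)
    with bump_fun_dird[OF g(1)] show ?case by blast
  qed
  have 1: "iter_pd bs (\<lambda>y. f (y - x)) differentiable at y" for bs y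
  proof -
    obtain g where g: "bump_fun (e\<^sup>2) g" "iter_pd bs (\<lambda>y. f (y - x)) = (\<lambda>y. g (y - x))"
      using iter by blast
    have "(g \<circ> (\<lambda>y. y - x)) differentiable at y"
      by (intro differentiable_chain_at bump_fun_differentiable[OF g(1)] differentiable_diff
          differentiable_ident differentiable_const)
    then show ?thesis by (simp add: g o_def)
  qed
  have "C_inf (\<lambda>y. f (y - x))"
    unfolding C_inf_def C_k_def
    using 1 by (auto intro!: continuous_at_imp_continuous_on differentiable_imp_continuous_within)
  moreover have "{y. f (y - x) \<noteq> 0} \<subseteq> cball x e"
  proof
    fix y assume "y \<in> {y. f (y - x) \<noteq> 0}"
    then have "\<not> e\<^sup>2 \<le> (norm (y - x))\<^sup>2"
      using bump_fun_vanishes[OF f, of "y - x"] by (auto simp: dot_square_norm)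
    then have "norm (y - x) \<le> e"
      using e by (meson linorder_le_cases power_mono)
    then show "y \<in> cball x e" by (simp add: dist_norm norm_minus_commute)
  qed
  then have "compact (closure {y. f (y - x) \<noteq> 0})"
    by (meson bounded_cball bounded_subset compact_closure)
  ultimately show ?thesis by (simp add: test_function_def)
qed

lemma integral_eq_integral_cbox:
  fixes h :: "'a::euclidean_space \<Rightarrow> real"
  assumes cont: "continuous_on UNIV h" and 0: "\<And>y. y \<notin> cbox a b \<Longrightarrow> h y = 0"
  shows "integrable lborel h" "(LINT y|lborel. h y) = integral (cbox a b) h"
proof -
  have "integrable lborel (\<lambda>y. indicator (cbox a b) y *\<^sub>R h y)"
    by (intro borel_integrable_compact compact_cbox continuous_on_subset[OF cont]) auto
  also have "(\<lambda>y. indicator (cbox a b) y *\<^sub>R h y) = h"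
  proof
    show "indicator (cbox a b) y *\<^sub>R h y = h y" for y
      using 0[of y] by (auto simp: indicator_def)
  qed
  finally show *: "integrable lborel h" .
  have "(\<lambda>y. if y \<in> cbox a b then h y else 0) = h"
    using 0 by auto
  with Henstock_Kurzweil_Integration.integral_restrict_UNIV[of "cbox a b" h]
  show "(LINT y|lborel. h y) = integral (cbox a b) h"
    by (simp add: integral_lborel[OF *])
qed

text \<open>
  Convolution with the reflected kernel; in this form the kernel is evaluated at \<open>y - x\<close>, the argument of
  a translated test function of \<open>y\<close>.
\<close>

definition conv :: "('a::euclidean_space \<Rightarrow> real) \<Rightarrow> ('a \<Rightarrow> real) \<Rightarrow> 'a \<Rightarrow> real" where
  "conv F k x = (LINT y|lborel. F y * k (y - x))"

text \<open>
  Differentiation under the integral sign: all derivatives fall on the kernel, and the sign stems from its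
  reflection.
\<close>

lemma conv_derivative:
  fixes F k :: "'a::euclidean_space \<Rightarrow> real"
  assumes F: "continuous_on UNIV F" and k: "bump_fun (e\<^sup>2) k" and e: "0 \<le> e"
  shows "conv F k differentiable at x0" "dird b (conv F k) x0 = - conv F (dird b k) x0"
proof -
  obtain c where c: "cball x0 (1 + e) \<subseteq> cbox (- c) c"
    using bounded_subset_cbox_symmetric[OF bounded_cball] by blast
  \<comment> \<open>For base points within distance 1 of x0 the translated kernels all vanish outside one box, on
    which Leibniz' rule for parameter integrals applies.\<close>
  have box: "F y * g (y - x) = 0" if "x \<in> ball x0 1" "y \<notin> cbox (- c) c" "bump_fun (e\<^sup>2) g" for x y g
  proof -
    have "1 + e < dist x0 y" using c that(2) by (auto simp: subset_iff not_le)
    moreover have "dist x0 y \<le> dist x0 x + dist x y" by (rule dist_triangle)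
    ultimately have "e \<le> norm (y - x)" using that(1) by (simp add: dist_norm norm_minus_commute)
    then have "e\<^sup>2 \<le> (y - x) \<bullet> (y - x)" using e by (simp add: power_mono dot_square_norm)
    then show ?thesis using bump_fun_vanishes[OF that(3)] by simp
  qed
  have contg: "continuous_on S (\<lambda>z. g (p z - q z))"
    if "bump_fun (e\<^sup>2) g" "continuous_on S p" "continuous_on S q"
    for g and p q :: "'z::topological_space \<Rightarrow> 'a" and S
    by (rule continuous_on_compose2[OF bump_fun_continuous[OF that(1), of UNIV]])
      (auto intro: that(2,3) continuous_intros)
  have int: "conv F g x = integral (cbox (- c) c) (\<lambda>y. F y * g (y - x))"
    if "x \<in> ball x0 1" "bump_fun (e\<^sup>2) g" for x g
    unfolding conv_def
    by (rule integral_eq_integral_cbox)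
      (use box[OF that(1) _ that(2)] in \<open>auto intro!: continuous_intros contg F that(2)\<close>)
  define fx where "fx x y = (\<Sum>i\<in>Basis. (F y * (- dird i k (y - x))) *\<^sub>R blinfun_inner_right i)"
    for x y :: 'a
  have contfx: "continuous_on (ball x0 1 \<times> cbox (- c) c) (\<lambda>(x, y). fx x y)"
    unfolding fx_def split_beta
    by (intro continuous_intros contg bump_fun_dird k continuous_on_compose2[OF F]) auto
  have x0: "x0 \<in> ball x0 1" by simp
  have "((\<lambda>x. integral (cbox (- c) c) (\<lambda>y. F y * k (y - x))) has_derivative
      blinfun_apply (integral (cbox (- c) c) (fx x0))) (at x0 within ball x0 1)"
  proof (rule leibniz_rule[OF _ _ contfx x0 convex_ball])
    fix x y :: 'a
    have "((\<lambda>x. k (y - x)) has_derivative (\<lambda>v. \<Sum>i\<in>Basis. (- v \<bullet> i) *\<^sub>R dird i k (y - x))) (at x)"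
      by (rule has_derivative_compose[OF _ has_derivative_sum_dird])
        (auto intro!: derivative_eq_intros bump_fun_differentiable[OF k])
    then have "((\<lambda>x. F y * k (y - x)) has_derivative
        (\<lambda>v. F y * (\<Sum>i\<in>Basis. (- v \<bullet> i) *\<^sub>R dird i k (y - x)))) (at x)"
      by (rule has_derivative_mult_right)
    also have "(\<lambda>v. F y * (\<Sum>i\<in>Basis. (- v \<bullet> i) *\<^sub>R dird i k (y - x))) = blinfun_apply (fx x y)"
      by (rule ext) (simp add: fx_def blinfun.sum_left blinfun.scaleR_left blinfun.minus_left
          sum_distrib_left inner_commute mult_ac)
    finally show "((\<lambda>x. F y * k (y - x)) has_derivative blinfun_apply (fx x y)) (at x within ball x0 1)"
      by (rule has_derivative_at_withinI)
  next
    fix x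
    show "(\<lambda>y. F y * k (y - x)) integrable_on cbox (- c) c"
      by (intro integrable_continuous continuous_intros contg k continuous_on_subset[OF F]) auto
  qed
  then have "((\<lambda>x. integral (cbox (- c) c) (\<lambda>y. F y * k (y - x))) has_derivative
      blinfun_apply (integral (cbox (- c) c) (fx x0))) (at x0)"
    by (simp add: at_within_open[OF x0])
  then have D: "(conv F k has_derivative blinfun_apply (integral (cbox (- c) c) (fx x0))) (at x0)"
    by (rule has_derivative_transform_within_open[OF _ open_ball x0]) (simp add: int k)
  then show "conv F k differentiable at x0"
    by (rule differentiableI)
  have "continuous_on (cbox (- c) c) (\<lambda>y. case (x0, y) of (x, y) \<Rightarrow> fx x y)"
    by (rule continuous_on_compose2[OF contfx]) (auto intro!: continuous_intros)
  then have "continuous_on (cbox (- c) c) (fx x0)" by simp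
  then have "fx x0 integrable_on cbox (- c) c"
    by (rule integrable_continuous)
  from blinfun_apply_integral[OF this]
  have *: "dird b (conv F k) x0 = integral (cbox (- c) c) (\<lambda>y. blinfun_apply (fx x0 y) b)" for b
    using dird_eqI[OF D] by simp
  show "dird b (conv F k) x0 = - conv F (dird b k) x0"
  proof -
    have "blinfun_apply (fx x0 y) b = - (F y * dird b k (y - x0))" for y
    proof -
      have "dird b k (y - x0) = (\<Sum>i\<in>Basis. (b \<bullet> i) *\<^sub>R dird i k (y - x0))"
        using frechet_derivative_eq_sum_dird[OF bump_fun_differentiable[OF k], of "y - x0" b]
        by (simp add: dird_def)
      then show ?thesis
        by (simp add: fx_def blinfun.sum_left blinfun.scaleR_left blinfun.minus_left sum_distrib_left inner_commute
          sum_negf mult_ac)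
    qed
    then show ?thesis
      using int[OF x0 bump_fun_dird[OF k]] * by simp
  qed
qed

text \<open>
  A generalised derivative of the factor may be exchanged with the derivative of the kernel, since
  the translates of the kernel are test functions.
\<close>

lemma conv_dird_weak_pd:
  assumes w: "weak_pd b F F'" and k: "bump_fun (e\<^sup>2) k" and e: "0 \<le> e"
  shows "conv F (dird b k) x = - conv F' k x" "integrable lborel (\<lambda>y. F' y * k (y - x))"
proof -
  have t: "test_function (\<lambda>y. k (y - x))"
    by (rule bump_fun_test_function[OF k e])
  have "dird b (\<lambda>y. k (y - x)) = (\<lambda>y. dird b k (y - x))"
    by (intro ext dird_translate bump_fun_differentiable[OF k])
  then show "conv F (dird b k) x = - conv F' k x" "integrable lborel (\<lambda>y. F' y * k (y - x))"
    using w t by (auto simp: weak_pd_def conv_def)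
qed

definition mollifier :: "real \<Rightarrow> 'a::euclidean_space \<Rightarrow> real" where
  "mollifier e y = flat_exp 0 (e\<^sup>2 - y \<bullet> y)"

lemma bump_fun_mollifier: "bump_fun (e\<^sup>2) (mollifier e)"
  using bump_fun.base[of "e\<^sup>2" 0] by (simp add: mollifier_def[abs_def])

lemma mollifier_nonneg: "0 \<le> mollifier e y"
  by (simp add: mollifier_def flat_exp_def)

lemma mollifier_eq_0: "0 \<le> e \<Longrightarrow> e \<le> norm y \<Longrightarrow> mollifier e y = 0"
  by (rule bump_fun_vanishes[OF bump_fun_mollifier]) (simp add: dot_square_norm power_mono)

lemma integrable_mollifier:
  fixes F :: "'a::euclidean_space \<Rightarrow> real"
  assumes F: "continuous_on UNIV F" and e: "0 \<le> e"
  shows "integrable lborel (\<lambda>y. F y * mollifier e (y - x))"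
proof -
  obtain c where c: "cball x e \<subseteq> cbox (- c) c"
    using bounded_subset_cbox_symmetric[OF bounded_cball] by blast
  show ?thesis
  proof (rule integral_eq_integral_cbox[of _ "- c" c])
    have "continuous_on UNIV (\<lambda>y. mollifier e (y - x))"
      by (rule continuous_on_compose2[OF bump_fun_continuous[OF bump_fun_mollifier, of UNIV]])
        (auto intro: continuous_intros)
    then show "continuous_on UNIV (\<lambda>y. F y * mollifier e (y - x))"
      using F by (intro continuous_intros)
    fix y assume "y \<notin> cbox (- c) c"
    then have "e < dist x y" using c by (auto simp: subset_iff not_le)
    then show "F y * mollifier e (y - x) = 0"
      using mollifier_eq_0[OF e, of "y - x"] by (simp add: dist_norm norm_minus_commute)
  qed
qed

text \<open>
  The type argument is the space over which the mollifier is integrated.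
\<close>

definition mollifier_mass :: "'a::euclidean_space itself \<Rightarrow> real \<Rightarrow> real" where
  "mollifier_mass _ e = (LINT y|lborel. mollifier e (y::'a))"

lemma integral_mollifier:
  fixes x :: "'a::euclidean_space"
  shows "(LINT y|lborel. mollifier e (y - x)) = mollifier_mass TYPE('a) e"
proof -
  have "mollifier e \<in> borel_measurable (borel :: 'a measure)"
    by (intro borel_measurable_continuous_onI bump_fun_continuous[OF bump_fun_mollifier])
  then have "(LINT y|distr lborel borel ((+) (- x)). mollifier e y) = (LINT y|lborel. mollifier e (- x + y))"
    by (intro integral_distr) auto
  then show ?thesis by (simp add: mollifier_mass_def lborel_distr_plus)
qed

text \<open>
  The mollifier is positive on an open ball, which is not a null set.
\<close>

lemma mollifier_mass_pos:
  assumes e: "0 < e"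
  shows "0 < mollifier_mass TYPE('a::euclidean_space) e"
proof -
  have int: "integrable lborel (mollifier e :: 'a \<Rightarrow> real)"
    using integrable_mollifier[of "\<lambda>_. 1" e 0] e by simp
  have "\<not> (AE y in lborel. mollifier e (y::'a) = 0)"
  proof
    assume "AE y in lborel. mollifier e (y::'a) = 0"
    moreover have "mollifier e y \<noteq> 0" if "y \<in> ball 0 e" for y :: 'a
    proof -
      have "(norm y)\<^sup>2 < e\<^sup>2" using that by (intro power_strict_mono) auto
      then show ?thesis by (simp add: mollifier_def flat_exp_def dot_square_norm)
    qed
    ultimately have "AE y in lborel. y \<notin> ball (0::'a) e" by (auto elim: eventually_mono)
    then have "ball (0::'a) e \<in> null_sets lborel"
      by (subst (asm) AE_iff_null_sets[symmetric]) auto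
    then have "emeasure lborel (ball (0::'a) e) = 0" by auto
    then show False using content_ball_pos[OF e, of "0::'a"] by (simp add: measure_def)
  qed
  then have "mollifier_mass TYPE('a) e \<noteq> 0"
    using integral_nonneg_eq_0_iff_AE[OF int] by (simp add: mollifier_mass_def mollifier_nonneg)
  moreover have "0 \<le> mollifier_mass TYPE('a) e"
    by (simp add: mollifier_mass_def mollifier_nonneg)
  ultimately show ?thesis by simp
qed

text \<open>
  The mollifier only sees points within distance \<open>1\<close> of \<open>x\<close>, where \<open>1 + norm y \<le> 2 * (1 + norm x)\<close>; hence
  the constant does not depend on the width \<open>e\<close>.
\<close>

lemma conv_mollifier_bound:
  fixes f :: "'a::euclidean_space \<Rightarrow> real"
  assumes int: "integrable lborel (\<lambda>y. f y * mollifier e (y - x))"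
    and bound: "AE y in lborel. \<bar>f y\<bar> \<le> C * (1 + norm y) ^ k" and C: "0 \<le> C"
    and e: "0 < e" "e \<le> 1"
  shows "\<bar>conv f (mollifier e) x\<bar> \<le> C * 2 ^ k * (1 + norm x) ^ k * mollifier_mass TYPE('a) e"
proof -
  have "\<bar>conv f (mollifier e) x\<bar> \<le> (LINT y|lborel. \<bar>f y * mollifier e (y - x)\<bar>)"
    unfolding conv_def by (rule integral_abs_bound)
  also have "\<dots> \<le> (LINT y|lborel. C * 2 ^ k * (1 + norm x) ^ k * mollifier e (y - x))"
  proof (rule integral_mono_AE)
    show "integrable lborel (\<lambda>y. \<bar>f y * mollifier e (y - x)\<bar>)"
      using int by (rule integrable_abs)
    show "integrable lborel (\<lambda>y. C * 2 ^ k * (1 + norm x) ^ k * mollifier e (y - x))"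
      using e by (intro integrable_mollifier) auto
    show "AE y in lborel. \<bar>f y * mollifier e (y - x)\<bar> \<le> C * 2 ^ k * (1 + norm x) ^ k * mollifier e (y - x)"
      using bound
    proof eventually_elim
      fix y assume y: "\<bar>f y\<bar> \<le> C * (1 + norm y) ^ k"
      show "\<bar>f y * mollifier e (y - x)\<bar> \<le> C * 2 ^ k * (1 + norm x) ^ k * mollifier e (y - x)"
      proof (cases "norm (y - x) \<le> e")
        case True
        then have "norm y \<le> norm x + 1" using e norm_triangle_sub[of y x] by simp
        moreover have "0 \<le> norm x" by simp
        ultimately have "1 + norm y \<le> 2 * (1 + norm x)" unfolding distrib_left by linarith
        then have "C * (1 + norm y) ^ k \<le> C * (2 * (1 + norm x)) ^ k"
          by (intro mult_left_mono power_mono C) auto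
        with y have "\<bar>f y\<bar> \<le> C * 2 ^ k * (1 + norm x) ^ k"
          by (simp only: power_mult_distrib mult.assoc)
        then show ?thesis by (simp add: abs_mult mollifier_nonneg mult_right_mono)
      next
        case False
        then show ?thesis using mollifier_eq_0[of e "y - x"] e by simp
      qed
    qed
  qed
  finally show ?thesis by (simp add: integral_mollifier)
qed

lemma conv_mollifier_tendsto:
  fixes F :: "'a::euclidean_space \<Rightarrow> real"
  assumes F: "continuous_on UNIV F"
  shows "((\<lambda>e. conv F (mollifier e) x / mollifier_mass TYPE('a) e) \<longlongrightarrow> F x) (at_right 0)"
proof (rule tendstoI)
  fix d :: real assume d: "0 < d"
  obtain r where r: "0 < r" "\<And>y. dist y x < r \<Longrightarrow> dist (F y) (F x) < d / 2"
    using F d by (metis UNIV_I continuous_on_iff half_gt_zero)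
  have "dist (conv F (mollifier e) x / mollifier_mass TYPE('a) e) (F x) < d" if e: "0 < e" "e < r" for e
  proof -
    let ?m = "mollifier_mass TYPE('a) e"
    have m: "0 < ?m" by (rule mollifier_mass_pos[OF e(1)])
    have i1: "integrable lborel (\<lambda>y. F y * mollifier e (y - x))"
      using e by (intro integrable_mollifier F) auto
    have i2: "integrable lborel (\<lambda>y. c * mollifier e (y - x))" for c
      using e by (intro integrable_mollifier) auto
    have "conv F (mollifier e) x - F x * ?m = (LINT y|lborel. F y * mollifier e (y - x) - F x * mollifier e (y - x))"
      unfolding conv_def by (subst Bochner_Integration.integral_diff[OF i1 i2]) (simp add: integral_mollifier)
    then have "\<bar>conv F (mollifier e) x - F x * ?m\<bar>
        \<le> (LINT y|lborel. \<bar>F y * mollifier e (y - x) - F x * mollifier e (y - x)\<bar>)"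
      by (simp only: integral_abs_bound)
    also have "\<dots> \<le> (LINT y|lborel. (d / 2) * mollifier e (y - x))"
    proof (rule integral_mono)
      show "integrable lborel (\<lambda>y. \<bar>F y * mollifier e (y - x) - F x * mollifier e (y - x)\<bar>)"
        by (intro integrable_abs Bochner_Integration.integrable_diff i1 i2)
      fix y
      show "\<bar>F y * mollifier e (y - x) - F x * mollifier e (y - x)\<bar> \<le> (d / 2) * mollifier e (y - x)"
      proof (cases "norm (y - x) < e")
        case True
        then have "\<bar>F y - F x\<bar> \<le> d / 2" using r(2)[of y] e by (simp add: dist_norm)
        then show ?thesis
          by (simp add: left_diff_distrib[symmetric] abs_mult mollifier_nonneg mult_right_mono del: times_divide_eq_left)
      next
        case False
        then show ?thesis using mollifier_eq_0[of e "y - x"] e by simp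
      qed
    qed (rule i2)
    finally have "\<bar>conv F (mollifier e) x - F x * ?m\<bar> \<le> d / 2 * ?m" by (simp add: integral_mollifier)
    then have "\<bar>conv F (mollifier e) x / ?m - F x\<bar> \<le> d / 2"
      using m by (simp add: field_simps abs_le_iff)
    then show ?thesis using d by (simp add: dist_real_def)
  qed
  then show "\<forall>\<^sub>F e in at_right 0. dist (conv F (mollifier e) x / mollifier_mass TYPE('a) e) (F x) < d"
    using eventually_at_right_less[of 0] eventually_at_right_real[OF r(1)]
    by (auto elim!: eventually_mono)
qed

text \<open>
  The mollified functions are smooth and inherit the growth bounds of the generalised derivatives
  with constants that do not depend on the width of the mollifier; the increments of \<open>F\<close> are the
  limits of their increments.
\<close>

lemma weak_diff1_imp_lip_poly:
  fixes F :: "'a::euclidean_space \<Rightarrow> real"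
  assumes F: "continuous_on UNIV F" and w: "weak_diff1 F"
  shows "\<exists>C k. 0 \<le> C \<and> lip_poly C k F"
proof -
  from w obtain F' where w1: "\<And>b. b \<in> Basis \<Longrightarrow> weak_pd b F (F' b)"
    and g: "\<And>b. b \<in> Basis \<Longrightarrow> poly_growth_ae (F' b)"
    unfolding weak_diff1_def by metis
  have "\<exists>C k. 0 \<le> C \<and> (\<forall>b\<in>Basis. AE x in lborel. \<bar>F' b x\<bar> \<le> C * (1 + norm x) ^ k)"
    using g unfolding poly_growth_ae_def
    by (intro uniform_poly_constants finite_Basis) (auto elim!: eventually_mono intro: poly_bound_mono)
  then obtain C k where C: "0 \<le> C"
    and bound: "\<And>b. b \<in> Basis \<Longrightarrow> AE x in lborel. \<bar>F' b x\<bar> \<le> C * (1 + norm x) ^ k" by blast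
  let ?m = "mollifier_mass TYPE('a)"
  define L where "L = real DIM('a) * (C * 2 ^ k)"
  define G where "G e = (\<lambda>x. inverse (?m e) * conv F (mollifier e) x)" for e
  have lip: "lip_poly L k (G e)" if e: "0 < e" "e \<le> 1" for e
    unfolding L_def
  proof (rule lip_poly_if_dird_bound)
    have m: "0 < ?m e" by (rule mollifier_mass_pos[OF e(1)])
    have e0: "0 \<le> e" using e by simp
    note conv = conv_derivative[OF F bump_fun_mollifier e0]
    show "0 \<le> C * 2 ^ k" using C by simp
    fix x :: 'a
    show "G e differentiable at x" unfolding G_def by (simp add: dird_cmult conv)
    fix b :: 'a assume b: "b \<in> Basis"
    have eq: "dird b (G e) x = inverse (?m e) * conv (F' b) (mollifier e) x"
      unfolding G_def using conv_dird_weak_pd(1)[OF w1[OF b] bump_fun_mollifier e0]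
      by (simp add: dird_cmult conv)
    have "\<bar>conv (F' b) (mollifier e) x\<bar> \<le> C * 2 ^ k * (1 + norm x) ^ k * ?m e"
      by (intro conv_mollifier_bound conv_dird_weak_pd(2)[OF w1[OF b] bump_fun_mollifier e0] bound b C e)
    then show "norm (dird b (G e) x) \<le> C * 2 ^ k * (1 + norm x) ^ k"
      using m by (simp add: eq abs_mult field_simps)
  qed
  have tendsto: "((\<lambda>e. G e x) \<longlongrightarrow> F x) (at_right 0)" for x
    using conv_mollifier_tendsto[OF F, of x] by (simp add: G_def divide_inverse mult.commute)
  have "lip_poly L k F"
    unfolding lip_poly_def
  proof (intro allI)
    fix a b :: 'a
    have "((\<lambda>e. norm (G e a - G e b)) \<longlongrightarrow> norm (F a - F b)) (at_right 0)"
      by (intro tendsto_intros tendsto)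
    moreover have "\<forall>\<^sub>F e in at_right 0. norm (G e a - G e b) \<le> L * (1 + norm a + norm b) ^ k * norm (a - b)"
      using eventually_at_right_less[of 0] eventually_at_right_real[OF zero_less_one]
      by (auto elim!: eventually_mono dest!: lip simp: lip_poly_def)
    ultimately show "norm (F a - F b) \<le> L * (1 + norm a + norm b) ^ k * norm (a - b)"
      by (intro tendsto_upperbound) auto
  qed
  moreover have "0 \<le> L" using C by (simp add: L_def)
  ultimately show ?thesis by blast
qed

text \<open>
  As for first order.  A second partial derivative of the mollified function moves both derivatives from
  the kernel to \<open>F\<close>, one at a time: the kernel with one derivative on it is still a test function.
\<close>

lemma weak_diff2_imp_lip2_poly:
  fixes F :: "'a::euclidean_space \<Rightarrow> real"
  assumes F: "continuous_on UNIV F" and w: "weak_diff2 F"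
  shows "\<exists>C k. 0 \<le> C \<and> lip2_poly C k F"
proof -
  from w obtain F' where w1: "\<And>b. b \<in> Basis \<Longrightarrow> weak_pd b F (F' b)"
    and g1: "\<And>b. b \<in> Basis \<Longrightarrow> poly_growth_ae (F' b)"
    and "\<And>b. b \<in> Basis \<Longrightarrow> \<forall>c\<in>Basis. \<exists>f''. weak_pd c (F' b) f'' \<and> poly_growth_ae f''"
    unfolding weak_diff2_def by metis
  then obtain F'' where w2: "\<And>b c. b \<in> Basis \<Longrightarrow> c \<in> Basis \<Longrightarrow> weak_pd c (F' b) (F'' b c)"
    and g2: "\<And>b c. b \<in> Basis \<Longrightarrow> c \<in> Basis \<Longrightarrow> poly_growth_ae (F'' b c)"
    by metis
  have "\<exists>C k. 0 \<le> C \<and> (\<forall>b\<in>Basis. AE x in lborel. \<bar>F' b x\<bar> \<le> C * (1 + norm x) ^ k)"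
    using g1 unfolding poly_growth_ae_def
    by (intro uniform_poly_constants finite_Basis) (auto elim!: eventually_mono intro: poly_bound_mono)
  then obtain C1 k1 where C1: "0 \<le> C1"
    and bound1: "\<And>b. b \<in> Basis \<Longrightarrow> AE x in lborel. \<bar>F' b x\<bar> \<le> C1 * (1 + norm x) ^ k1" by blast
  have "\<exists>C k. 0 \<le> C \<and> (\<forall>i\<in>Basis \<times> Basis. AE x in lborel. \<bar>F'' (fst i) (snd i) x\<bar> \<le> C * (1 + norm x) ^ k)"
    using g2 unfolding poly_growth_ae_def
    by (intro uniform_poly_constants finite_cartesian_product finite_Basis)
      (auto elim!: eventually_mono intro: poly_bound_mono)
  then obtain C2 k2 where C2: "0 \<le> C2"
    and bound2: "\<And>b c. b \<in> Basis \<Longrightarrow> c \<in> Basis \<Longrightarrow> AE x in lborel. \<bar>F'' b c x\<bar> \<le> C2 * (1 + norm x) ^ k2"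
    by fastforce
  define C where "C = C1 + C2"
  define k where "k = k1 + k2"
  have C: "0 \<le> C" using C1 C2 by (simp add: C_def)
  have bound1': "AE x in lborel. \<bar>F' b x\<bar> \<le> C * (1 + norm x) ^ k" if "b \<in> Basis" for b
    using bound1[OF that]
    by (rule eventually_mono) (erule poly_bound_mono, use C1 C2 in \<open>auto simp: C_def k_def\<close>)
  have bound2': "AE x in lborel. \<bar>F'' b c x\<bar> \<le> C * (1 + norm x) ^ k" if "b \<in> Basis" "c \<in> Basis" for b c
    using bound2[OF that]
    by (rule eventually_mono) (erule poly_bound_mono, use C1 C2 in \<open>auto simp: C_def k_def\<close>)
  let ?m = "mollifier_mass TYPE('a)"
  define L where "L = 2 * (real DIM('a))\<^sup>2 * (C * 2 ^ k)"
  define G where "G e = (\<lambda>x. inverse (?m e) * conv F (mollifier e) x)" for e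
  have lip: "lip2_poly L k (G e)" if e: "0 < e" "e \<le> 1" for e
    unfolding L_def
  proof (rule lip2_poly_if_dird_bound)
    have m: "0 < ?m e" by (rule mollifier_mass_pos[OF e(1)])
    have e0: "0 \<le> e" using e by simp
    note bump = bump_fun_mollifier[of e] bump_fun_mollifier[of e, THEN bump_fun_dird]
    note conv = conv_derivative[OF F bump(1) e0] conv_derivative[OF F bump(2) e0]
    have G1: "dird b (G e) = (\<lambda>x. - inverse (?m e) * conv F (dird b (mollifier e)) x)" for b
      unfolding G_def by (intro ext) (simp add: dird_cmult conv)
    show "0 \<le> C * 2 ^ k" using C by simp
    fix x :: 'a
    show "G e differentiable at x" unfolding G_def by (simp add: dird_cmult conv)
    fix b :: 'a assume b: "b \<in> Basis"
    show "dird b (G e) differentiable at x"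
      unfolding G1 by (rule dird_cmult(1)[OF conv(3)])
    have eq1: "dird b (G e) x = conv (F' b) (mollifier e) x * inverse (?m e)"
      unfolding G1 using conv_dird_weak_pd(1)[OF w1[OF b] bump(1) e0] by simp
    have "\<bar>conv (F' b) (mollifier e) x\<bar> \<le> C * 2 ^ k * (1 + norm x) ^ k * ?m e"
      by (intro conv_mollifier_bound conv_dird_weak_pd(2)[OF w1[OF b] bump(1) e0] bound1' b C e)
    then show "norm (dird b (G e) x) \<le> C * 2 ^ k * (1 + norm x) ^ k"
      using m by (simp add: eq1 abs_mult field_simps)
    fix c :: 'a assume c: "c \<in> Basis"
    have "dird c (dird b (G e)) x = conv F (dird c (dird b (mollifier e))) x * inverse (?m e)"
      unfolding G1 using dird_cmult(2)[OF conv(3), where c = "- inverse (?m e)" and b = c]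
      by (simp add: conv)
    also have "conv F (dird c (dird b (mollifier e))) x = - conv (F' c) (dird b (mollifier e)) x"
      by (rule conv_dird_weak_pd(1)[OF w1[OF c] bump(2) e0])
    also have "\<dots> = conv (F'' c b) (mollifier e) x"
      using conv_dird_weak_pd(1)[OF w2[OF c b] bump(1) e0] by simp
    finally have eq: "dird c (dird b (G e)) x = conv (F'' c b) (mollifier e) x * inverse (?m e)" .
    have "\<bar>conv (F'' c b) (mollifier e) x\<bar> \<le> C * 2 ^ k * (1 + norm x) ^ k * ?m e"
      by (intro conv_mollifier_bound conv_dird_weak_pd(2)[OF w2[OF c b] bump(1) e0] bound2' b c C e)
    then show "norm (dird c (dird b (G e)) x) \<le> C * 2 ^ k * (1 + norm x) ^ k"
      using m by (simp add: eq abs_mult field_simps)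
  qed
  have tendsto: "((\<lambda>e. G e x) \<longlongrightarrow> F x) (at_right 0)" for x
    using conv_mollifier_tendsto[OF F, of x] by (simp add: G_def divide_inverse mult.commute)
  have "lip2_poly L k F"
    unfolding lip2_poly_def
  proof (intro allI)
    fix a b c :: 'a
    let ?R = "L * (1 + norm a + norm b + norm c) ^ k *
      (norm (a - 2 *\<^sub>R b + c) + (norm (a - b))\<^sup>2 + (norm (c - b))\<^sup>2)"
    have "((\<lambda>e. norm (G e a - 2 *\<^sub>R G e b + G e c)) \<longlongrightarrow> norm (F a - 2 *\<^sub>R F b + F c)) (at_right 0)"
      by (intro tendsto_intros tendsto)
    moreover have "\<forall>\<^sub>F e in at_right 0. norm (G e a - 2 *\<^sub>R G e b + G e c) \<le> ?R"
      using eventually_at_right_real[OF zero_less_one]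
      by eventually_elim (use lip in \<open>auto simp: lip2_poly_def\<close>)
    ultimately show "norm (F a - 2 *\<^sub>R F b + F c) \<le> ?R"
      by (intro tendsto_upperbound) auto
  qed
  moreover have "0 \<le> L" using C by (simp add: L_def)
  ultimately show ?thesis by blast
qed

section \<open>Derivatives of the matrix J, locally uniformly in the step size\<close>

text \<open>
  Existence and local boundedness of all partial derivatives up to order \<open>k\<close>, uniformly for small \<open>h\<close>.
  In the recursive form the closure properties follow by induction on the order, from the rules for a
  single derivative.
\<close>

primrec unif_C :: "nat \<Rightarrow> (real \<Rightarrow> 'a::euclidean_space \<Rightarrow> 'b::real_normed_vector) \<Rightarrow> bool" where
  "unif_C 0 f \<longleftrightarrow> unif_loc_bounded f"
| "unif_C (Suc k) f \<longleftrightarrow> unif_loc_bounded f \<and> (\<forall>\<^sub>F h in at_right 0. \<forall>x. f h differentiable at x) \<and>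
     (\<forall>b\<in>Basis. unif_C k (\<lambda>h. dird b (f h)))"

lemma unif_loc_bounded_cong:
  assumes "\<forall>\<^sub>F h in at_right 0. f h = g h" "unif_loc_bounded f"
  shows "unif_loc_bounded g"
  unfolding unif_loc_bounded_def
proof (intro allI impI)
  fix K :: "'a set" assume "compact K"
  with assms(2) obtain C where "\<forall>\<^sub>F h in at_right 0. \<forall>x\<in>K. norm (f h x) \<le> C"
    unfolding unif_loc_bounded_def by blast
  with assms(1) have "\<forall>\<^sub>F h in at_right 0. \<forall>x\<in>K. norm (g h x) \<le> C"
    by eventually_elim simp
  then show "\<exists>C. \<forall>\<^sub>F h in at_right 0. \<forall>x\<in>K. norm (g h x) \<le> C" by blast
qed

text \<open>
  The properties concern small \<open>h\<close> only, so that formulas for derivatives which hold for small \<open>h\<close> may be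
  substituted.
\<close>

lemma unif_C_cong:
  assumes "\<forall>\<^sub>F h in at_right 0. f h = g h" "unif_C k f"
  shows "unif_C k g"
  using assms
proof (induction k arbitrary: f g)
  case 0
  then show ?case using unif_loc_bounded_cong by auto
next
  case (Suc k)
  have "\<forall>\<^sub>F h in at_right 0. \<forall>x. g h differentiable at x"
    using Suc.prems(1) Suc.prems(2)[simplified, THEN conjunct2, THEN conjunct1]
    by eventually_elim simp
  moreover have "unif_C k (\<lambda>h. dird b (g h))" if "b \<in> Basis" for b
    by (rule Suc.IH[of "\<lambda>h. dird b (f h)"])
      (use Suc.prems that in \<open>auto elim: eventually_mono\<close>)
  ultimately show ?case
    using Suc.prems unif_loc_bounded_cong by auto
qed

lemma unif_C_loc_bounded: "unif_C k f \<Longrightarrow> unif_loc_bounded f"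
  by (cases k) auto

lemma unif_C_differentiable:
  "unif_C (Suc k) f \<Longrightarrow> \<forall>\<^sub>F h in at_right 0. \<forall>x. f h differentiable at x"
  by simp

lemma unif_C_dird: "unif_C (Suc k) f \<Longrightarrow> b \<in> Basis \<Longrightarrow> unif_C k (\<lambda>h. dird b (f h))"
  by simp

lemma unif_C_SucD: "unif_C (Suc k) f \<Longrightarrow> unif_C k f"
proof (induction k arbitrary: f)
  case 0
  then show ?case by simp
next
  case (Suc k)
  from Suc.IH[OF unif_C_dird[OF Suc.prems]] unif_C_loc_bounded[OF Suc.prems]
    unif_C_differentiable[OF Suc.prems]
  show ?case unfolding unif_C.simps(2) by blast
qed

lemma unif_loc_boundedI2:
  assumes "unif_loc_bounded f" "unif_loc_bounded g"
    and "\<And>h x A B. norm (f h x) \<le> A \<Longrightarrow> norm (g h x) \<le> B \<Longrightarrow> norm (r h x) \<le> R A B"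
  shows "unif_loc_bounded r"
  unfolding unif_loc_bounded_def
proof (intro allI impI)
  fix K :: "'a set" assume "compact K"
  obtain A where A: "\<forall>\<^sub>F h in at_right 0. \<forall>x\<in>K. norm (f h x) \<le> A"
    using assms(1) \<open>compact K\<close> unfolding unif_loc_bounded_def by blast
  obtain B where B: "\<forall>\<^sub>F h in at_right 0. \<forall>x\<in>K. norm (g h x) \<le> B"
    using assms(2) \<open>compact K\<close> unfolding unif_loc_bounded_def by blast
  from A B have "\<forall>\<^sub>F h in at_right 0. \<forall>x\<in>K. norm (r h x) \<le> R A B"
    by eventually_elim (use assms(3) in blast)
  then show "\<exists>C. \<forall>\<^sub>F h in at_right 0. \<forall>x\<in>K. norm (r h x) \<le> C" by blast
qed

lemma unif_C_const: "unif_C k (\<lambda>h x. c)"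
proof (induction k arbitrary: c)
  case 0
  then show ?case by (auto simp: unif_loc_bounded_def intro: exI[of _ "norm c"])
next
  case (Suc k)
  have "dird b (\<lambda>x. c) = (\<lambda>x. 0)" for b :: 'a by (intro ext dird_const)
  then show ?case using Suc by (auto simp: unif_loc_bounded_def intro: exI[of _ "norm c"])
qed

lemma unif_C_add:
  assumes "unif_C k f" "unif_C k g"
  shows "unif_C k (\<lambda>h x. f h x + g h x)"
proof -
  have bounded: "unif_loc_bounded (\<lambda>h x. f h x + g h x)"
    if "unif_loc_bounded f" "unif_loc_bounded g" for f g :: "real \<Rightarrow> 'a \<Rightarrow> 'b"
    using that
  proof (rule unif_loc_boundedI2[where R = "(+)"])
    fix h x a b assume ab: "norm (f h x) \<le> a" "norm (g h x) \<le> b"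
    show "norm (f h x + g h x) \<le> a + b"
      using ab by (rule norm_triangle_mono)
  qed
  show ?thesis
    using assms
  proof (induction k arbitrary: f g)
    case 0
    then show ?case using bounded by simp
  next
    case (Suc k)
    note diff = Suc.prems[THEN unif_C_differentiable]
    have "unif_loc_bounded (\<lambda>h x. f h x + g h x)"
      by (rule bounded[OF Suc.prems[THEN unif_C_loc_bounded]])
    moreover have "\<forall>\<^sub>F h in at_right 0. \<forall>x. (\<lambda>x. f h x + g h x) differentiable at x"
      using diff by eventually_elim auto
    moreover have "unif_C k (\<lambda>h. dird b (\<lambda>x. f h x + g h x))" if "b \<in> Basis" for b
    proof (rule unif_C_cong)
      show "unif_C k (\<lambda>h x. dird b (f h) x + dird b (g h) x)"
        using Suc that by simp
      show "\<forall>\<^sub>F h in at_right 0. (\<lambda>x. dird b (f h) x + dird b (g h) x) = dird b (\<lambda>x. f h x + g h x)"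
        using diff by eventually_elim (auto simp: dird_add)
    qed
    ultimately show ?case by simp
  qed
qed

lemma unif_C_sum:
  assumes "\<And>i. i \<in> I \<Longrightarrow> unif_C k (f i)"
  shows "unif_C k (\<lambda>h x. \<Sum>i\<in>I. f i h x)"
  using assms
proof (induction I rule: infinite_finite_induct)
  case (insert i I)
  then have "unif_C k (\<lambda>h x. f i h x + (\<Sum>i\<in>I. f i h x))"
    by (intro unif_C_add) simp_all
  with insert.hyps show ?case by simp
qed (simp_all add: unif_C_const)

lemma unif_C_mult:
  fixes f g :: "real \<Rightarrow> 'a::euclidean_space \<Rightarrow> real"
  assumes "unif_C k f" "unif_C k g"
  shows "unif_C k (\<lambda>h x. f h x * g h x)"
proof -
  have bounded: "unif_loc_bounded (\<lambda>h x. f h x * g h x)"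
    if "unif_loc_bounded f" "unif_loc_bounded g" for f g :: "real \<Rightarrow> 'a \<Rightarrow> real"
    using that
  proof (rule unif_loc_boundedI2[where R = "(*)"])
    fix h x a b assume ab: "norm (f h x) \<le> a" "norm (g h x) \<le> b"
    show "norm (f h x * g h x) \<le> a * b"
      unfolding norm_mult using ab by (intro mult_mono') auto
  qed
  show ?thesis
    using assms
  proof (induction k arbitrary: f g)
    case 0
    then show ?case using bounded by simp
  next
    case (Suc k)
    note diff = Suc.prems[THEN unif_C_differentiable]
    have "unif_loc_bounded (\<lambda>h x. f h x * g h x)"
      by (rule bounded[OF Suc.prems[THEN unif_C_loc_bounded]])
    moreover have "\<forall>\<^sub>F h in at_right 0. \<forall>x. (\<lambda>x. f h x * g h x) differentiable at x"
      using diff by eventually_elim auto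
    moreover have "unif_C k (\<lambda>h. dird b (\<lambda>x. f h x * g h x))" if "b \<in> Basis" for b
    proof (rule unif_C_cong)
      show "unif_C k (\<lambda>h x. f h x * dird b (g h) x + dird b (f h) x * g h x)"
        by (intro unif_C_add Suc.IH Suc.prems[THEN unif_C_SucD] Suc.prems[THEN unif_C_dird] that)
      show "\<forall>\<^sub>F h in at_right 0. (\<lambda>x. f h x * dird b (g h) x + dird b (f h) x * g h x)
          = dird b (\<lambda>x. f h x * g h x)"
        using diff by eventually_elim (auto simp: dird_mult)
    qed
    ultimately show ?case by simp
  qed
qed

lemma unif_C_bounded_linear:
  assumes "unif_C k f" "bounded_linear L"
  shows "unif_C k (\<lambda>h x. L (f h x))"
proof -
  have bounded: "unif_loc_bounded (\<lambda>h x. L (f h x))" if "unif_loc_bounded f"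
    for f :: "real \<Rightarrow> 'a \<Rightarrow> 'b"
  proof (rule unif_loc_boundedI2[OF that that, where R = "\<lambda>a b. onorm L * a"])
    fix h x a assume "norm (f h x) \<le> a"
    then have "onorm L * norm (f h x) \<le> onorm L * a"
      by (intro mult_left_mono onorm_pos_le assms(2))
    with onorm[OF assms(2), of "f h x"] show "norm (L (f h x)) \<le> onorm L * a" by linarith
  qed
  show ?thesis
    using assms(1)
  proof (induction k arbitrary: f)
    case 0
    then show ?case using bounded by simp
  next
    case (Suc k)
    note diff = Suc.prems[THEN unif_C_differentiable]
    have "unif_loc_bounded (\<lambda>h x. L (f h x))"
      using bounded Suc.prems by simp
    moreover have "\<forall>\<^sub>F h in at_right 0. \<forall>x. (\<lambda>x. L (f h x)) differentiable at x"
      using diff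
      by eventually_elim (metis assms(2) bounded_linear.has_derivative differentiable_def)
    moreover have "unif_C k (\<lambda>h. dird b (\<lambda>x. L (f h x)))" if "b \<in> Basis" for b
    proof (rule unif_C_cong)
      show "unif_C k (\<lambda>h x. L (dird b (f h) x))"
        using Suc.prems that by (intro Suc.IH) auto
      show "\<forall>\<^sub>F h in at_right 0. (\<lambda>x. L (dird b (f h) x)) = dird b (\<lambda>x. L (f h x))"
        using diff by eventually_elim (auto simp: dird_bounded_linear assms(2))
    qed
    ultimately show ?case by simp
  qed
qed

lemma unif_C_iter_pd:
  fixes f :: "real \<Rightarrow> 'a::euclidean_space \<Rightarrow> 'b::real_normed_vector"
  assumes smooth: "\<forall>\<^sub>F h in at_right 0. C_inf (f h)"
    and bound: "\<And>bs. set bs \<subseteq> Basis \<Longrightarrow> unif_loc_bounded (\<lambda>h. iter_pd bs (f h))"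
    and bs: "set bs \<subseteq> Basis"
  shows "unif_C k (\<lambda>h. iter_pd bs (f h))"
  using bs
proof (induction k arbitrary: bs)
  case 0
  then show ?case using bound by simp
next
  case (Suc k)
  have "\<forall>\<^sub>F h in at_right 0. \<forall>x. iter_pd bs (f h) differentiable at x"
    using smooth
    by eventually_elim (use Suc.prems in \<open>auto simp: C_inf_def C_k_def\<close>)
  moreover have "unif_C k (\<lambda>h. dird b (iter_pd bs (f h)))" if "b \<in> Basis" for b
    using Suc.IH[of "b # bs"] Suc.prems that by (simp add: iter_pd_def)
  ultimately show ?case using bound Suc.prems by simp
qed

lemma differentiable_prod:
  fixes f :: "'i \<Rightarrow> 'a::real_normed_vector \<Rightarrow> real"
  assumes "\<And>i. i \<in> I \<Longrightarrow> f i differentiable at x"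
  shows "(\<lambda>x. \<Prod>i\<in>I. f i x) differentiable at x"
  using assms by (induction I rule: infinite_finite_induct) auto

lemma matrix_inv_inverse:
  assumes "invertible A"
  shows "A ** matrix_inv A = mat 1" "matrix_inv A ** A = mat 1"
  using assms someI_ex[of "\<lambda>A'. A ** A' = mat 1 \<and> A' ** A = mat 1"]
  unfolding invertible_def matrix_inv_def by blast+

text \<open>
  By Cramer's rule the entries of the inverse are rational functions of the entries of the matrix, which
  shows that they are differentiable.
\<close>

lemma matrix_inv_entry_cramer:
  fixes A :: "real^'n^'n"
  assumes "invertible A"
  shows "matrix_inv A $ k $ j =
    det (\<chi> i j'. if j' = k then (if i = j then 1 else 0) else A $ i $ j') / det A"
proof -
  have det: "det A \<noteq> 0" using assms invertible_det_nz by blast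
  have "A *v (matrix_inv A *v axis j 1) = axis j 1"
    using matrix_inv_inverse(1)[OF assms] by (simp add: matrix_vector_mul_assoc)
  then have "matrix_inv A *v axis j 1 =
      (\<chi> k. det (\<chi> i j'. if j' = k then axis j 1 $ i else A $ i $ j') / det A)"
    using cramer[OF det] by blast
  then have "(matrix_inv A *v axis j 1) $ k =
      det (\<chi> i j'. if j' = k then axis j 1 $ i else A $ i $ j') / det A"
    by simp
  moreover have "(matrix_inv A *v axis j 1) $ k = matrix_inv A $ k $ j"
    by (simp add: matrix_vector_mult_basis column_def)
  moreover have "(\<chi> i j'. if j' = k then axis j 1 $ i else A $ i $ j')
      = (\<chi> i j'. if j' = k then (if i = j then 1 else 0) else A $ i $ j')"
    by (auto simp: vec_eq_iff axis_def)
  ultimately show ?thesis by simp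
qed

lemma differentiable_det:
  fixes A :: "'a::real_normed_vector \<Rightarrow> real^'n^'n"
  assumes "\<And>i j. (\<lambda>x. A x $ i $ j) differentiable at x"
  shows "(\<lambda>x. det (A x)) differentiable at x"
  unfolding det_def
  by (intro differentiable_sum ballI differentiable_mult differentiable_const differentiable_prod assms)
    (simp add: finite_permutations)

lemma differentiable_matrix_inv_entry:
  fixes A :: "'a::real_normed_vector \<Rightarrow> real^'n^'n"
  assumes inv: "\<And>x. invertible (A x)" and A: "\<And>i j. (\<lambda>x. A x $ i $ j) differentiable at x"
  shows "(\<lambda>x. matrix_inv (A x) $ k $ j) differentiable at x"
proof -
  have nz: "det (A x) \<noteq> 0" using inv by (simp add: invertible_det_nz[symmetric])
  have "(\<lambda>x. (\<chi> i j'. if j' = k then (if i = j then 1 else 0) else A x $ i $ j') $ i $ l) differentiable at x"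
    for i l
    by (cases "l = k") (simp_all add: A)
  then show ?thesis
    unfolding matrix_inv_entry_cramer[OF inv]
    by (intro differentiable_divide differentiable_det A nz)
qed

text \<open>
  The formula \<open>B' = - B A' B\<close> for \<open>B = A\<^sup>-\<^sup>1\<close>, from differentiating \<open>A B = 1\<close> and multiplying by \<open>B\<close> from the
  left.
\<close>

lemma dird_matrix_inv_entry:
  fixes A :: "'a::euclidean_space \<Rightarrow> real^'n^'n"
  assumes inv: "\<And>x. invertible (A x)" and A: "\<And>i j. (\<lambda>x. A x $ i $ j) differentiable at x"
  shows "dird b (\<lambda>x. matrix_inv (A x) $ i $ j) x =
    (\<Sum>p\<in>UNIV. \<Sum>q\<in>UNIV. (-1) * (matrix_inv (A x) $ i $ p *
      (dird b (\<lambda>x. A x $ p $ q) x * matrix_inv (A x) $ q $ j)))"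
proof -
  define B where "B x = matrix_inv (A x)" for x
  define A' where "A' p q = dird b (\<lambda>x. A x $ p $ q) x" for p q
  define B' where "B' p q = dird b (\<lambda>x. B x $ p $ q) x" for p q
  have B: "(\<lambda>x. B x $ i $ j) differentiable at x" for i j
    unfolding B_def by (rule differentiable_matrix_inv_entry[OF inv A])
  have AB: "(\<Sum>q\<in>UNIV. A y $ p $ q * B y $ q $ j) = (if p = j then 1 else 0)" for y p
    using arg_cong[OF matrix_inv_inverse(1)[OF inv, of y], of "\<lambda>M. M $ p $ j"]
    by (simp add: B_def matrix_matrix_mult_def mat_def)
  have BA: "(\<Sum>p\<in>UNIV. B y $ i $ p * A y $ p $ q) = (if i = q then 1 else 0)" for y q
    using arg_cong[OF matrix_inv_inverse(2)[OF inv, of y], of "\<lambda>M. M $ i $ q"]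
    by (simp add: B_def matrix_matrix_mult_def mat_def)
  have 0: "(\<Sum>q\<in>UNIV. A x $ p $ q * B' q j) = - (\<Sum>q\<in>UNIV. A' p q * B x $ q $ j)" for p
  proof -
    have "((\<lambda>y. \<Sum>q\<in>UNIV. A y $ p $ q * B y $ q $ j) has_derivative
       (\<lambda>v. \<Sum>q\<in>UNIV. A x $ p $ q * frechet_derivative (\<lambda>x. B x $ q $ j) (at x) v
          + frechet_derivative (\<lambda>x. A x $ p $ q) (at x) v * B x $ q $ j)) (at x)"
      by (intro has_derivative_sum has_derivative_mult frechet_derivative_works[THEN iffD1] A B)
    from dird_eqI[OF this, of b]
    have "dird b (\<lambda>y. \<Sum>q\<in>UNIV. A y $ p $ q * B y $ q $ j) x
        = (\<Sum>q\<in>UNIV. A x $ p $ q * B' q j + A' p q * B x $ q $ j)"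
      by (simp add: A'_def B'_def dird_def)
    moreover have "dird b (\<lambda>y. \<Sum>q\<in>UNIV. A y $ p $ q * B y $ q $ j) x = 0"
      unfolding AB by (rule dird_const)
    ultimately show ?thesis by (simp add: sum.distrib)
  qed
  have "B' i j = (\<Sum>q\<in>UNIV. (if i = q then 1 else 0) * B' q j)"
    by (simp add: if_distrib[of "\<lambda>t. t * _"] cong: if_cong)
  also have "\<dots> = (\<Sum>q\<in>UNIV. \<Sum>p\<in>UNIV. B x $ i $ p * (A x $ p $ q * B' q j))"
    by (simp add: BA[of x, symmetric] sum_distrib_right mult.assoc)
  also have "\<dots> = (\<Sum>p\<in>UNIV. \<Sum>q\<in>UNIV. B x $ i $ p * (A x $ p $ q * B' q j))"
    by (rule sum.swap)
  also have "\<dots> = (\<Sum>p\<in>UNIV. B x $ i $ p * (\<Sum>q\<in>UNIV. A x $ p $ q * B' q j))"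
    by (simp add: sum_distrib_left)
  also have "\<dots> = (\<Sum>p\<in>UNIV. \<Sum>q\<in>UNIV. (-1) * (B x $ i $ p * (A' p q * B x $ q $ j)))"
    unfolding 0 by (simp add: sum_distrib_left sum_negf)
  finally show ?thesis by (simp add: A'_def B'_def B_def)
qed

text \<open>
  The derivative formula expresses the derivatives of order \<open>k + 1\<close> of the inverse by its derivatives of
  order at most \<open>k\<close> and those of the matrix; this reduces everything to the local bound on the inverse
  itself.
\<close>

lemma unif_C_matrix_inv:
  fixes A :: "real \<Rightarrow> 'a::euclidean_space \<Rightarrow> real^'n^'n"
  assumes A: "\<And>k i j. unif_C k (\<lambda>h x. A h x $ i $ j)"
    and inv: "\<forall>\<^sub>F h in at_right 0. \<forall>x. invertible (A h x)"
    and bound: "unif_loc_bounded (\<lambda>h x. matrix_inv (A h x))"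
  shows "unif_C k (\<lambda>h x. matrix_inv (A h x) $ i $ j)"
proof -
  have *: "unif_loc_bounded (\<lambda>h x. matrix_inv (A h x) $ i $ j)" for i j
  proof (rule unif_loc_boundedI2[OF bound bound, where R = "\<lambda>a b. a"])
    fix h x a b assume "norm (matrix_inv (A h x)) \<le> a"
    then show "norm (matrix_inv (A h x) $ i $ j) \<le> a"
      by (meson Finite_Cartesian_Product.norm_nth_le order_trans)
  qed
  show ?thesis
  proof (induction k arbitrary: i j)
  case 0
  show ?case using * by simp
  case (Suc k)
  have diff: "\<forall>\<^sub>F h in at_right 0. \<forall>i j x. (\<lambda>x. A h x $ i $ j) differentiable at x"
    using unif_C_differentiable[OF A] by (intro eventually_all_finite) auto
  have "\<forall>\<^sub>F h in at_right 0. \<forall>x. (\<lambda>x. matrix_inv (A h x) $ i $ j) differentiable at x"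
    using diff inv by eventually_elim (auto intro: differentiable_matrix_inv_entry)
  moreover have "unif_C k (\<lambda>h. dird b (\<lambda>x. matrix_inv (A h x) $ i $ j))" if b: "b \<in> Basis" for b
  proof (rule unif_C_cong)
    show "unif_C k (\<lambda>h x. \<Sum>p\<in>UNIV. \<Sum>q\<in>UNIV. (-1) * (matrix_inv (A h x) $ i $ p *
      (dird b (\<lambda>x. A h x $ p $ q) x * matrix_inv (A h x) $ q $ j)))"
      by (intro unif_C_sum unif_C_mult unif_C_const Suc.IH unif_C_dird[OF A b])
    show "\<forall>\<^sub>F h in at_right 0. (\<lambda>x. \<Sum>p\<in>UNIV. \<Sum>q\<in>UNIV. (-1) * (matrix_inv (A h x) $ i $ p *
      (dird b (\<lambda>x. A h x $ p $ q) x * matrix_inv (A h x) $ q $ j)))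
        = dird b (\<lambda>x. matrix_inv (A h x) $ i $ j)"
      using diff inv by eventually_elim (auto simp: dird_matrix_inv_entry)
  qed
  ultimately show ?case using * by simp
  qed
qed

lemma dsH_dxH_entry:
  fixes H0 :: "real^'n \<Rightarrow> real^'n \<Rightarrow> real^'n"
  assumes "(\<lambda>(u, x). H0 u x) differentiable at (u, x)"
  shows "dsH H0 u x $ i $ j = dird (axis j 1, 0) (\<lambda>(u, x). H0 u x) (u, x) $ i"
    and "dxH H0 u x $ i $ j = dird (0, axis j 1) (\<lambda>(u, x). H0 u x) (u, x) $ i"
  using dird_partial[OF assms]
  by (simp_all add: dsH_def dxH_def jacobian_def matrix_def dird_def)

lemma Basis_pair_axis:
  "(axis j (1::real), 0) \<in> (Basis :: ((real^'n) \<times> (real^'n)) set)"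
  "(0, axis j (1::real)) \<in> (Basis :: ((real^'n) \<times> (real^'n)) set)"
  by (auto simp: Basis_prod_def axis_in_Basis_iff)

text \<open>
  The partial derivatives of \<open>J\<close> in \<open>s\<close> and in \<open>x\<close> are partial derivatives in coordinate directions of the
  product space.
\<close>

lemma unif_C_Jmat:
  fixes G :: "real \<Rightarrow> real^'n \<Rightarrow> real^'n \<Rightarrow> real^'n"
  assumes smooth: "\<forall>\<^sub>F h in at_right 0. C_inf (\<lambda>(u, x). G h u x)"
    and bound: "\<And>bs. set bs \<subseteq> Basis \<Longrightarrow> unif_loc_bounded (\<lambda>h. iter_pd bs (\<lambda>(u, x). G h u x))"
    and inv: "\<forall>\<^sub>F h in at_right 0. \<forall>u x. invertible (dxH (G h) u x)"
    and inv_bound: "unif_loc_bounded (\<lambda>h (u, x). matrix_inv (dxH (G h) u x))"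
  shows "unif_C k (\<lambda>h (u, x). Jmat (G h) u x $ p $ l)"
    and "unif_C k (\<lambda>h (u, x). dsJ (G h) m p l u x)"
    and "unif_C k (\<lambda>h (u, x). dxJ (G h) m p l u x)"
proof -
  have iter: "unif_C k (\<lambda>h. dird b (\<lambda>(u, x). G h u x))" if "b \<in> Basis" for k b
    using unif_C_iter_pd[OF smooth bound, of "[b]" k] that by (simp add: iter_pd_def)
  have diff: "\<forall>\<^sub>F h in at_right 0. \<forall>x. (\<lambda>(u, x). G h u x) differentiable at x"
    using smooth
  proof eventually_elim
    case (elim h)
    then have "C_k 1 (\<lambda>(u, x). G h u x)" by (simp add: C_inf_def)
    then show ?case unfolding C_k_def iter_pd_def by (auto dest: spec[of _ "[]"])
  qed
  have dx: "unif_C k (\<lambda>h (u, x). dxH (G h) u x $ i $ j)" for k i j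
  proof (rule unif_C_cong)
    show "unif_C k (\<lambda>h y. dird (0, axis j 1) (\<lambda>(u, x). G h u x) y $ i)"
      by (intro unif_C_bounded_linear[OF _ bounded_linear_vec_nth] iter Basis_pair_axis)
    show "\<forall>\<^sub>F h in at_right 0. (\<lambda>y. dird (0, axis j 1) (\<lambda>(u, x). G h u x) y $ i)
        = (\<lambda>(u, x). dxH (G h) u x $ i $ j)"
      using diff by eventually_elim (auto simp: dsH_dxH_entry)
  qed
  have ds: "unif_C k (\<lambda>h (u, x). dsH (G h) u x $ i $ j)" for k i j
  proof (rule unif_C_cong)
    show "unif_C k (\<lambda>h y. dird (axis j 1, 0) (\<lambda>(u, x). G h u x) y $ i)"
      by (intro unif_C_bounded_linear[OF _ bounded_linear_vec_nth] iter Basis_pair_axis)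
    show "\<forall>\<^sub>F h in at_right 0. (\<lambda>y. dird (axis j 1, 0) (\<lambda>(u, x). G h u x) y $ i)
        = (\<lambda>(u, x). dsH (G h) u x $ i $ j)"
      using diff by eventually_elim (auto simp: dsH_dxH_entry)
  qed
  have minv: "unif_C k (\<lambda>h (u, x). matrix_inv (dxH (G h) u x) $ i $ j)" for k i j
    using unif_C_matrix_inv[of "\<lambda>h (u, x). dxH (G h) u x" k i j] dx inv inv_bound
    by (simp add: case_prod_unfold)
  have J: "unif_C k (\<lambda>h (u, x). Jmat (G h) u x $ p $ l)" for k p l
  proof -
    have "unif_C k (\<lambda>h y. \<Sum>q\<in>UNIV. (case y of (u, x) \<Rightarrow> matrix_inv (dxH (G h) u x) $ p $ q) *
        (case y of (u, x) \<Rightarrow> dsH (G h) u x $ q $ l))"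
      by (intro unif_C_sum unif_C_mult minv ds)
    then show ?thesis by (simp add: Jmat_def matrix_matrix_mult_def case_prod_unfold)
  qed
  then show "unif_C k (\<lambda>h (u, x). Jmat (G h) u x $ p $ l)" .
  have J_diff: "\<forall>\<^sub>F h in at_right 0. \<forall>x. (\<lambda>(u, x). Jmat (G h) u x $ p $ l) differentiable at x"
    by (rule unif_C_differentiable[OF J])
  show "unif_C k (\<lambda>h (u, x). dsJ (G h) m p l u x)"
  proof (rule unif_C_cong)
    show "unif_C k (\<lambda>h. dird (axis m 1, 0) (\<lambda>(u, x). Jmat (G h) u x $ p $ l))"
      by (intro unif_C_dird[OF J] Basis_pair_axis)
    show "\<forall>\<^sub>F h in at_right 0. dird (axis m 1, 0) (\<lambda>(u, x). Jmat (G h) u x $ p $ l)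
        = (\<lambda>(u, x). dsJ (G h) m p l u x)"
      using J_diff by eventually_elim (auto simp: dsJ_def dird_partial[symmetric])
  qed
  show "unif_C k (\<lambda>h (u, x). dxJ (G h) m p l u x)"
  proof (rule unif_C_cong)
    show "unif_C k (\<lambda>h. dird (0, axis m 1) (\<lambda>(u, x). Jmat (G h) u x $ p $ l))"
      by (intro unif_C_dird[OF J] Basis_pair_axis)
    show "\<forall>\<^sub>F h in at_right 0. dird (0, axis m 1) (\<lambda>(u, x). Jmat (G h) u x $ p $ l)
        = (\<lambda>(u, x). dxJ (G h) m p l u x)"
      using J_diff by eventually_elim (auto simp: dxJ_def dird_partial[symmetric])
  qed
qed

lemma unif_loc_bounded_finite:
  assumes "finite I" "\<And>i. i \<in> I \<Longrightarrow> unif_loc_bounded (f i)" "compact K"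
  shows "\<exists>C\<ge>0. \<forall>\<^sub>F h in at_right 0. \<forall>i\<in>I. \<forall>x\<in>K. norm (f i h x) \<le> C"
proof -
  have "\<exists>C k::nat. 0 \<le> C \<and> (\<forall>i\<in>I. \<forall>\<^sub>F h in at_right 0. \<forall>x\<in>K. norm (f i h x) \<le> C)"
  proof (rule uniform_poly_constants[OF assms(1)])
    show "\<exists>C k. \<forall>\<^sub>F h in at_right 0. \<forall>x\<in>K. norm (f i h x) \<le> C" if "i \<in> I" for i
      using assms(2)[OF that] assms(3) by (auto simp: unif_loc_bounded_def)
  next
    fix i and C C' :: real
    assume "\<forall>\<^sub>F h in at_right 0. \<forall>x\<in>K. norm (f i h x) \<le> C" "C \<le> C'"
    then show "\<forall>\<^sub>F h in at_right 0. \<forall>x\<in>K. norm (f i h x) \<le> C'"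
      by (auto elim!: eventually_mono)
  qed
  then show ?thesis using assms(1) by (auto simp: eventually_ball_finite_distrib)
qed

text \<open>
  The segment between the two points lies in the compact set \<open>{s} \<times> cball 0 1\<close>, on which the derivatives are
  bounded uniformly in \<open>h\<close>.
\<close>

lemma unif_C_increment:
  fixes g :: "real \<Rightarrow> 'a::euclidean_space \<times> 'b::euclidean_space \<Rightarrow> real"
  assumes "unif_C (Suc 0) g"
  shows "\<exists>C\<ge>0. \<forall>\<^sub>F h in at_right 0. \<forall>y. norm y \<le> 1 \<longrightarrow> norm (g h (s, y) - g h (s, 0)) \<le> C * norm y"
proof -
  let ?U = "{s} \<times> cball (0::'b) 1"
  have U: "convex ?U" "compact ?U" by (auto intro: convex_Times compact_Times)
  obtain C where C: "0 \<le> C" "\<forall>\<^sub>F h in at_right 0. \<forall>b\<in>Basis. \<forall>x\<in>?U. norm (dird b (g h) x) \<le> C"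
    using unif_loc_bounded_finite[of Basis "\<lambda>b h. dird b (g h)", OF _ _ U(2)] assms by auto
  have "\<forall>\<^sub>F h in at_right 0. \<forall>y. norm y \<le> 1 \<longrightarrow>
      norm (g h (s, y) - g h (s, 0)) \<le> (real DIM('a \<times> 'b) * C) * norm y"
    using C(2) unif_C_differentiable[OF assms]
  proof eventually_elim
    case (elim h)
    show ?case
    proof (intro allI impI)
      fix y :: 'b assume "norm y \<le> 1"
      then have "norm (g h (s, y) - g h (s, 0)) \<le> real DIM('a \<times> 'b) * C * norm ((s, y) - (s, 0::'b))"
        by (intro increment_bound[OF U(1)]) (use elim in auto)
      then show "norm (g h (s, y) - g h (s, 0)) \<le> (real DIM('a \<times> 'b) * C) * norm y"
        by (simp add: norm_Pair)
    qed
  qed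
  then show ?thesis using C(1) by (intro exI[of _ "real DIM('a \<times> 'b) * C"]) auto
qed

lemma unif_C_second_difference:
  fixes g :: "real \<Rightarrow> 'a::euclidean_space \<times> 'b::euclidean_space \<Rightarrow> real"
  assumes g: "unif_C (Suc (Suc 0)) g"
  shows "\<exists>C\<ge>0. \<forall>\<^sub>F h in at_right 0. \<forall>y. norm y \<le> 1 \<longrightarrow>
    norm (g h (s, y) - 2 *\<^sub>R g h (s, 0) + g h (s, - y)) \<le> C * (norm y)\<^sup>2"
proof -
  let ?U = "{s} \<times> cball (0::'b) 1"
  have U: "convex ?U" "compact ?U" by (auto intro: convex_Times compact_Times)
  obtain C1 where C1: "0 \<le> C1" "\<forall>\<^sub>F h in at_right 0. \<forall>b\<in>Basis. \<forall>x\<in>?U. norm (dird b (g h) x) \<le> C1"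
    using unif_loc_bounded_finite[of Basis "\<lambda>b h. dird b (g h)", OF _ _ U(2)] g by auto
  have "\<exists>C\<ge>0. \<forall>\<^sub>F h in at_right 0. \<forall>i\<in>Basis \<times> Basis. \<forall>x\<in>?U. norm (dird (snd i) (dird (fst i) (g h)) x) \<le> C"
    using g by (intro unif_loc_bounded_finite U(2) finite_cartesian_product) auto
  then obtain C2 where C2: "0 \<le> C2"
    "\<forall>\<^sub>F h in at_right 0. \<forall>i\<in>Basis \<times> Basis. \<forall>x\<in>?U. norm (dird (snd i) (dird (fst i) (g h)) x) \<le> C2"
    by blast
  have d: "\<forall>\<^sub>F h in at_right 0. \<forall>b\<in>Basis. \<forall>x. dird b (g h) differentiable at x"
    using g by (simp add: eventually_ball_finite_distrib)
  define D where "D = 2 * (real DIM('a \<times> 'b))\<^sup>2 * (C1 + C2)"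
  have "\<forall>\<^sub>F h in at_right 0. \<forall>y. norm y \<le> 1 \<longrightarrow>
      norm (g h (s, y) - 2 *\<^sub>R g h (s, 0) + g h (s, - y)) \<le> (2 * D) * (norm y)\<^sup>2"
    using C1(2) C2(2) d unif_C_differentiable[OF g]
  proof eventually_elim
    case (elim h)
    show ?case
    proof (intro allI impI)
      fix y :: 'b assume y: "norm y \<le> 1"
      have "norm (g h (s, y) - 2 *\<^sub>R g h (s, 0) + g h (s, - y)) \<le>
        2 * (real DIM('a \<times> 'b))\<^sup>2 * (C1 + C2) * (norm ((s, y) - 2 *\<^sub>R (s, 0) + (s, - y)) +
          (norm ((s, y) - (s, 0::'b)))\<^sup>2 + (norm ((s, - y) - (s, 0)))\<^sup>2)"
      proof (rule second_difference_bound[OF U(1)])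
        fix e e' :: "'a \<times> 'b" and x assume e: "e \<in> Basis" "e' \<in> Basis" "x \<in> ?U"
        from elim(1) e have "norm (dird e (g h) x) \<le> C1" by blast
        then show "norm (dird e (g h) x) \<le> C1 + C2" using C2(1) by linarith
        from elim(2) e have "norm (dird e' (dird e (g h)) x) \<le> C2" by fastforce
        then show "norm (dird e' (dird e (g h)) x) \<le> C1 + C2" using C1(1) by linarith
      qed (use y elim in auto)
      also have "\<dots> = (2 * D) * (norm y)\<^sup>2"
        by (simp add: norm_Pair scaleR_2 D_def)
      finally show "norm (g h (s, y) - 2 *\<^sub>R g h (s, 0) + g h (s, - y)) \<le> (2 * D) * (norm y)\<^sup>2" .
    qed
  qed
  moreover have "0 \<le> 2 * D" using C1(1) C2(1) by (simp add: D_def)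
  ultimately show ?thesis by blast
qed

section \<open>Symmetric differences of functionals of the path\<close>

definition weight :: "nat \<Rightarrow> (nat \<Rightarrow> 'v::real_normed_vector) \<Rightarrow> real" where
  "weight N z = 1 + (\<Sum>i\<in>{1..N}. norm (z i))"

text \<open>
  Order \<open>sqrt h ^ p\<close> uniformly in the increments \<open>z\<close>, up to a power of the weight.  Measuring orders in
  powers of \<open>sqrt h\<close> makes them additive under products.
\<close>

definition dominated ::
  "nat \<Rightarrow> nat \<Rightarrow> (real \<Rightarrow> (nat \<Rightarrow> 'v::real_normed_vector) \<Rightarrow> 'b::real_normed_vector) \<Rightarrow> bool" where
  "dominated N p X \<longleftrightarrow> (\<exists>C k. 0 \<le> C \<and>
     (\<forall>\<^sub>F h in at_right 0. \<forall>z. norm (X h z) \<le> C * weight N z ^ k * sqrt h ^ p))"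

lemma weight_ge_1: "1 \<le> weight N z"
  by (simp add: weight_def sum_nonneg)

lemma weight_nonneg: "0 \<le> weight N z"
  using weight_ge_1[of N z] by simp

lemma weight_hat: "weight N (hat z) = weight N z"
  unfolding weight_def hat_def by (intro arg_cong2[of _ _ _ _ "(+)"] refl sum.cong) auto

lemma weight_bar: "weight N (bar z) \<le> weight N z"
  unfolding weight_def bar_def by (intro add_left_mono sum_mono) auto

lemma dominatedI:
  assumes "0 \<le> C" "\<forall>\<^sub>F h in at_right 0. \<forall>z. norm (X h z) \<le> C * weight N z ^ k * sqrt h ^ p"
  shows "dominated N p X"
  using assms unfolding dominated_def by blast

lemma dominated_le:
  assumes "dominated N p Y" "\<forall>\<^sub>F h in at_right 0. \<forall>z. norm (X h z) \<le> norm (Y h z)"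
  shows "dominated N p X"
proof -
  from assms(1) obtain C k where C: "0 \<le> C"
    and Y: "\<forall>\<^sub>F h in at_right 0. \<forall>z. norm (Y h z) \<le> C * weight N z ^ k * sqrt h ^ p"
    unfolding dominated_def by blast
  from Y assms(2) have "\<forall>\<^sub>F h in at_right 0. \<forall>z. norm (X h z) \<le> C * weight N z ^ k * sqrt h ^ p"
    by eventually_elim (blast intro: order_trans)
  with C show ?thesis by (rule dominatedI)
qed

lemma dominated_norm_iff: "dominated N p (\<lambda>h z. norm (X h z)) \<longleftrightarrow> dominated N p X"
  by (simp add: dominated_def)

lemma dominated_const: "dominated N 0 (\<lambda>h z. c)"
  by (rule dominatedI[where C = "norm c" and k = 0]) auto

lemma dominated_zero: "dominated N p (\<lambda>h z. 0)"
  by (rule dominatedI[where C = 0 and k = 0]) auto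

lemma dominated_sqrt: "dominated N 1 (\<lambda>h z. sqrt h)"
  using eventually_at_right_less[of 0]
  by (intro dominatedI[where C = 1 and k = 0]) (auto elim: eventually_mono)

lemma dominated_component:
  assumes "i \<in> {1..N}"
  shows "dominated N 0 (\<lambda>h z. z i)"
proof (rule dominatedI[where C = 1 and k = 1], simp, intro always_eventually allI)
  fix z :: "nat \<Rightarrow> 'a"
  have "norm (z i) \<le> (\<Sum>i\<in>{1..N}. norm (z i))"
    by (rule member_le_sum) (use assms in auto)
  then show "norm (z i) \<le> 1 * weight N z ^ 1 * sqrt h ^ 0" for h
    by (simp add: weight_def)
qed

lemma dominated_add:
  assumes "dominated N p X" "dominated N p Y"
  shows "dominated N p (\<lambda>h z. X h z + Y h z)"
proof -
  obtain C k where C: "0 \<le> C"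
    "\<forall>\<^sub>F h in at_right 0. \<forall>z. norm (X h z) \<le> C * weight N z ^ k * sqrt h ^ p"
    using assms(1) unfolding dominated_def by blast
  obtain D l where D: "0 \<le> D"
    "\<forall>\<^sub>F h in at_right 0. \<forall>z. norm (Y h z) \<le> D * weight N z ^ l * sqrt h ^ p"
    using assms(2) unfolding dominated_def by blast
  have "\<forall>\<^sub>F h in at_right 0. \<forall>z. norm (X h z + Y h z) \<le> (C + D) * weight N z ^ (k + l) * sqrt h ^ p"
    using C(2) D(2) eventually_at_right_less[of 0]
  proof eventually_elim
    case (elim h)
    show ?case
    proof
      fix z :: "nat \<Rightarrow> 'a"
      have "norm (X h z) \<le> C * weight N z ^ (k + l) * sqrt h ^ p"
        using elim C(1) weight_ge_1[of N z]
        by (intro order_trans[OF elim(1)[rule_format]] mult_right_mono mult_left_mono power_increasing) auto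
      moreover have "norm (Y h z) \<le> D * weight N z ^ (k + l) * sqrt h ^ p"
        using elim D(1) weight_ge_1[of N z]
        by (intro order_trans[OF elim(2)[rule_format]] mult_right_mono mult_left_mono power_increasing) auto
      ultimately show "norm (X h z + Y h z) \<le> (C + D) * weight N z ^ (k + l) * sqrt h ^ p"
        using norm_triangle_ineq[of "X h z" "Y h z"] by (simp add: distrib_right)
    qed
  qed
  then show ?thesis using C(1) D(1) by (intro dominatedI) auto
qed

lemma dominated_sum:
  assumes "\<And>i. i \<in> I \<Longrightarrow> dominated N p (X i)"
  shows "dominated N p (\<lambda>h z. \<Sum>i\<in>I. X i h z)"
  using assms
proof (induction I rule: infinite_finite_induct)
  case (insert i I)
  then have "dominated N p (\<lambda>h z. X i h z + (\<Sum>i\<in>I. X i h z))"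
    by (intro dominated_add) simp_all
  with insert.hyps show ?case by simp
qed (simp_all add: dominated_zero)

lemma dominated_mult:
  fixes X Y :: "real \<Rightarrow> (nat \<Rightarrow> 'v::real_normed_vector) \<Rightarrow> real"
  assumes "dominated N p X" "dominated N q Y"
  shows "dominated N (p + q) (\<lambda>h z. X h z * Y h z)"
proof -
  obtain C k where C: "0 \<le> C"
    "\<forall>\<^sub>F h in at_right 0. \<forall>z. norm (X h z) \<le> C * weight N z ^ k * sqrt h ^ p"
    using assms(1) unfolding dominated_def by blast
  obtain D l where D: "0 \<le> D"
    "\<forall>\<^sub>F h in at_right 0. \<forall>z. norm (Y h z) \<le> D * weight N z ^ l * sqrt h ^ q"
    using assms(2) unfolding dominated_def by blast
  have "\<forall>\<^sub>F h in at_right 0. \<forall>z. norm (X h z * Y h z) \<le> (C * D) * weight N z ^ (k + l) * sqrt h ^ (p + q)"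
    using C(2) D(2)
  proof eventually_elim
    case (elim h)
    show ?case
    proof
      fix z :: "nat \<Rightarrow> 'v"
      have "norm (X h z) * norm (Y h z) \<le>
          (C * weight N z ^ k * sqrt h ^ p) * (D * weight N z ^ l * sqrt h ^ q)"
        using elim by (intro mult_mono') auto
      then show "norm (X h z * Y h z) \<le> (C * D) * weight N z ^ (k + l) * sqrt h ^ (p + q)"
        by (simp add: abs_mult power_add mult_ac)
    qed
  qed
  then show ?thesis using C(1) D(1) by (intro dominatedI) auto
qed

lemma dominated_power:
  fixes X :: "real \<Rightarrow> (nat \<Rightarrow> 'v::real_normed_vector) \<Rightarrow> real"
  assumes "dominated N p X"
  shows "dominated N (k * p) (\<lambda>h z. X h z ^ k)"
proof (induction k)
  case 0
  then show ?case using dominated_const[of N "1::real"] by simp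
next
  case (Suc k)
  then show ?case using dominated_mult[OF assms Suc] by simp
qed

lemma dominated_hat:
  fixes X :: "real \<Rightarrow> (nat \<Rightarrow> real^'n) \<Rightarrow> 'b::real_normed_vector"
  assumes "dominated N p X"
  shows "dominated N p (\<lambda>h z. X h (hat z))"
proof -
  obtain C k where C: "0 \<le> C"
    "\<forall>\<^sub>F h in at_right 0. \<forall>z. norm (X h z) \<le> C * weight N z ^ k * sqrt h ^ p"
    using assms unfolding dominated_def by blast
  from C(2) have "\<forall>\<^sub>F h in at_right 0. \<forall>z. norm (X h (hat z)) \<le> C * weight N z ^ k * sqrt h ^ p"
    by eventually_elim (metis weight_hat)
  with C(1) show ?thesis by (rule dominatedI)
qed

lemma dominated_bar:
  fixes X :: "real \<Rightarrow> (nat \<Rightarrow> real^'n) \<Rightarrow> 'b::real_normed_vector"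
  assumes "dominated N p X"
  shows "dominated N p (\<lambda>h z. X h (bar z))"
proof -
  obtain C k where C: "0 \<le> C"
    "\<forall>\<^sub>F h in at_right 0. \<forall>z. norm (X h z) \<le> C * weight N z ^ k * sqrt h ^ p"
    using assms(1) unfolding dominated_def by blast
  have "\<forall>\<^sub>F h in at_right 0. \<forall>z. norm (X h (bar z)) \<le> C * weight N z ^ k * sqrt h ^ p"
    using C(2) eventually_at_right_less[of 0]
  proof eventually_elim
    case (elim h)
    show ?case
    proof
      fix z :: "nat \<Rightarrow> real^'n"
      have "C * weight N (bar z) ^ k * sqrt h ^ p \<le> C * weight N z ^ k * sqrt h ^ p"
        using elim C(1) weight_ge_1[of N "bar z"] weight_bar[of N z]
        by (intro mult_right_mono mult_left_mono power_mono) auto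
      with elim(1) show "norm (X h (bar z)) \<le> C * weight N z ^ k * sqrt h ^ p"
        by (meson order_trans)
    qed
  qed
  with C(1) show ?thesis by (rule dominatedI)
qed

lemma dominated_minus: "dominated N p X \<Longrightarrow> dominated N p (\<lambda>h z. - X h z)"
  by (simp add: dominated_def)

lemma dominated_diff:
  assumes "dominated N p X" "dominated N p Y"
  shows "dominated N p (\<lambda>h z. X h z - Y h z)"
  using dominated_add[OF assms(1) dominated_minus[OF assms(2)]] by simp

lemma dominated_divide_sqrt:
  fixes X :: "real \<Rightarrow> (nat \<Rightarrow> 'v::real_normed_vector) \<Rightarrow> real"
  assumes "dominated N p X"
  shows "dominated N 0 (\<lambda>h z. X h z / sqrt h ^ p)"
proof -
  obtain C k where C: "0 \<le> C"
    "\<forall>\<^sub>F h in at_right 0. \<forall>z. norm (X h z) \<le> C * weight N z ^ k * sqrt h ^ p"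
    using assms(1) unfolding dominated_def by blast
  have "\<forall>\<^sub>F h in at_right 0. \<forall>z. norm (X h z / sqrt h ^ p) \<le> C * weight N z ^ k * sqrt h ^ 0"
    using C(2) eventually_at_right_less[of 0]
    by eventually_elim (auto simp: pos_divide_le_eq)
  with C(1) show ?thesis by (rule dominatedI)
qed

text \<open>
  Functionals of the increments whose first difference (\<open>q = 1\<close>), respectively first and second
  difference (\<open>q = 2\<close>), under reflection of the first increment has the order of a smooth function of
  \<open>sqrt h *\<^sub>R z 1\<close>.  First differences are taken against the midpoint \<open>bar z\<close>; those between \<open>z\<close> and
  \<open>hat z\<close> follow, as \<open>hat z\<close> has the same midpoint and weight.
\<close>

definition small_diff ::
  "nat \<Rightarrow> nat \<Rightarrow> (real \<Rightarrow> (nat \<Rightarrow> real^'n) \<Rightarrow> 'b::real_normed_vector) \<Rightarrow> bool" where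
  "small_diff N q X \<longleftrightarrow> dominated N 0 X \<and> dominated N 1 (\<lambda>h z. X h z - X h (bar z)) \<and>
     (2 \<le> q \<longrightarrow> dominated N 2 (\<lambda>h z. X h z - 2 *\<^sub>R X h (bar z) + X h (hat z)))"

lemma bar_hat: "bar (hat z) = bar z"
  by (simp add: bar_def hat_def)

lemma small_diffD:
  assumes "small_diff N q X"
  shows "dominated N 0 X" "dominated N 1 (\<lambda>h z. X h z - X h (bar z))"
    "2 \<le> q \<Longrightarrow> dominated N 2 (\<lambda>h z. X h z - 2 *\<^sub>R X h (bar z) + X h (hat z))"
    "dominated N 1 (\<lambda>h z. X h (hat z) - X h (bar z))"
  using assms dominated_hat[of N 1 "\<lambda>h z. X h z - X h (bar z)"]
  by (auto simp: small_diff_def bar_hat)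

lemma small_diff_indep:
  assumes "dominated N 0 X" "\<And>h z. X h (bar z) = X h z" "\<And>h z. X h (hat z) = X h z"
  shows "small_diff N q X"
  using assms by (simp add: small_diff_def dominated_zero scaleR_2)

text \<open>
  The increment is odd in the first coordinate: its value at the midpoint and its second difference vanish.
\<close>

lemma small_diff_first_step:
  assumes "1 \<le> N"
  shows "small_diff N q (\<lambda>h z. sqrt h *\<^sub>R z 1 :: real^'n)"
proof -
  have 1: "dominated N 1 (\<lambda>h z. sqrt h * norm (z 1 :: real^'n))"
    using dominated_mult[OF dominated_sqrt dominated_norm_iff[THEN iffD2, OF dominated_component], of 1 N]
      assms by simp
  have le1: "\<forall>\<^sub>F h::real in at_right 0. h < 1"
    using eventually_at_right_real[OF zero_less_one] by (auto elim: eventually_mono)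
  have "dominated N 0 (\<lambda>h z. sqrt h *\<^sub>R z 1 :: real^'n)"
  proof (rule dominated_le[OF dominated_component[of 1 N]])
    show "\<forall>\<^sub>F h in at_right 0. \<forall>z. norm (sqrt h *\<^sub>R z 1 :: real^'n) \<le> norm (z 1)"
      using le1 eventually_at_right_less[of 0]
      by eventually_elim (auto intro!: mult_left_le_one_le)
  qed (use assms in auto)
  moreover have "dominated N 1 (\<lambda>h z. sqrt h *\<^sub>R z 1 - sqrt h *\<^sub>R bar z 1 :: real^'n)"
    by (rule dominated_le[OF 1]) (simp add: bar_def abs_mult)
  moreover have "dominated N 2 (\<lambda>h z. sqrt h *\<^sub>R z 1 - 2 *\<^sub>R (sqrt h *\<^sub>R bar z 1) + sqrt h *\<^sub>R hat z 1 :: real^'n)"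
    by (simp add: bar_def hat_def dominated_zero)
  ultimately show ?thesis by (simp add: small_diff_def)
qed

lemma dominated_Pair:
  assumes "dominated N p X" "dominated N p Y"
  shows "dominated N p (\<lambda>h z. (X h z, Y h z))"
  by (rule dominated_le[OF dominated_add[OF assms[THEN dominated_norm_iff[THEN iffD2]]]])
    (simp add: norm_Pair_le)

lemma small_diff_Pair:
  assumes "small_diff N q X" "small_diff N q Y"
  shows "small_diff N q (\<lambda>h z. (X h z, Y h z))"
  unfolding small_diff_def
  using dominated_Pair[OF small_diffD(1)[OF assms(1)] small_diffD(1)[OF assms(2)]]
    dominated_Pair[OF small_diffD(2)[OF assms(1)] small_diffD(2)[OF assms(2)]]
    dominated_Pair[OF small_diffD(3)[OF assms(1)] small_diffD(3)[OF assms(2)]]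
  by simp

lemma dominated_vec:
  fixes X :: "'m::finite \<Rightarrow> real \<Rightarrow> (nat \<Rightarrow> 'v::real_normed_vector) \<Rightarrow> 'b::real_normed_vector"
  assumes "\<And>j. dominated N p (X j)"
  shows "dominated N p (\<lambda>h z. \<chi> j. X j h z)"
proof (rule dominated_le)
  show "dominated N p (\<lambda>h z. \<Sum>j\<in>UNIV. norm (X j h z))"
    by (intro dominated_sum dominated_norm_iff[THEN iffD2] assms)
  have "norm (\<chi> j. X j h z) \<le> (\<Sum>j\<in>UNIV. norm (X j h z))" for h z
    by (simp add: norm_vec_def L2_set_le_sum)
  then show "\<forall>\<^sub>F h in at_right 0. \<forall>z. norm (\<chi> j. X j h z) \<le> norm (\<Sum>j\<in>UNIV. norm (X j h z))"
    by (auto simp: sum_nonneg)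
qed

lemma small_diff_vec:
  fixes X :: "'m::finite \<Rightarrow> real \<Rightarrow> (nat \<Rightarrow> real^'n) \<Rightarrow> 'b::real_normed_vector"
  assumes "\<And>j. small_diff N q (X j)"
  shows "small_diff N q (\<lambda>h z. \<chi> j. X j h z)"
proof -
  have "(\<chi> j. X j h z) - (\<chi> j. X j h (bar z)) = (\<chi> j. X j h z - X j h (bar z))"
    "(\<chi> j. X j h z) - 2 *\<^sub>R (\<chi> j. X j h (bar z)) + (\<chi> j. X j h (hat z))
      = (\<chi> j. X j h z - 2 *\<^sub>R X j h (bar z) + X j h (hat z))" for h z
    by (simp_all add: vec_eq_iff)
  then show ?thesis
    unfolding small_diff_def using assms[THEN small_diffD(1)] assms[THEN small_diffD(2)]
      assms[THEN small_diffD(3)] by (simp add: dominated_vec)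
qed

lemma small_diff_mult:
  fixes X Y :: "real \<Rightarrow> (nat \<Rightarrow> real^'n) \<Rightarrow> real"
  assumes X: "small_diff N q X" and Y: "small_diff N q Y"
  shows "small_diff N q (\<lambda>h z. X h z * Y h z)"
  unfolding small_diff_def
proof (intro conjI impI)
  note X' = small_diffD[OF X] and Y' = small_diffD[OF Y]
  show "dominated N 0 (\<lambda>h z. X h z * Y h z)"
    using dominated_mult[OF X'(1) Y'(1)] by simp
  have "dominated N 1 (\<lambda>h z. (X h z - X h (bar z)) * Y h z + X h (bar z) * (Y h z - Y h (bar z)))"
    using dominated_mult[OF X'(2) Y'(1)] dominated_mult[OF dominated_bar[OF X'(1)] Y'(2)]
    by (simp add: dominated_add)
  then show "dominated N 1 (\<lambda>h z. X h z * Y h z - X h (bar z) * Y h (bar z))"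
    by (simp add: algebra_simps)
  assume q: "2 \<le> q"
  \<comment> \<open>The second difference of a product, expanded around the midpoint.\<close>
  have "dominated N 2 (\<lambda>h z. (X h z - X h (bar z)) * (Y h z - Y h (bar z))
      + (X h (hat z) - X h (bar z)) * (Y h (hat z) - Y h (bar z))
      + X h (bar z) * (Y h z - 2 *\<^sub>R Y h (bar z) + Y h (hat z))
      + (X h z - 2 *\<^sub>R X h (bar z) + X h (hat z)) * Y h (bar z))"
    using dominated_mult[OF X'(2) Y'(2)] dominated_mult[OF X'(4) Y'(4)]
      dominated_mult[OF dominated_bar[OF X'(1)] Y'(3)[OF q]]
      dominated_mult[OF X'(3)[OF q] dominated_bar[OF Y'(1)]]
    by (simp add: dominated_add numeral_2_eq_2 del: real_scaleR_def)
  then show "dominated N 2 (\<lambda>h z. X h z * Y h z - 2 *\<^sub>R (X h (bar z) * Y h (bar z)) + X h (hat z) * Y h (hat z))"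
    by (simp add: algebra_simps)
qed

definition unif_lip :: "nat \<Rightarrow> (real \<Rightarrow> 'a::real_normed_vector \<Rightarrow> 'b::real_normed_vector) \<Rightarrow> bool" where
  "unif_lip q f \<longleftrightarrow> (\<exists>C k. \<forall>\<^sub>F h in at_right 0. lip_poly C k (f h)) \<and>
     (2 \<le> q \<longrightarrow> (\<exists>C k. \<forall>\<^sub>F h in at_right 0. lip2_poly C k (f h)))"

text \<open>
  The two moduli of continuity of \<open>f\<close> are evaluated at the states for \<open>z\<close>, \<open>bar z\<close> and \<open>hat z\<close>; the
  polynomial factors in the states are absorbed by the weight, and squares of first differences have the
  order of second ones.
\<close>

lemma small_diff_compose:
  fixes X :: "real \<Rightarrow> (nat \<Rightarrow> real^'n) \<Rightarrow> 'a::real_normed_vector"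
  assumes X: "small_diff N q X" and grow: "unif_poly_growth f" and lip: "unif_lip q f"
  shows "small_diff N q (\<lambda>h z. f h (X h z))"
  unfolding small_diff_def
proof (intro conjI impI)
  note X' = small_diffD[OF X]
  note n = X'(1)[THEN dominated_norm_iff[THEN iffD2]]
    X'(1)[THEN dominated_bar, THEN dominated_norm_iff[THEN iffD2]]
    X'(1)[THEN dominated_hat, THEN dominated_norm_iff[THEN iffD2]]
  obtain C k where C: "\<forall>\<^sub>F h in at_right 0. \<forall>x. norm (f h x) \<le> C * (1 + norm x) ^ k"
    using grow unfolding unif_poly_growth_def by blast
  show "dominated N 0 (\<lambda>h z. f h (X h z))"
  proof (rule dominated_le)
    have "dominated N 0 (\<lambda>h z. (1 + norm (X h z)) ^ k)"
      using dominated_power[OF dominated_add[OF dominated_const n(1)]] by simp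
    from dominated_mult[OF dominated_const this]
    show "dominated N 0 (\<lambda>h z. C * (1 + norm (X h z)) ^ k)" by simp
    show "\<forall>\<^sub>F h in at_right 0. \<forall>z. norm (f h (X h z)) \<le> norm (C * (1 + norm (X h z)) ^ k)"
      using C by eventually_elim (auto intro: order_trans[OF _ abs_ge_self])
  qed
  obtain C k where C: "\<forall>\<^sub>F h in at_right 0. lip_poly C k (f h)"
    using lip unfolding unif_lip_def by blast
  show "dominated N 1 (\<lambda>h z. f h (X h z) - f h (X h (bar z)))"
  proof (rule dominated_le)
    have "dominated N 0 (\<lambda>h z. (1 + norm (X h z) + norm (X h (bar z))) ^ k)"
      using dominated_power[OF dominated_add[OF dominated_add[OF dominated_const n(1)] n(2)]] by simp
    from dominated_mult[OF dominated_mult[OF dominated_const this] X'(2)[THEN dominated_norm_iff[THEN iffD2]]]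
    show "dominated N 1 (\<lambda>h z. C * (1 + norm (X h z) + norm (X h (bar z))) ^ k * norm (X h z - X h (bar z)))"
      by simp
    show "\<forall>\<^sub>F h in at_right 0. \<forall>z. norm (f h (X h z) - f h (X h (bar z))) \<le>
        norm (C * (1 + norm (X h z) + norm (X h (bar z))) ^ k * norm (X h z - X h (bar z)))"
      using C
    proof eventually_elim
      case (elim h)
      show ?case
      proof
        fix z
        have "norm (f h (X h z) - f h (X h (bar z))) \<le>
            C * (1 + norm (X h z) + norm (X h (bar z))) ^ k * norm (X h z - X h (bar z))"
          using elim unfolding lip_poly_def by blast
        then show "norm (f h (X h z) - f h (X h (bar z))) \<le>
            norm (C * (1 + norm (X h z) + norm (X h (bar z))) ^ k * norm (X h z - X h (bar z)))"
          unfolding real_norm_def by (rule order_trans[OF _ abs_ge_self])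
      qed
    qed
  qed
  assume q: "2 \<le> q"
  obtain C k where C: "\<forall>\<^sub>F h in at_right 0. lip2_poly C k (f h)"
    using lip q unfolding unif_lip_def by blast
  show "dominated N 2 (\<lambda>h z. f h (X h z) - 2 *\<^sub>R f h (X h (bar z)) + f h (X h (hat z)))"
  proof (rule dominated_le)
    let ?R = "\<lambda>h z. C * (1 + norm (X h z) + norm (X h (bar z)) + norm (X h (hat z))) ^ k *
       (norm (X h z - 2 *\<^sub>R X h (bar z) + X h (hat z)) + (norm (X h z - X h (bar z)))\<^sup>2
        + (norm (X h (hat z) - X h (bar z)))\<^sup>2)"
    have 1: "dominated N 0 (\<lambda>h z. (1 + norm (X h z) + norm (X h (bar z)) + norm (X h (hat z))) ^ k)"
      using dominated_power[OF dominated_add[OF dominated_add[OF dominated_add[OF dominated_const n(1)] n(2)] n(3)]]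
      by simp
    have 2: "dominated N 2 (\<lambda>h z. (norm (X h z - X h (bar z)))\<^sup>2)"
      "dominated N 2 (\<lambda>h z. (norm (X h (hat z) - X h (bar z)))\<^sup>2)"
      using dominated_power[OF X'(2)[THEN dominated_norm_iff[THEN iffD2]], of 2]
        dominated_power[OF X'(4)[THEN dominated_norm_iff[THEN iffD2]], of 2] by simp_all
    from dominated_mult[OF dominated_mult[OF dominated_const 1] dominated_add[OF dominated_add[OF
          X'(3)[OF q, THEN dominated_norm_iff[THEN iffD2]] 2(1)] 2(2)]]
    show "dominated N 2 ?R" by (simp add: numeral_2_eq_2)
    show "\<forall>\<^sub>F h in at_right 0. \<forall>z. norm (f h (X h z) - 2 *\<^sub>R f h (X h (bar z)) + f h (X h (hat z))) \<le>
        norm (?R h z)"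
      using C
    proof eventually_elim
      case (elim h)
      show ?case
      proof
        fix z
        have "norm (f h (X h z) - 2 *\<^sub>R f h (X h (bar z)) + f h (X h (hat z))) \<le> ?R h z"
          using elim unfolding lip2_poly_def by blast
        also have "\<dots> \<le> norm (?R h z)" unfolding real_norm_def by (rule abs_ge_self)
        finally show "norm (f h (X h z) - 2 *\<^sub>R f h (X h (bar z)) + f h (X h (hat z))) \<le> norm (?R h z)" .
      qed
    qed
  qed
qed

lemma small_diff_add:
  assumes X: "small_diff N q X" and Y: "small_diff N q Y"
  shows "small_diff N q (\<lambda>h z. X h z + Y h z)"
proof -
  have eq: "X h z + Y h z - (X h (bar z) + Y h (bar z)) = (X h z - X h (bar z)) + (Y h z - Y h (bar z))"
    "X h z + Y h z - 2 *\<^sub>R (X h (bar z) + Y h (bar z)) + (X h (hat z) + Y h (hat z))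
      = (X h z - 2 *\<^sub>R X h (bar z) + X h (hat z)) + (Y h z - 2 *\<^sub>R Y h (bar z) + Y h (hat z))" for h z
    by (simp_all add: scaleR_add_right)
  show ?thesis
    unfolding small_diff_def eq
    by (intro conjI impI dominated_add small_diffD(1,2)[OF X] small_diffD(1,2)[OF Y]
        small_diffD(3)[OF X] small_diffD(3)[OF Y])
qed

lemma small_diff_const: "small_diff N q (\<lambda>h z. c)"
  by (intro small_diff_indep dominated_const) auto

lemma small_diff_sum:
  assumes "\<And>i. i \<in> I \<Longrightarrow> small_diff N q (X i)"
  shows "small_diff N q (\<lambda>h z. \<Sum>i\<in>I. X i h z)"
  using assms
proof (induction I rule: infinite_finite_induct)
  case (insert i I)
  then have "small_diff N q (\<lambda>h z. X i h z + (\<Sum>i\<in>I. X i h z))"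
    by (intro small_diff_add) simp_all
  with insert.hyps show ?case by simp
qed (simp_all add: small_diff_const)

lemma small_diff_diff:
  fixes X Y :: "real \<Rightarrow> (nat \<Rightarrow> real^'n) \<Rightarrow> real"
  assumes "small_diff N q X" "small_diff N q Y"
  shows "small_diff N q (\<lambda>h z. X h z - Y h z)"
  using small_diff_add[OF assms(1) small_diff_mult[OF small_diff_const[of N q "- 1"] assms(2)]] by simp

text \<open>
  The factors built from \<open>J\<close> are only controlled to the extent that they grow polynomially and have local
  difference bounds near \<open>0\<close>.  Farther out than \<open>1\<close> the factor \<open>norm y ^ p\<close> is at least \<open>1\<close>, so that the
  growth bound implies the difference bounds there.
\<close>

lemma small_diff_local:
  fixes g :: "real \<Rightarrow> real^'n \<Rightarrow> real"
  assumes N: "1 \<le> N" and grow: "unif_poly_growth g"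
    and lip: "\<exists>C\<ge>0. \<forall>\<^sub>F h in at_right 0. \<forall>y. norm y \<le> 1 \<longrightarrow> norm (g h y - g h 0) \<le> C * norm y"
    and lip2: "2 \<le> q \<Longrightarrow> \<exists>C\<ge>0. \<forall>\<^sub>F h in at_right 0. \<forall>y. norm y \<le> 1 \<longrightarrow>
      norm (g h y - 2 *\<^sub>R g h 0 + g h (- y)) \<le> C * (norm y)\<^sup>2"
  shows "small_diff N q (\<lambda>h z. g h (sqrt h *\<^sub>R z 1))"
proof -
  define Y where "Y h z = sqrt h *\<^sub>R z 1" for h and z :: "nat \<Rightarrow> real^'n"
  have bar: "Y h (bar z) = 0" and hat: "Y h (hat z) = - Y h z" for h z
    by (simp_all add: Y_def bar_def hat_def)
  have Y: "small_diff N 2 Y" unfolding Y_def[abs_def] using N by (rule small_diff_first_step)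
  have Y0: "dominated N 0 (\<lambda>h z. norm (Y h z))"
    using small_diffD(1)[OF Y] by (simp add: dominated_norm_iff)
  have Y1: "dominated N 1 (\<lambda>h z. norm (Y h z))"
    using small_diffD(2)[OF Y] by (simp add: bar dominated_norm_iff)
  obtain C k where C: "\<forall>\<^sub>F h in at_right 0. \<forall>y. norm (g h y) \<le> C * (1 + norm y) ^ k"
    using grow unfolding unif_poly_growth_def by blast
  have pw: "dominated N 0 (\<lambda>h z. c + d * (1 + norm (Y h z)) ^ k)" for c d
  proof (intro dominated_add dominated_const)
    show "dominated N 0 (\<lambda>h z. d * (1 + norm (Y h z)) ^ k)"
    proof -
      have "dominated N (k * 0) (\<lambda>h z. (1 + norm (Y h z)) ^ k)"
        by (intro dominated_power dominated_add dominated_const Y0)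
      from dominated_mult[OF dominated_const this] show ?thesis by simp
    qed
  qed
  \<comment> \<open>Gluing of a difference bound inside the unit ball and a growth bound outside.\<close>
  have far: "r \<le> (c + d * (1 + norm y) ^ k) * norm y ^ p"
    if "norm y \<le> 1 \<Longrightarrow> r \<le> c * norm y ^ p" "r \<le> d * (1 + norm y) ^ k" "0 \<le> c" "0 \<le> d"
    for r c d and y :: "real^'n" and p
  proof (cases "norm y \<le> 1")
    case True
    have "c * norm y ^ p \<le> (c + d * (1 + norm y) ^ k) * norm y ^ p"
      using that(3,4) by (intro mult_right_mono) auto
    with that(1)[OF True] show ?thesis by linarith
  next
    case False
    then have "1 \<le> norm y ^ p" by (intro one_le_power) auto
    then have "(c + d * (1 + norm y) ^ k) * 1 \<le> (c + d * (1 + norm y) ^ k) * norm y ^ p"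
      using that(3,4) by (intro mult_left_mono) auto
    with that(2,3) show ?thesis unfolding mult_1_right by linarith
  qed
  obtain h0 where "\<forall>y. norm (g h0 y) \<le> C * (1 + norm y) ^ k"
    using eventually_happens[OF C] by auto
  then have "norm (g h0 0) \<le> C * (1 + norm (0::real^'n)) ^ k" by blast
  then have C0: "0 \<le> C" using norm_ge_zero[of "g h0 0"] by simp
  show ?thesis
    unfolding small_diff_def Y_def[symmetric] bar hat
  proof (intro conjI impI)
    show "dominated N 0 (\<lambda>h z. g h (Y h z))"
    proof (rule dominated_le[OF pw[of 0 C]])
      show "\<forall>\<^sub>F h in at_right 0. \<forall>z. norm (g h (Y h z)) \<le> norm (0 + C * (1 + norm (Y h z)) ^ k)"
        using C by eventually_elim (simp add: order_trans[OF _ abs_ge_self])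
    qed
    obtain C1 where C1: "0 \<le> C1"
      "\<forall>\<^sub>F h in at_right 0. \<forall>y. norm y \<le> 1 \<longrightarrow> norm (g h y - g h 0) \<le> C1 * norm y"
      using lip by blast
    show "dominated N 1 (\<lambda>h z. g h (Y h z) - g h 0)"
    proof (rule dominated_le)
      show "dominated N 1 (\<lambda>h z. (C1 + (2 * C) * (1 + norm (Y h z)) ^ k) * norm (Y h z))"
        using dominated_mult[OF pw Y1] by simp
      show "\<forall>\<^sub>F h in at_right 0. \<forall>z. norm (g h (Y h z) - g h 0) \<le>
          norm ((C1 + (2 * C) * (1 + norm (Y h z)) ^ k) * norm (Y h z))"
        using C1(2) C
      proof eventually_elim
        case (elim h)
        show ?case
        proof
          fix z
          have "C * 1 \<le> C * (1 + norm (Y h z)) ^ k"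
            using C0 by (intro mult_left_mono one_le_power) auto
          moreover have "norm (g h 0) \<le> C * 1"
            using elim(2)[rule_format, of 0] by simp
          ultimately have "norm (g h (Y h z) - g h 0) \<le> (2 * C) * (1 + norm (Y h z)) ^ k"
            using elim(2)[rule_format, of "Y h z"] norm_triangle_ineq4[of "g h (Y h z)" "g h 0"] by linarith
          then have "norm (g h (Y h z) - g h 0) \<le> (C1 + (2 * C) * (1 + norm (Y h z)) ^ k) * norm (Y h z) ^ 1"
            by (intro far) (use elim(1) C1(1) C0 in auto)
          then show "norm (g h (Y h z) - g h 0) \<le>
              norm ((C1 + (2 * C) * (1 + norm (Y h z)) ^ k) * norm (Y h z))"
            unfolding real_norm_def power_one_right by (rule order_trans[OF _ abs_ge_self])
        qed
      qed
    qed
    assume q: "2 \<le> q"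
    obtain C2 where C2: "0 \<le> C2"
      "\<forall>\<^sub>F h in at_right 0. \<forall>y. norm y \<le> 1 \<longrightarrow>
        norm (g h y - 2 *\<^sub>R g h 0 + g h (- y)) \<le> C2 * (norm y)\<^sup>2"
      using lip2[OF q] by blast
    show "dominated N 2 (\<lambda>h z. g h (Y h z) - 2 *\<^sub>R g h 0 + g h (- Y h z))"
    proof (rule dominated_le)
      show "dominated N 2 (\<lambda>h z. (C2 + (4 * C) * (1 + norm (Y h z)) ^ k) * norm (Y h z) ^ 2)"
        using dominated_mult[OF pw dominated_power[OF Y1, of 2]] by (simp add: numeral_2_eq_2)
      show "\<forall>\<^sub>F h in at_right 0. \<forall>z. norm (g h (Y h z) - 2 *\<^sub>R g h 0 + g h (- Y h z)) \<le>
          norm ((C2 + (4 * C) * (1 + norm (Y h z)) ^ k) * norm (Y h z) ^ 2)"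
        using C2(2) C
      proof eventually_elim
        case (elim h)
        show ?case
        proof
          fix z
          have "C * 1 \<le> C * (1 + norm (Y h z)) ^ k"
            using C0 by (intro mult_left_mono one_le_power) auto
          moreover have "norm (g h 0) \<le> C * 1"
            using elim(2)[rule_format, of 0] by simp
          moreover have "norm (g h (Y h z) - 2 *\<^sub>R g h 0 + g h (- Y h z)) \<le>
              norm (g h (Y h z)) + 2 * norm (g h 0) + norm (g h (- Y h z))"
            by simp
          moreover have "norm (g h (- Y h z)) \<le> C * (1 + norm (Y h z)) ^ k"
            using elim(2)[rule_format, of "- Y h z"] by simp
          ultimately have "norm (g h (Y h z) - 2 *\<^sub>R g h 0 + g h (- Y h z)) \<le> (4 * C) * (1 + norm (Y h z)) ^ k"
            using elim(2)[rule_format, of "Y h z"] by linarith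
          then have "norm (g h (Y h z) - 2 *\<^sub>R g h 0 + g h (- Y h z)) \<le>
              (C2 + (4 * C) * (1 + norm (Y h z)) ^ k) * norm (Y h z) ^ 2"
            by (intro far) (use elim(1) C2(1) C0 in auto)
          then show "norm (g h (Y h z) - 2 *\<^sub>R g h 0 + g h (- Y h z)) \<le>
              norm ((C2 + (4 * C) * (1 + norm (Y h z)) ^ k) * norm (Y h z) ^ 2)"
            unfolding real_norm_def by (rule order_trans[OF _ abs_ge_self])
        qed
      qed
    qed
  qed
qed

lemma unif_lip_if_C2:
  fixes f :: "real \<Rightarrow> 'a::euclidean_space \<Rightarrow> 'b::real_normed_vector"
  assumes C2: "\<forall>\<^sub>F h in at_right 0. C_k 2 (f h)"
    and growth: "\<And>bs. set bs \<subseteq> Basis \<Longrightarrow> length bs \<le> 2 \<Longrightarrow> unif_poly_growth (\<lambda>h. iter_pd bs (f h))"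
  shows "unif_lip q f"
proof -
  define S where "S = {bs. set bs \<subseteq> (Basis :: 'a set) \<and> length bs \<le> 2}"
  have S: "finite S" unfolding S_def by (rule finite_lists_length_le) simp
  have "\<exists>C k. 0 \<le> C \<and> (\<forall>bs\<in>S. \<forall>\<^sub>F h in at_right 0. \<forall>x. norm (iter_pd bs (f h) x) \<le> C * (1 + norm x) ^ k)"
  proof (rule uniform_poly_constants[OF S])
    show "\<exists>C k. \<forall>\<^sub>F h in at_right 0. \<forall>x. norm (iter_pd bs (f h) x) \<le> C * (1 + norm x) ^ k"
      if "bs \<in> S" for bs
      using growth[of bs] that unfolding S_def unif_poly_growth_def by blast
  next
    fix bs and C C' :: real and k k' :: nat
    assume "\<forall>\<^sub>F h in at_right 0. \<forall>x. norm (iter_pd bs (f h) x) \<le> C * (1 + norm x) ^ k"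
      and "C \<le> C'" "0 \<le> C'" "k \<le> k'"
    then show "\<forall>\<^sub>F h in at_right 0. \<forall>x. norm (iter_pd bs (f h) x) \<le> C' * (1 + norm x) ^ k'"
      by (auto elim!: eventually_mono intro: poly_bound_mono)
  qed
  then obtain C k where C: "0 \<le> C"
    and "\<forall>bs\<in>S. \<forall>\<^sub>F h in at_right 0. \<forall>x. norm (iter_pd bs (f h) x) \<le> C * (1 + norm x) ^ k"
    by blast
  then have bound: "\<forall>\<^sub>F h in at_right 0. \<forall>bs\<in>S. \<forall>x. norm (iter_pd bs (f h) x) \<le> C * (1 + norm x) ^ k"
    by (simp add: eventually_ball_finite_distrib S)
  have "\<forall>\<^sub>F h in at_right 0. lip_poly (real DIM('a) * C) k (f h) \<and>
      lip2_poly (2 * (real DIM('a))\<^sup>2 * C) k (f h)"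
    using C2 bound
  proof eventually_elim
    case (elim h)
    have d0: "f h differentiable at x" for x
      using elim(1) unfolding C_k_def by (auto simp: iter_pd_def dest: spec[of _ "[]"])
    have d1: "dird e (f h) differentiable at x" if "e \<in> Basis" for e x
      using elim(1) that unfolding C_k_def by (auto simp: iter_pd_def dest: spec[of _ "[e]"])
    have b1: "norm (dird e (f h) x) \<le> C * (1 + norm x) ^ k" if "e \<in> Basis" for e x
      using elim(2)[rule_format, of "[e]"] that by (simp add: S_def iter_pd_def)
    have b2: "norm (dird e' (dird e (f h)) x) \<le> C * (1 + norm x) ^ k" if "e \<in> Basis" "e' \<in> Basis" for e e' x
      using elim(2)[rule_format, of "[e', e]"] that by (simp add: S_def iter_pd_def)
    show ?case
      by (intro conjI lip_poly_if_dird_bound lip2_poly_if_dird_bound C d0 d1 b1 b2)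
  qed
  then show ?thesis
    unfolding unif_lip_def by (auto simp: eventually_conj_iff)
qed

text \<open>
  Only the first increment is reflected, so that the later ones count as constants; the order of the
  differences is propagated by the steps of the scheme.
\<close>

lemma small_diff_path:
  fixes t :: "nat \<Rightarrow> real" and H :: "'n::finite scheme" and s :: "real^'n"
  defines "grid \<equiv> (\<lambda>h. t(1 := h))"
  assumes t0: "t 0 = 0" and N: "1 \<le> N"
    and H_C2: "\<And>i. i < N \<Longrightarrow> \<forall>\<^sub>F h in at_right 0. C_k 2 (\<lambda>(u, x). step (grid h) H i u x)"
    and H_growth: "\<And>i bs. i < N \<Longrightarrow> set bs \<subseteq> Basis \<Longrightarrow> length bs \<le> 2 \<Longrightarrow>
        unif_poly_growth (\<lambda>h. iter_pd bs (\<lambda>(u, x). step (grid h) H i u x))"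
    and k: "k \<le> N"
  shows "small_diff N q (\<lambda>h z. path (grid h) H s z k)"
  using k
proof (induction k)
  case 0
  show ?case by (simp add: small_diff_const)
next
  case (Suc i)
  then have i: "i < N" by simp
  have incr: "small_diff N q (\<lambda>h z. sqrt (dt (grid h) (Suc i)) *\<^sub>R z (Suc i) :: real^'n)"
  proof (cases "i = 0")
    case True
    then show ?thesis
      using small_diff_first_step[OF N, of q] by (simp add: dt_def grid_def t0)
  next
    case False
    \<comment> \<open>At most one of the two times moves with h, and it stays below 1.\<close>
    define c where "c = sqrt (\<bar>t (Suc i)\<bar> + \<bar>t i\<bar> + 1)"
    have "dominated N 0 (\<lambda>h z. sqrt (dt (grid h) (Suc i)) *\<^sub>R z (Suc i) :: real^'n)"
    proof (rule dominated_le)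
      show "dominated N 0 (\<lambda>h z. c * norm (z (Suc i) :: real^'n))"
        using dominated_mult[OF dominated_const[of N c] dominated_norm_iff[THEN iffD2, OF dominated_component, of "Suc i" N]]
          Suc.prems by simp
      have "\<bar>sqrt (dt (grid h) (Suc i))\<bar> \<le> c" if "0 < h" "h < 1" for h
        unfolding c_def real_sqrt_abs'[symmetric]
        using that False by (intro real_sqrt_le_mono) (auto simp: dt_def grid_def)
      then show "\<forall>\<^sub>F h in at_right 0. \<forall>z. norm (sqrt (dt (grid h) (Suc i)) *\<^sub>R z (Suc i) :: real^'n)
          \<le> norm (c * norm (z (Suc i)))"
        using eventually_at_right_real[OF zero_less_one]
        by (auto elim!: eventually_mono intro!: mult_right_mono simp: abs_mult c_def)
    qed
    then show ?thesis
      using False by (intro small_diff_indep) (auto simp: bar_def hat_def)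
  qed
  have "unif_poly_growth (\<lambda>h. (\<lambda>(u, x). step (grid h) H i u x))"
    using H_growth[OF i, of "[]"] by (simp add: iter_pd_def)
  from small_diff_compose[OF small_diff_Pair[OF Suc.IH incr] this unif_lip_if_C2[OF H_C2[OF i] H_growth[OF i]]]
  show ?case using Suc.prems by simp
qed

section \<open>Gaussian moments\<close>

text \<open>
  A bound in product form, which the integral against the product density factorizes.
\<close>

lemma one_plus_norm_le_prod:
  fixes x :: "real^'n"
  shows "1 + norm x \<le> (\<Prod>j\<in>UNIV. 1 + \<bar>x $ j\<bar>)"
proof -
  have "1 + (\<Sum>j\<in>I. \<bar>x $ j\<bar>) \<le> (\<Prod>j\<in>I. 1 + \<bar>x $ j\<bar>)" if "finite I" for I
    using that
  proof induction
    case (insert i I)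
    have "1 + (\<Sum>j\<in>insert i I. \<bar>x $ j\<bar>) = \<bar>x $ i\<bar> + (1 + (\<Sum>j\<in>I. \<bar>x $ j\<bar>))"
      using insert by simp
    also have "\<dots> \<le> \<bar>x $ i\<bar> * (1 + (\<Sum>j\<in>I. \<bar>x $ j\<bar>)) + (1 + (\<Sum>j\<in>I. \<bar>x $ j\<bar>))"
      by (simp add: distrib_left sum_nonneg)
    also have "\<dots> = (1 + \<bar>x $ i\<bar>) * (1 + (\<Sum>j\<in>I. \<bar>x $ j\<bar>))"
      by (simp add: algebra_simps)
    also have "\<dots> \<le> (1 + \<bar>x $ i\<bar>) * (\<Prod>j\<in>I. 1 + \<bar>x $ j\<bar>)"
      by (intro mult_left_mono insert.IH) auto
    finally show ?case using insert.hyps by simp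
  qed simp
  from this[of UNIV] norm_le_l1_cart[of x] show ?thesis by simp
qed

text \<open>
  The integrand is at most a product over the coordinates, whose integral factorizes into absolute moments
  of the standard normal distribution on the line.
\<close>

lemma integrable_std_normal_vector_density:
  "integrable lborel (\<lambda>x::real^'n. (\<Prod>j\<in>UNIV. std_normal_density (x $ j)) * (1 + norm x) ^ m)"
proof -
  define g where "g y = std_normal_density y * (1 + \<bar>y\<bar>) ^ m" for y
  have g0: "0 \<le> g y" for y by (simp add: g_def)
  have gm: "g \<in> borel_measurable borel" unfolding g_def by measurable
  have g_int: "integrable lborel g"
  proof (rule Bochner_Integration.integrable_bound)
    show "integrable lborel (\<lambda>y. 2 ^ m * (std_normal_density y * \<bar>y\<bar> ^ 0 + std_normal_density y * \<bar>y\<bar> ^ m))"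
      by (intro integrable_mult_right Bochner_Integration.integrable_add integrable_std_normal_moment_abs)
    show "g \<in> borel_measurable lborel" using gm by simp
    have "(1 + \<bar>y\<bar>) ^ m \<le> 2 ^ m * (1 + \<bar>y\<bar> ^ m)" for y :: real
    proof -
      have "(1 + \<bar>y\<bar>) ^ m \<le> (2 * max 1 \<bar>y\<bar>) ^ m" by (intro power_mono) auto
      also have "\<dots> = 2 ^ m * max 1 \<bar>y\<bar> ^ m" by (simp add: power_mult_distrib)
      also have "max 1 \<bar>y\<bar> ^ m \<le> 1 + \<bar>y\<bar> ^ m" by (auto simp: max_def)
      finally show ?thesis by simp
    qed
    then have "g y \<le> 2 ^ m * (std_normal_density y * \<bar>y\<bar> ^ 0 + std_normal_density y * \<bar>y\<bar> ^ m)" for y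
      using mult_left_mono[of "(1 + \<bar>y\<bar>) ^ m" "2 ^ m * (1 + \<bar>y\<bar> ^ m)" "std_normal_density y"]
      by (simp add: g_def algebra_simps)
    then show "AE y in lborel. norm (g y) \<le>
        norm (2 ^ m * (std_normal_density y * \<bar>y\<bar> ^ 0 + std_normal_density y * \<bar>y\<bar> ^ m))"
      by (intro AE_I2) (simp add: g0)
  qed
  have reindex: "(\<Prod>b\<in>Basis. f (x \<bullet> b)) = (\<Prod>j\<in>UNIV. f (x $ j))"
    for f :: "real \<Rightarrow> real" and x :: "real^'n"
  proof -
    have "(Basis :: (real^'n) set) = range (\<lambda>j. axis j 1)"
      by (auto simp: Basis_vec_def)
    then have "(\<Prod>b\<in>Basis. f (x \<bullet> b)) = (\<Prod>b\<in>range (\<lambda>j. axis j 1). f (x \<bullet> b))"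
      by (rule arg_cong)
    also have "\<dots> = (\<Prod>j\<in>UNIV. f (x $ j))"
      by (subst prod.reindex) (auto simp: inj_on_def axis_eq_axis cart_eq_inner_axis)
    finally show ?thesis .
  qed
  have prod_int: "integrable lborel (\<lambda>x::real^'n. \<Prod>j\<in>UNIV. g (x $ j))"
  proof (rule integrableI_nonneg)
    show "(\<lambda>x::real^'n. \<Prod>j\<in>UNIV. g (x $ j)) \<in> borel_measurable lborel"
      using gm by measurable
    show "AE x in lborel. 0 \<le> (\<Prod>j\<in>UNIV. g ((x::real^'n) $ j))"
      by (intro AE_I2 prod_nonneg ballI g0)
    have "(\<integral>\<^sup>+x. ennreal (\<Prod>j\<in>UNIV. g ((x::real^'n) $ j)) \<partial>lborel)
        = (\<integral>\<^sup>+x. (\<Prod>b\<in>Basis. ennreal (g ((x::real^'n) \<bullet> b))) \<partial>lborel)"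
      by (simp add: reindex[symmetric] prod_ennreal g0)
    also have "\<dots> = (\<Prod>b\<in>(Basis :: (real^'n) set). (\<integral>\<^sup>+y. ennreal (g y) \<partial>lborel))"
      using gm by (intro nn_integral_lborel_prod) auto
    also have "\<dots> < \<infinity>"
    proof -
      have "(\<integral>\<^sup>+y. ennreal (g y) \<partial>lborel) < \<infinity>"
        using g_int by (simp add: nn_integral_eq_integral g0)
      then show ?thesis by (simp add: power_less_top_ennreal)
    qed
    finally show "(\<integral>\<^sup>+x. ennreal (\<Prod>j\<in>UNIV. g ((x::real^'n) $ j)) \<partial>lborel) < \<infinity>" .
  qed
  show ?thesis
  proof (rule Bochner_Integration.integrable_bound[OF prod_int])
    show "(\<lambda>x::real^'n. (\<Prod>j\<in>UNIV. std_normal_density (x $ j)) * (1 + norm x) ^ m)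
        \<in> borel_measurable lborel"
      by measurable
    have "(\<Prod>j\<in>UNIV. std_normal_density (x $ j)) * (1 + norm x) ^ m \<le> (\<Prod>j\<in>UNIV. g (x $ j))"
      for x :: "real^'n"
    proof -
      have "(1 + norm x) ^ m \<le> (\<Prod>j\<in>UNIV. (1 + \<bar>x $ j\<bar>)) ^ m"
        by (intro power_mono one_plus_norm_le_prod) auto
      then have "(\<Prod>j\<in>UNIV. std_normal_density (x $ j)) * (1 + norm x) ^ m
          \<le> (\<Prod>j\<in>UNIV. std_normal_density (x $ j)) * (\<Prod>j\<in>UNIV. (1 + \<bar>x $ j\<bar>)) ^ m"
        by (intro mult_left_mono prod_nonneg) auto
      then show ?thesis by (simp add: g_def prod.distrib prod_power_distrib)
    qed
    moreover have "0 \<le> (\<Prod>j\<in>UNIV. std_normal_density (x $ j)) * (1 + norm x) ^ m" for x :: "real^'n"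
      by (intro mult_nonneg_nonneg prod_nonneg) auto
    ultimately show "AE x in lborel. norm ((\<Prod>j\<in>UNIV. std_normal_density ((x::real^'n) $ j)) * (1 + norm x) ^ m)
        \<le> norm (\<Prod>j\<in>UNIV. g (x $ j))"
      by (intro AE_I2) (simp add: abs_of_nonneg prod_nonneg g0)
  qed
qed

lemma std_normal_vector_moments:
  fixes X :: "'w \<Rightarrow> real^'n"
  assumes "std_normal_vector M X"
  shows "integrable M (\<lambda>\<omega>. (1 + norm (X \<omega>)) ^ m)"
proof -
  have "integrable lborel (\<lambda>x::real^'n. (\<Prod>j\<in>UNIV. std_normal_density (x $ j)) * (1 + norm x) ^ m)
      \<longleftrightarrow> integrable M (\<lambda>\<omega>. (1 + norm (X \<omega>)) ^ m)"
    using assms unfolding std_normal_vector_def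
    by (rule distributed_integrable) (auto intro: prod_nonneg)
  then show ?thesis using integrable_std_normal_vector_density by blast
qed

text \<open>
  A crude substitute for the power mean inequality, from comparison with the largest summand.  It reduces
  moments of the weight to moments of the single increments.
\<close>

lemma sum_power_le:
  fixes b :: "'i \<Rightarrow> real"
  assumes I: "finite I" "I \<noteq> {}" and b: "\<And>i. i \<in> I \<Longrightarrow> 0 \<le> b i"
  shows "(\<Sum>i\<in>I. b i) ^ m \<le> real (card I) ^ m * (\<Sum>i\<in>I. b i ^ m)"
proof -
  from I have "Max (b ` I) \<in> b ` I" by (intro Max_in) auto
  then obtain i where i: "i \<in> I" "b i = Max (b ` I)" by force
  have "(\<Sum>i\<in>I. b i) \<le> (\<Sum>j\<in>I. b i)"
    using I by (intro sum_mono) (simp add: i(2))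
  then have "(\<Sum>i\<in>I. b i) ^ m \<le> (real (card I) * b i) ^ m"
    by (intro power_mono) (auto intro: sum_nonneg b)
  also have "\<dots> = real (card I) ^ m * b i ^ m" by (simp add: power_mult_distrib)
  also have "\<dots> \<le> real (card I) ^ m * (\<Sum>i\<in>I. b i ^ m)"
    using I b i(1) by (intro mult_left_mono member_le_sum) auto
  finally show ?thesis .
qed

lemma integrable_weight_power:
  fixes Z :: "nat \<Rightarrow> 'w \<Rightarrow> real^'n"
  assumes N: "1 \<le> N" and Z: "\<And>i. i \<in> {1..N} \<Longrightarrow> std_normal_vector M (Z i)"
  shows "integrable M (\<lambda>\<omega>. weight N (\<lambda>i. Z i \<omega>) ^ m)"
proof (rule Bochner_Integration.integrable_bound)
  show "integrable M (\<lambda>\<omega>. real N ^ m * (\<Sum>i\<in>{1..N}. (1 + norm (Z i \<omega>)) ^ m))"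
    by (intro integrable_mult_right Bochner_Integration.integrable_sum std_normal_vector_moments Z)
  have "Z i \<in> borel_measurable M" if "i \<in> {1..N}" for i
    using Z[OF that] unfolding std_normal_vector_def by (auto dest: distributed_measurable)
  then show "(\<lambda>\<omega>. weight N (\<lambda>i. Z i \<omega>) ^ m) \<in> borel_measurable M"
    unfolding weight_def
    by (intro borel_measurable_power borel_measurable_add borel_measurable_const
        borel_measurable_sum borel_measurable_norm) auto
  have "weight N z ^ m \<le> real N ^ m * (\<Sum>i\<in>{1..N}. (1 + norm (z i)) ^ m)" for z :: "nat \<Rightarrow> real^'n"
  proof -
    have "weight N z \<le> (\<Sum>i\<in>{1..N}. 1 + norm (z i))"
      using N by (simp add: weight_def sum.distrib)
    then have "weight N z ^ m \<le> (\<Sum>i\<in>{1..N}. 1 + norm (z i)) ^ m"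
      using weight_ge_1[of N z] by (intro power_mono) auto
    also have "\<dots> \<le> real N ^ m * (\<Sum>i\<in>{1..N}. (1 + norm (z i)) ^ m)"
      using sum_power_le[of "{1..N}" "\<lambda>i. 1 + norm (z i)" m] N by simp
    finally show ?thesis .
  qed
  then show "AE \<omega> in M. norm (weight N (\<lambda>i. Z i \<omega>) ^ m) \<le>
      norm (real N ^ m * (\<Sum>i\<in>{1..N}. (1 + norm (Z i \<omega>)) ^ m))"
    by (intro AE_I2) (simp add: weight_nonneg order_trans[OF _ abs_ge_self])
qed

text \<open>
  The variance is at most the second moment, which the moments of the weight bound uniformly in \<open>h\<close>.
\<close>

lemma var_O1_if_dominated:
  fixes Z :: "nat \<Rightarrow> 'w \<Rightarrow> real^'n" and X :: "real \<Rightarrow> (nat \<Rightarrow> real^'n) \<Rightarrow> real"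
  assumes M: "prob_space M" and N: "1 \<le> N"
    and Z: "\<And>i. i \<in> {1..N} \<Longrightarrow> std_normal_vector M (Z i)"
    and meas: "\<forall>\<^sub>F h in at_right 0. (\<lambda>\<omega>. X h (\<lambda>i. Z i \<omega>)) \<in> borel_measurable M"
    and X: "dominated N 0 X"
  shows "var_O1 M (\<lambda>h \<omega>. X h (\<lambda>i. Z i \<omega>))"
proof -
  interpret prob_space M by (rule M)
  obtain C k where C: "0 \<le> C" "\<forall>\<^sub>F h in at_right 0. \<forall>z. norm (X h z) \<le> C * weight N z ^ k"
    using X unfolding dominated_def by auto
  define B where "B = expectation (\<lambda>\<omega>. C\<^sup>2 * weight N (\<lambda>i. Z i \<omega>) ^ (2 * k))"
  have int: "integrable M (\<lambda>\<omega>. C\<^sup>2 * weight N (\<lambda>i. Z i \<omega>) ^ (2 * k))"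
    by (intro integrable_mult_right integrable_weight_power N Z)
  have key: "\<forall>\<^sub>F h in at_right 0. (\<lambda>\<omega>. X h (\<lambda>i. Z i \<omega>)) \<in> borel_measurable M \<and>
      integrable M (\<lambda>\<omega>. (X h (\<lambda>i. Z i \<omega>))\<^sup>2) \<and> norm (variance (\<lambda>\<omega>. X h (\<lambda>i. Z i \<omega>))) \<le> B"
    using meas C(2)
  proof eventually_elim
    case (elim h)
    let ?X = "\<lambda>\<omega>. X h (\<lambda>i. Z i \<omega>)"
    have le: "(?X \<omega>)\<^sup>2 \<le> C\<^sup>2 * weight N (\<lambda>i. Z i \<omega>) ^ (2 * k)" for \<omega>
    proof -
      have "\<bar>?X \<omega>\<bar>\<^sup>2 \<le> (C * weight N (\<lambda>i. Z i \<omega>) ^ k)\<^sup>2"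
        using elim(2) by (intro power_mono) auto
      then show ?thesis by (simp add: power_mult_distrib power_mult[symmetric] mult.commute)
    qed
    have sq: "integrable M (\<lambda>\<omega>. (?X \<omega>)\<^sup>2)"
    proof (rule Bochner_Integration.integrable_bound[OF int])
      show "(\<lambda>\<omega>. (?X \<omega>)\<^sup>2) \<in> borel_measurable M" using elim(1) by measurable
      show "AE \<omega> in M. norm ((?X \<omega>)\<^sup>2) \<le> norm (C\<^sup>2 * weight N (\<lambda>i. Z i \<omega>) ^ (2 * k))"
        using le by (intro AE_I2) (simp add: order_trans[OF _ abs_ge_self])
    qed
    have "integrable M ?X"
      using elim(1) sq by (rule square_integrable_imp_integrable)
    then have "variance ?X = expectation (\<lambda>\<omega>. (?X \<omega>)\<^sup>2) - (expectation ?X)\<^sup>2"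
      using sq by (rule variance_eq)
    also have "\<dots> \<le> expectation (\<lambda>\<omega>. (?X \<omega>)\<^sup>2)" by simp
    also have "\<dots> \<le> B" unfolding B_def by (intro integral_mono sq int le)
    finally have "variance ?X \<le> B" .
    moreover have "0 \<le> variance ?X" by (rule variance_positive)
    ultimately show ?case using elim(1) sq by simp
  qed
  show ?thesis
    unfolding var_O1_def
  proof
    show "\<forall>\<^sub>F h in at_right 0. (\<lambda>\<omega>. X h (\<lambda>i. Z i \<omega>)) \<in> borel_measurable M \<and>
        integrable M (\<lambda>\<omega>. (X h (\<lambda>i. Z i \<omega>))\<^sup>2)"
      using key by eventually_elim blast
    show "(\<lambda>h. variance (\<lambda>\<omega>. X h (\<lambda>i. Z i \<omega>))) \<in> O[at_right 0](\<lambda>_. 1)"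
      by (rule bigoI[of _ B]) (use key in eventually_elim, simp)
  qed
qed

section \<open>The variance of the estimators\<close>

lemma real_polynomial_function_growth:
  fixes q :: "'a::real_normed_vector \<Rightarrow> real"
  assumes "real_polynomial_function q"
  shows "\<exists>C k. 0 \<le> C \<and> (\<forall>x. \<bar>q x\<bar> \<le> C * (1 + norm x) ^ k)"
  using assms
proof induction
  case (linear f)
  have "\<bar>f x\<bar> \<le> onorm f * (1 + norm x) ^ 1" for x
    using onorm[OF linear, of x] onorm_pos_le[OF linear] by (simp add: distrib_left)
  then show ?case using onorm_pos_le[OF linear] by blast
next
  case (const c)
  have "\<bar>c\<bar> \<le> \<bar>c\<bar> * (1 + norm x) ^ 0" for x :: 'a by simp
  then show ?case using abs_ge_zero by blast
next
  case (add f g)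
  then obtain C k D l where f: "0 \<le> C" "\<And>x. \<bar>f x\<bar> \<le> C * (1 + norm x) ^ k"
    and g: "0 \<le> D" "\<And>x. \<bar>g x\<bar> \<le> D * (1 + norm x) ^ l" by blast
  have "\<bar>f x + g x\<bar> \<le> (C + D) * (1 + norm x) ^ (k + l)" for x
  proof -
    have "\<bar>f x\<bar> \<le> C * (1 + norm x) ^ (k + l)" by (rule poly_bound_mono[OF f(2)]) (use f in auto)
    moreover have "\<bar>g x\<bar> \<le> D * (1 + norm x) ^ (k + l)" by (rule poly_bound_mono[OF g(2)]) (use g in auto)
    ultimately show ?thesis by (simp add: distrib_right)
  qed
  then show ?case using f(1) g(1) add_nonneg_nonneg by blast
next
  case (mult f g)
  then obtain C k D l where f: "0 \<le> C" "\<And>x. \<bar>f x\<bar> \<le> C * (1 + norm x) ^ k"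
    and g: "0 \<le> D" "\<And>x. \<bar>g x\<bar> \<le> D * (1 + norm x) ^ l" by blast
  have "\<bar>f x * g x\<bar> \<le> (C * D) * (1 + norm x) ^ (k + l)" for x
    using mult_mono'[OF f(2)[of x] g(2)[of x]] by (simp add: abs_mult power_add mult_ac)
  then show ?case using f(1) g(1) mult_nonneg_nonneg by blast
qed

lemma unif_poly_growth_if_polynomial:
  fixes g :: "real \<Rightarrow> real^'n \<Rightarrow> real"
  assumes "real_polynomial_function q" "\<forall>\<^sub>F h in at_right 0. \<forall>y. \<bar>g h y\<bar> \<le> \<bar>q y\<bar>"
  shows "unif_poly_growth g"
proof -
  obtain C k where "\<And>y. \<bar>q y\<bar> \<le> C * (1 + norm y) ^ k"
    using real_polynomial_function_growth[OF assms(1)] by blast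
  then have "\<forall>\<^sub>F h in at_right 0. \<forall>y. norm (g h y) \<le> C * (1 + norm y) ^ k"
    using assms(2) by (auto elim!: eventually_mono intro: order_trans)
  then show ?thesis unfolding unif_poly_growth_def by blast
qed

lemma small_diff_unif_C:
  fixes g :: "real \<Rightarrow> real^'n \<Rightarrow> real^'n \<Rightarrow> real"
  assumes N: "1 \<le> N" and g: "\<And>k. unif_C k (\<lambda>h (u, x). g h u x)"
    and q: "real_polynomial_function q" "\<forall>\<^sub>F h in at_right 0. \<forall>y. \<bar>g h s y\<bar> \<le> \<bar>q y\<bar>"
  shows "small_diff N p (\<lambda>h z. g h s (sqrt h *\<^sub>R z 1))"
    and "\<forall>\<^sub>F h in at_right 0. continuous_on UNIV (g h s)"
proof -
  show "small_diff N p (\<lambda>h z. g h s (sqrt h *\<^sub>R z 1))"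
    using unif_C_increment[OF g, of s] unif_C_second_difference[OF g, of s]
    by (intro small_diff_local N unif_poly_growth_if_polynomial[OF q]) auto
  show "\<forall>\<^sub>F h in at_right 0. continuous_on UNIV (g h s)"
    using unif_C_differentiable[OF g[of "Suc 0"]]
  proof eventually_elim
    case (elim h)
    then have "continuous_on UNIV (\<lambda>(u, x). g h u x)"
      by (auto intro!: continuous_at_imp_continuous_on differentiable_imp_continuous_within)
    then have "continuous_on UNIV (\<lambda>x. case (s, x) of (u, x) \<Rightarrow> g h u x)"
      by (rule continuous_on_compose2) (auto intro!: continuous_intros)
    then show ?case by simp
  qed
qed

lemma borel_measurable_vec_lambda:
  fixes f :: "'m::finite \<Rightarrow> 'w \<Rightarrow> 'b::euclidean_space"
  assumes "\<And>j. f j \<in> borel_measurable M"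
  shows "(\<lambda>\<omega>. \<chi> j. f j \<omega>) \<in> borel_measurable M"
proof (rule borel_measurable_euclidean_space[THEN iffD2], rule ballI)
  fix b :: "'b^'m" assume "b \<in> Basis"
  then obtain j c where "b = axis j c" by (auto simp: Basis_vec_def)
  then have "(\<lambda>\<omega>. (\<chi> j. f j \<omega>) \<bullet> b) = (\<lambda>\<omega>. f j \<omega> \<bullet> c)"
    by (simp add: inner_axis)
  then show "(\<lambda>\<omega>. (\<chi> j. f j \<omega>) \<bullet> b) \<in> borel_measurable M"
    using assms[of j] by simp
qed

lemma path_measurable:
  fixes H :: "'n::finite scheme" and Z :: "nat \<Rightarrow> 'w \<Rightarrow> real^'n"
  assumes Z: "\<And>i. i \<in> {1..N} \<Longrightarrow> Z i \<in> borel_measurable M"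
    and H: "\<And>i. i < N \<Longrightarrow> continuous_on UNIV (\<lambda>(u, x). step t H i u x)"
    and k: "k \<le> N"
  shows "(\<lambda>\<omega>. path t H s (\<lambda>i. Z i \<omega>) k) \<in> borel_measurable M"
  using k
proof (induction k)
  case (Suc i)
  have "(\<lambda>\<omega>. (\<lambda>(u, x). step t H i u x)
      (path t H s (\<lambda>i. Z i \<omega>) i, sqrt (dt t (Suc i)) *\<^sub>R Z (Suc i) \<omega>)) \<in> borel_measurable M"
  proof (rule borel_measurable_continuous_on[OF H])
    show "(\<lambda>\<omega>. (path t H s (\<lambda>i. Z i \<omega>) i, sqrt (dt t (Suc i)) *\<^sub>R Z (Suc i) \<omega>)) \<in> borel_measurable M"
      by (rule borel_measurable_Pair)
        (use Suc Z in \<open>auto intro!: borel_measurable_scaleR borel_measurable_const\<close>)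
  qed (use Suc in auto)
  then show ?case by simp
qed simp

lemma states_index_le: "card {..j :: 'm::{finite,linorder}} \<le> CARD('m)"
  by (rule card_mono) auto

text \<open>
  For \<open>q = 1\<close> the two paths are compared with each other, for \<open>q = 2\<close> also with the path whose first
  increment vanishes.
\<close>

definition symm_diff :: "nat \<Rightarrow> ((nat \<Rightarrow> real^'n) \<Rightarrow> real) \<Rightarrow> (nat \<Rightarrow> real^'n) \<Rightarrow> real" where
  "symm_diff q f z = (if q = 1 then f z - f (hat z) else f z - 2 * f (bar z) + f (hat z))"

lemma small_diff_symm_diff:
  assumes f: "small_diff N q f" and q: "q \<in> {1, 2}"
  shows "dominated N q (\<lambda>h z. symm_diff q (f h) z)"
proof (cases "q = 1")
  case True
  have "f h z - f h (hat z) = (f h z - f h (bar z)) - (f h (hat z) - f h (bar z))" for h z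
    by simp
  then show ?thesis
    using dominated_diff[OF small_diffD(2,4)[OF f]] True by (simp add: symm_diff_def)
next
  case False
  then show ?thesis using small_diffD(3)[OF f] q by (simp add: symm_diff_def)
qed

text \<open>
  The common form of the three estimators: \<open>c\<close> collects the polynomials in \<open>Z\<^sub>1\<close>, which are not reflected,
  and \<open>K\<close> the functions of \<open>sqrt h *\<^sub>R Z\<^sub>1\<close>, which are.
\<close>

lemma var_O1_weighted_symm_diff:
  fixes t :: "nat \<Rightarrow> real" and H :: "'n::finite scheme" and s :: "real^'n"
    and F :: "real^'n^'m::{finite,linorder} \<Rightarrow> real" and Z :: "nat \<Rightarrow> 'w \<Rightarrow> real^'n"
    and K :: "'i::finite \<Rightarrow> real \<Rightarrow> real^'n \<Rightarrow> real" and c :: "'i \<Rightarrow> real^'n \<Rightarrow> real"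
  defines "N \<equiv> CARD('m)" and "grid \<equiv> (\<lambda>h. t(1 := h))"
  assumes prob: "prob_space M"
    and Z: "\<And>i. i \<in> {1..N} \<Longrightarrow> std_normal_vector M (Z i)"
    and t0: "t 0 = 0"
    and H_C2: "\<And>i. i < N \<Longrightarrow> \<forall>\<^sub>F h in at_right 0. C_k 2 (\<lambda>(u, x). step (grid h) H i u x)"
    and H_growth: "\<And>i bs. i < N \<Longrightarrow> set bs \<subseteq> Basis \<Longrightarrow> length bs \<le> 2 \<Longrightarrow>
        unif_poly_growth (\<lambda>h. iter_pd bs (\<lambda>(u, x). step (grid h) H i u x))"
    and F_cont: "continuous_on UNIV F"
    and F_growth: "poly_growth F"
    and F_lip: "unif_lip q (\<lambda>h. F)"
    and q: "q \<in> {1, 2}"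
    and K: "\<And>i. small_diff N q (\<lambda>h z. K i h (sqrt h *\<^sub>R z 1))"
    and K_cont: "\<And>i. \<forall>\<^sub>F h in at_right 0. continuous_on UNIV (K i h)"
    and c: "\<And>i. dominated N 0 (\<lambda>h z. c i (z 1))"
    and c_cont: "\<And>i. continuous_on UNIV (c i)"
    and X: "\<forall>\<^sub>F h in at_right 0. \<forall>z. X h z = (\<Sum>i\<in>UNIV. c i (z 1) *
       symm_diff q (\<lambda>z. F (states (grid h) H s z) * K i h (sqrt h *\<^sub>R z 1)) z) / sqrt h ^ q"
  shows "var_O1 M (\<lambda>h \<omega>. X h (\<lambda>i. Z i \<omega>))"
proof (rule var_O1_if_dominated[OF prob])
  show N: "1 \<le> N" by (simp add: N_def Suc_leI)
  show "std_normal_vector M (Z i)" if "i \<in> {1..N}" for i using Z[OF that] .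
  define Y where "Y i h = (\<lambda>z. F (states (grid h) H s z) * K i h (sqrt h *\<^sub>R z 1))" for i h
  have "small_diff N q (\<lambda>h z. states (grid h) H s z :: (real^'n, 'm) vec)"
    unfolding states_def grid_def
    by (intro small_diff_vec small_diff_path t0 N)
      (use H_C2 H_growth states_index_le in \<open>auto simp: grid_def N_def\<close>)
  moreover have "unif_poly_growth (\<lambda>h. F)"
    using F_growth unfolding poly_growth_def unif_poly_growth_def by auto
  ultimately have "small_diff N q (\<lambda>h z. F (states (grid h) H s z))"
    using F_lip by (rule small_diff_compose)
  then have "small_diff N q (Y i)" for i
    unfolding Y_def by (intro small_diff_mult K)
  then have "dominated N q (\<lambda>h z. symm_diff q (Y i h) z)" for i
    using q by (rule small_diff_symm_diff)
  then have "dominated N (0 + q) (\<lambda>h z. \<Sum>i\<in>UNIV. c i (z 1) * symm_diff q (Y i h) z)"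
    by (intro dominated_sum dominated_mult c)
  then have "dominated N 0 (\<lambda>h z. (\<Sum>i\<in>UNIV. c i (z 1) * symm_diff q (Y i h) z) / sqrt h ^ q)"
    using dominated_divide_sqrt by simp
  then show "dominated N 0 X"
    by (rule dominated_le) (use X in eventually_elim, simp add: Y_def)
  have K_cont': "\<forall>\<^sub>F h in at_right 0. \<forall>i. continuous_on UNIV (K i h)"
    using K_cont by (rule eventually_all_finite)
  have "\<forall>\<^sub>F h in at_right 0. \<forall>i\<in>{..<N}. C_k 2 (\<lambda>(u, x). step (grid h) H i u x)"
    using H_C2 by (simp add: eventually_ball_finite_distrib)
  with X K_cont' show "\<forall>\<^sub>F h in at_right 0. (\<lambda>\<omega>. X h (\<lambda>i. Z i \<omega>)) \<in> borel_measurable M"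
  proof eventually_elim
    case (elim h)
    have H_cont: "continuous_on UNIV (\<lambda>(u, x). step (grid h) H i u x)" if "i < N" for i
      by (rule C_k_continuous) (use elim(3) that in blast)
    have Z_meas: "Z i \<in> borel_measurable M" if "i \<in> {1..N}" for i
      using Z[OF that] unfolding std_normal_vector_def by (auto dest: distributed_measurable)
    have Y_meas: "(\<lambda>\<omega>. Y i h (\<lambda>j. V j \<omega>)) \<in> borel_measurable M"
      if V: "\<And>j. j \<in> {1..N} \<Longrightarrow> V j \<in> borel_measurable M" for i V
    proof -
      have "(\<lambda>\<omega>. states (grid h) H s (\<lambda>j. V j \<omega>) :: (real^'n, 'm) vec) \<in> borel_measurable M"
        unfolding states_def
        by (intro borel_measurable_vec_lambda path_measurable[of N] V H_cont)
          (use states_index_le in \<open>auto simp: N_def\<close>)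
      then have "(\<lambda>\<omega>. F (states (grid h) H s (\<lambda>j. V j \<omega>))) \<in> borel_measurable M"
        by (rule borel_measurable_continuous_on[OF F_cont])
      moreover have "(\<lambda>\<omega>. K i h (sqrt h *\<^sub>R V 1 \<omega>)) \<in> borel_measurable M"
        using elim(2) V[of 1] N
        by (intro borel_measurable_continuous_on[of "K i h"] borel_measurable_scaleR borel_measurable_const) auto
      ultimately show ?thesis unfolding Y_def by (rule borel_measurable_times)
    qed
    have hat: "hat (\<lambda>i. Z i \<omega>) = (\<lambda>i. (if i = 1 then - Z 1 \<omega> else Z i \<omega>))"
      and bar: "bar (\<lambda>i. Z i \<omega>) = (\<lambda>i. (if i = 1 then 0 else Z i \<omega>))" for \<omega>
      by (auto simp: hat_def bar_def)
    have "(\<lambda>\<omega>. Y i h (\<lambda>j. Z j \<omega>)) \<in> borel_measurable M" for i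
      by (intro Y_meas Z_meas)
    moreover have "(\<lambda>\<omega>. Y i h (hat (\<lambda>j. Z j \<omega>))) \<in> borel_measurable M" for i
      unfolding hat by (rule Y_meas) (use Z_meas N in auto)
    moreover have "(\<lambda>\<omega>. Y i h (bar (\<lambda>j. Z j \<omega>))) \<in> borel_measurable M" for i
      unfolding bar by (rule Y_meas) (use Z_meas N in auto)
    ultimately have "(\<lambda>\<omega>. symm_diff q (Y i h) (\<lambda>j. Z j \<omega>)) \<in> borel_measurable M" for i
      unfolding symm_diff_def by (cases "q = 1") (auto intro: borel_measurable_add borel_measurable_diff borel_measurable_times)
    moreover have "(\<lambda>\<omega>. c i (Z 1 \<omega>)) \<in> borel_measurable M" for i
      using Z_meas[of 1] N by (intro borel_measurable_continuous_on[OF c_cont]) auto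
    ultimately have "(\<lambda>\<omega>. (\<Sum>i\<in>UNIV. c i (Z 1 \<omega>) * symm_diff q (Y i h) (\<lambda>j. Z j \<omega>)) / sqrt h ^ q)
        \<in> borel_measurable M"
      by (intro borel_measurable_divide borel_measurable_sum borel_measurable_times borel_measurable_const)
    then show ?case using elim(1) by (simp add: Y_def)
  qed
qed

text \<open>
  Exchanging the names of the summation indices in the last double sum exhibits the matrix as linear in
  \<open>z\<close>.
\<close>

lemma Lambda1_entry:
  "Lambda1 H0 s z x $ l $ m = (\<Sum>p\<in>UNIV. z $ p * (dsJ H0 m p l s x
     - (\<Sum>r\<in>UNIV. Jmat H0 s x $ r $ m * dxJ H0 r p l s x)
     - (\<Sum>r\<in>UNIV. dxJ H0 r r m s x * Jmat H0 s x $ p $ l)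
     - (\<Sum>r\<in>UNIV. Jmat H0 s x $ p $ m * dxJ H0 r r l s x)))"
proof -
  have "(\<Sum>p\<in>UNIV. \<Sum>r\<in>UNIV. z $ r * Jmat H0 s x $ r $ m * dxJ H0 p p l s x)
      = (\<Sum>p\<in>UNIV. \<Sum>r\<in>UNIV. z $ p * Jmat H0 s x $ p $ m * dxJ H0 r r l s x)"
    by (rule sum.swap)
  then show ?thesis
    by (simp add: Lambda1_def right_diff_distrib sum_subtractf sum_distrib_left mult.assoc)
qed

theorem theorem3p8:
  fixes M :: "'w measure"
    and t :: "nat \<Rightarrow> real"
    and H :: "nat \<Rightarrow> real \<Rightarrow> real \<Rightarrow> real^'n \<Rightarrow> real^'n \<Rightarrow> real^'n"
    and F :: "real^'n^'m::{finite,linorder} \<Rightarrow> real"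
    and s :: "real^'n"
    and Z :: "nat \<Rightarrow> 'w \<Rightarrow> real^'n"
  defines "N \<equiv> CARD('m)"
    and "grid \<equiv> (\<lambda>h. t(1 := h))"
  assumes prob: "prob_space M"
    and Z_indep: "prob_space.indep_vars M (\<lambda>_. borel) Z {1..N}"
    and Z_normal: "\<And>i. i \<in> {1..N} \<Longrightarrow> std_normal_vector M (Z i)"
    and t0: "t 0 = 0"
    and t_mono: "strict_mono_on {0..N} t"
    and s_pos: "\<And>k. 0 < s $ k"
    \<comment> \<open>standing assumptions on the first step; the two uniformity clauses concern its
        dependence on \<open>h\<close> and are automatic if there is none\<close>
    and H0_smooth: "\<forall>\<^sub>F h in at_right 0. C_inf (\<lambda>(u, x). step (grid h) H 0 u x)"
    and H0_smooth_unif: "\<And>bs. set bs \<subseteq> Basis \<Longrightarrow>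
        unif_loc_bounded (\<lambda>h. iter_pd bs (\<lambda>(u, x). step (grid h) H 0 u x))"
    and H0_inv: "\<forall>\<^sub>F h in at_right 0. \<forall>u x. invertible (dxH (step (grid h) H 0) u x)"
    and H0_inv_unif: "unif_loc_bounded (\<lambda>h (u, x). matrix_inv (dxH (step (grid h) H 0) u x))"
    \<comment> \<open>hypotheses on the functions \<open>H\<close> and on \<open>J\<close>; \<open>infnorm\<close> is the maximum of the
        absolute values of the entries\<close>
    and H_C2: "\<And>i. i < N \<Longrightarrow> \<forall>\<^sub>F h in at_right 0. C_k 2 (\<lambda>(u, x). step (grid h) H i u x)"
    and H_growth: "\<And>i bs. i < N \<Longrightarrow> set bs \<subseteq> Basis \<Longrightarrow> length bs \<le> 2 \<Longrightarrow>
        unif_poly_growth (\<lambda>h. iter_pd bs (\<lambda>(u, x). step (grid h) H i u x))"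
    and J_growth: "\<And>u. \<exists>q. real_polynomial_function q \<and>
        (\<forall>\<^sub>F h in at_right 0. \<forall>x. infnorm (Jmat (step (grid h) H 0) u x) \<le> \<bar>q x\<bar>)"
    \<comment> \<open>the payoff; \<open>weak_diff1\<close> determines it only up to a null set, and continuity selects
        the representative (the laws of the three states may be singular)\<close>
    and F_cont: "continuous_on UNIV F"
    and F_growth: "poly_growth F"
    and F_weak: "weak_diff1 F"
  shows "(\<forall>l. var_O1 M (\<lambda>h \<omega>. xi F (grid h) H s (\<lambda>i. Z i \<omega>) $ l))
    \<and> ((\<forall>u. \<exists>q. real_polynomial_function q \<and>
          (\<forall>\<^sub>F h in at_right 0. \<forall>x m p l.
             \<bar>dsJ (step (grid h) H 0) m p l u x\<bar> \<le> \<bar>q x\<bar> \<and>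
             \<bar>dxJ (step (grid h) H 0) m p l u x\<bar> \<le> \<bar>q x\<bar>))
        \<longrightarrow> (\<forall>l m. var_O1 M (\<lambda>h \<omega>. eta1 F (grid h) H s (\<lambda>i. Z i \<omega>) $ l $ m)))
    \<and> (weak_diff2 F
        \<longrightarrow> (\<forall>l m. var_O1 M (\<lambda>h \<omega>. eta2 F (grid h) H s (\<lambda>i. Z i \<omega>) $ l $ m)))"
proof -
  let ?G = "\<lambda>h. step (grid h) H 0"
  have N: "1 \<le> N" by (simp add: N_def Suc_leI)
  have dt: "dt (grid h) 1 = h" for h by (simp add: dt_def grid_def t0)
  obtain C k where "lip_poly C k F"
    using weak_diff1_imp_lip_poly[OF F_cont F_weak] by blast
  then have lip1: "unif_lip 1 (\<lambda>h::real. F)" unfolding unif_lip_def by auto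
  note var = var_O1_weighted_symm_diff[where s = s and F = F and Z = Z and t = t and H = H,
      folded N_def grid_def, OF prob Z_normal t0 H_C2 H_growth F_cont F_growth]
  have smooth: "unif_C k (\<lambda>h (u, x). Jmat (?G h) u x $ p $ l)"
    "unif_C k (\<lambda>h (u, x). dsJ (?G h) m p l u x)"
    "unif_C k (\<lambda>h (u, x). dxJ (?G h) m p l u x)" for k m p l
    by (rule unif_C_Jmat[OF H0_smooth _ H0_inv H0_inv_unif], erule H0_smooth_unif)+
  obtain qJ where qJ: "real_polynomial_function qJ"
    "\<forall>\<^sub>F h in at_right 0. \<forall>x. infnorm (Jmat (?G h) s x) \<le> \<bar>qJ x\<bar>"
    using J_growth by blast
  \<comment> \<open>The entries are the coordinates of the matrix as a vector.\<close>
  have J_entry: "\<bar>A $ p $ l\<bar> \<le> infnorm A" for A :: "real^'n^'n" and p l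
    using Basis_le_infnorm[of "axis p (axis l (1::real))" A]
    by (simp add: inner_axis axis_in_Basis_iff)
  have qJ': "\<forall>\<^sub>F h in at_right 0. \<forall>x. \<bar>Jmat (?G h) s x $ p $ l\<bar> \<le> \<bar>qJ x\<bar>" for p l
    using qJ(2) by eventually_elim (blast intro: order_trans[OF J_entry])
  note J = small_diff_unif_C[OF N smooth(1) qJ(1) qJ']
  have comp: "dominated N 0 (\<lambda>h z. (z 1 :: real^'n) $ p)" for p
    by (rule dominated_le[OF dominated_component[of 1 N]])
      (use N in \<open>auto simp: component_le_norm_cart\<close>)
  have comp_cont: "continuous_on UNIV (\<lambda>x::real^'n. x $ p)" for p
    by (intro continuous_intros)
  have "var_O1 M (\<lambda>h \<omega>. xi F (grid h) H s (\<lambda>i. Z i \<omega>) $ l)" for l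
  proof (rule var[where q = 1 and c = "\<lambda>p x. x $ p" and K = "\<lambda>p h y. Jmat (?G h) s y $ p $ l"])
    show "\<forall>\<^sub>F h in at_right 0. \<forall>z. xi F (grid h) H s z $ l = (\<Sum>p\<in>UNIV. z 1 $ p *
        symm_diff 1 (\<lambda>z. F (states (grid h) H s z) * Jmat (?G h) s (sqrt h *\<^sub>R z 1) $ p $ l) z) / sqrt h ^ 1"
      unfolding xi_def dt Theta1_def symm_diff_def
      by (intro always_eventually allI)
        (simp add: sum_distrib_left sum_subtractf right_diff_distrib mult_ac
          diff_divide_distrib sum_divide_distrib)
  qed (use lip1 J comp comp_cont in auto)
  moreover have "var_O1 M (\<lambda>h \<omega>. eta1 F (grid h) H s (\<lambda>i. Z i \<omega>) $ l $ m)"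
    if dJ: "\<forall>u. \<exists>q. real_polynomial_function q \<and>
          (\<forall>\<^sub>F h in at_right 0. \<forall>x m p l.
             \<bar>dsJ (step (grid h) H 0) m p l u x\<bar> \<le> \<bar>q x\<bar> \<and>
             \<bar>dxJ (step (grid h) H 0) m p l u x\<bar> \<le> \<bar>q x\<bar>)" for l m
  proof -
    obtain qd where qd: "real_polynomial_function qd"
      and "\<forall>\<^sub>F h in at_right 0. \<forall>x m p l.
             \<bar>dsJ (?G h) m p l s x\<bar> \<le> \<bar>qd x\<bar> \<and> \<bar>dxJ (?G h) m p l s x\<bar> \<le> \<bar>qd x\<bar>"
      using dJ by blast
    then have qs: "\<forall>\<^sub>F h in at_right 0. \<forall>x. \<bar>dsJ (?G h) m p l s x\<bar> \<le> \<bar>qd x\<bar>"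
      and qx: "\<forall>\<^sub>F h in at_right 0. \<forall>x. \<bar>dxJ (?G h) m p l s x\<bar> \<le> \<bar>qd x\<bar>" for m p l
      by (auto elim: eventually_mono)
    note ds = small_diff_unif_C[OF N smooth(2) qd qs] and dx = small_diff_unif_C[OF N smooth(3) qd qx]
    define K where "K p h y = dsJ (?G h) m p l s y
       - (\<Sum>r\<in>UNIV. Jmat (?G h) s y $ r $ m * dxJ (?G h) r p l s y)
       - (\<Sum>r\<in>UNIV. dxJ (?G h) r r m s y * Jmat (?G h) s y $ p $ l)
       - (\<Sum>r\<in>UNIV. Jmat (?G h) s y $ p $ m * dxJ (?G h) r r l s y)" for p h y
    have L: "Lambda1 (?G h) s z x $ l $ m = (\<Sum>p\<in>UNIV. z $ p * K p h x)" for h z x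
      by (simp only: Lambda1_entry K_def)
    show ?thesis
    proof (rule var[where q = 1 and c = "\<lambda>p x. x $ p" and K = K])
      show "small_diff N 1 (\<lambda>h z. K p h (sqrt h *\<^sub>R z 1))" for p
        unfolding K_def by (intro small_diff_diff small_diff_sum small_diff_mult J ds dx)
      have "\<forall>\<^sub>F h in at_right 0. \<forall>p l. continuous_on UNIV (\<lambda>y. Jmat (?G h) s y $ p $ l)"
        "\<forall>\<^sub>F h in at_right 0. \<forall>m p l. continuous_on UNIV (\<lambda>y. dsJ (?G h) m p l s y)"
        "\<forall>\<^sub>F h in at_right 0. \<forall>m p l. continuous_on UNIV (\<lambda>y. dxJ (?G h) m p l s y)"
        by (intro eventually_all_finite J ds dx)+
      then show "\<forall>\<^sub>F h in at_right 0. continuous_on UNIV (K p h)" for p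
        unfolding K_def
        by eventually_elim (intro continuous_on_diff continuous_on_sum continuous_on_mult; blast)
      show "\<forall>\<^sub>F h in at_right 0. \<forall>z. eta1 F (grid h) H s z $ l $ m = (\<Sum>p\<in>UNIV. z 1 $ p *
          symm_diff 1 (\<lambda>z. F (states (grid h) H s z) * K p h (sqrt h *\<^sub>R z 1)) z) / sqrt h ^ 1"
        unfolding eta1_def dt symm_diff_def
        by (intro always_eventually allI)
          (simp add: L sum_distrib_left sum_subtractf right_diff_distrib mult_ac
          diff_divide_distrib sum_divide_distrib)
    qed (use lip1 comp comp_cont in auto)
  qed
  moreover have "var_O1 M (\<lambda>h \<omega>. eta2 F (grid h) H s (\<lambda>i. Z i \<omega>) $ l $ m)"
    if w2: "weak_diff2 F" for l m
  proof -
    obtain C2 k2 where "lip2_poly C2 k2 F"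
      using weak_diff2_imp_lip2_poly[OF F_cont w2] by blast
    then have lip2: "unif_lip 2 (\<lambda>h::real. F)" using \<open>lip_poly C k F\<close> unfolding unif_lip_def by auto
    define c where "c = (\<lambda>(p, r) (x :: real^'n). x $ r * x $ p - (if r = p then 1 else 0))"
    define K where "K = (\<lambda>(p, r) h y. Jmat (?G h) s y $ r $ m * Jmat (?G h) s y $ p $ l)"
    show ?thesis
    proof (rule var[where q = 2 and c = c and K = K])
      show "small_diff N 2 (\<lambda>h z. K i h (sqrt h *\<^sub>R z 1))" for i
        unfolding K_def by (cases i) (simp only: prod.case, intro small_diff_mult J)
      have "\<forall>\<^sub>F h in at_right 0. \<forall>p l. continuous_on UNIV (\<lambda>y. Jmat (?G h) s y $ p $ l)"
        by (intro eventually_all_finite J)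
      then show "\<forall>\<^sub>F h in at_right 0. continuous_on UNIV (K i h)" for i
        unfolding K_def
        by eventually_elim (simp split: prod.split add: continuous_on_mult)
      have "dominated N 0 (\<lambda>h z. (z 1 :: real^'n) $ r * z 1 $ p - (if r = p then 1 else 0))" for p r :: 'n
        by (rule dominated_diff[OF _ dominated_const]) (use dominated_mult[OF comp comp] in simp)
      then show "dominated N 0 (\<lambda>h z. c i (z 1))" for i
        unfolding c_def by (cases i) auto
      show "continuous_on UNIV (c i)" for i
        unfolding c_def by (cases i) (auto intro!: continuous_intros)
      show "\<forall>\<^sub>F h in at_right 0. \<forall>z. eta2 F (grid h) H s z $ l $ m = (\<Sum>i\<in>UNIV. c i (z 1) *
          symm_diff 2 (\<lambda>z. F (states (grid h) H s z) * K i h (sqrt h *\<^sub>R z 1)) z) / sqrt h ^ 2"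
        using eventually_at_right_less[of 0]
      proof eventually_elim
        case (elim h)
        have L: "Lambda2 (?G h) s z x $ l $ m = (\<Sum>i\<in>UNIV. c i z * K i h x)" for z x
        proof -
          have "Lambda2 (?G h) s z x $ l $ m = (\<Sum>p\<in>UNIV. \<Sum>r\<in>UNIV. c (p, r) z * K (p, r) h x)"
            by (simp add: Lambda2_def c_def K_def mult.assoc)
          also have "\<dots> = (\<Sum>i\<in>UNIV \<times> UNIV. c i z * K i h x)"
            by (simp add: sum.cartesian_product case_prod_unfold)
          finally show ?thesis by simp
        qed
        show ?case
          using elim unfolding eta2_def dt symm_diff_def
          by (auto simp: L sum_distrib_left sum_subtractf sum.distrib right_diff_distrib distrib_left mult_ac
            diff_divide_distrib add_divide_distrib sum_divide_distrib)
      qed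
    qed (use lip2 in auto)
  qed
  ultimately show ?thesis by blast
qed

end
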